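(* Let $d\ge2$, $\nu>0$, and let $u_0\in L^\infty(\mathbb R^d)$ satisfy, for some constants $C,\sigma>0$, $|u_0(x)|\le C\,G_{\nu\sigma}(x)$ for a.e. $x\in\mathbb R^d$. Let $u$ be the strong solution to the incompressible Navier–Stokes equations generated by $u_0$, with maximal lifespan $0<T_{max}\le\infty$. Then for any $(x,t)$ with $|x|\ge1$ and $t\in(0,T_{max})$, $$u(x,t)=-\sum_{|\alpha|=0}^{d-1}\frac{(-1)^{|\alpha|}}{\alpha!}\sum_{i,j=1}^d\nabla\partial^\alpha \mathrm K_{i,j}(x)\int_0^t \mathrm M_\alpha^{i,j}(s)\,ds+\mathrm R(x,t),$$ where the remainder satisfies, for any $[0,T]\subset[0,T_{max})$, $$\sup_{t\in[0,T]}|\mathrm R(x,t)|=O\big(|x|^{-2d-1}\big)\quad\text{as }|x|\to\infty.$$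
   Context: $G_t(x)=(4\pi t)^{-d/2}e^{-|x|^2/(4t)}$. $\Gamma$ is the fundamental solution of the Laplacian, $-\Delta\Gamma=\delta_0$ on $\mathbb R^d$, and $\mathrm K_{i,j}:=\partial_i\partial_j\Gamma$. The moments are $\mathrm M_\alpha^{i,j}(t):=\int_{\mathbb R^d}y^\alpha u^i(y,t)u^j(y,t)\,dy$, $\alpha\in\mathbb N_0^d$ a multi-index. The incompressible Navier–Stokes system on $\mathbb R^d$ with viscosity $\nu>0$ is $\partial_tu+\mathrm{div}(u\otimes u)+\nabla p=\nu\Delta u$, $\mathrm{div}\,u=0$. For $d\le p\le\infty$, $u\in C([0,T);L^p)$ is the strong (mild) solution arising from $u_0\in L^p$ if $$u(x,t)=G_{\nu t}*u_0(x)-\int_0^tG_{\nu(t-s)}*\mathcal P\,\mathrm{div}\big(u(s)\otimes u(s)\big)(x)\,ds$$ holds in $C([0,T);L^p)$ and for a.e. $(x,t)\in\mathbb R^d\times[0,T)$, where $\mathcal P=\mathrm{Id}+\nabla(-\Delta)^{-1}\mathrm{div}$ is the Leray projector. For $u_0\in L^\infty$ the maximal lifespan is $T_{max}:=\sup\{T>0:\ \text{there exists a unique solution }u\in C([0,T];L^\infty)\text{ with }u(0)=u_0\}$. *)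

theory Defs
  imports "HOL-Analysis.Analysis" "HOL-Probability.Essential_Supremum"
begin

section \<open>Differential operators on \<open>\<real>\<^sup>d\<close>\<close>

definition partial :: "'n::finite \<Rightarrow> (real^'n \<Rightarrow> real) \<Rightarrow> real^'n \<Rightarrow> real" where
  "partial i f x = deriv (\<lambda>h. f (x + h *\<^sub>R axis i 1)) 0"

definition gradient :: "(real^'n::finite \<Rightarrow> real) \<Rightarrow> real^'n \<Rightarrow> real^'n" where
  "gradient f x = (\<chi> k. partial k f x)"

definition divergence :: "(real^'n::finite \<Rightarrow> real^'n) \<Rightarrow> real^'n \<Rightarrow> real" where
  "divergence v x = (\<Sum>j\<in>UNIV. partial j (\<lambda>y. v y $ j) x)"

text \<open>
  Multi-indices are functions \<open>'n \<Rightarrow> nat\<close>. The index type carries no order, so \<open>\<partial>\<^sup>\<alpha>\<close> composes the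
  partial derivatives along an arbitrary fixed enumeration of it. The order of composition is
  irrelevant for functions that are smooth near the point of evaluation.
\<close>

definition index_list :: "'n::finite list" where
  "index_list = (SOME is. distinct is \<and> set is = UNIV)"

definition multi_partial ::
    "('n::finite \<Rightarrow> nat) \<Rightarrow> (real^'n \<Rightarrow> real) \<Rightarrow> real^'n \<Rightarrow> real" where
  "multi_partial \<alpha> = foldr (\<lambda>i g. (partial i ^^ \<alpha> i) \<circ> g) index_list id"

definition multi_order :: "('n::finite \<Rightarrow> nat) \<Rightarrow> nat" where
  "multi_order \<alpha> = (\<Sum>i\<in>UNIV. \<alpha> i)"

definition multi_fact :: "('n::finite \<Rightarrow> nat) \<Rightarrow> real" where
  "multi_fact \<alpha> = (\<Prod>i\<in>UNIV. fact (\<alpha> i))"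

definition multi_power :: "real^'n::finite \<Rightarrow> ('n \<Rightarrow> nat) \<Rightarrow> real" where
  "multi_power y \<alpha> = (\<Prod>i\<in>UNIV. (y $ i) ^ \<alpha> i)"


section \<open>Kernels\<close>

definition heat_kernel :: "real \<Rightarrow> real^'n::finite \<Rightarrow> real" where
  "heat_kernel t x =
     (4 * pi * t) powr (- real CARD('n) / 2) * exp (- (norm x)\<^sup>2 / (4 * t))"

text \<open>
  The fundamental solution of \<open>-\<Delta>\<close> with the usual normalisation: logarithmic for \<open>d = 2\<close>, and
  vanishing at infinity for \<open>d \<ge> 3\<close>. The value at the origin is immaterial.
\<close>

definition fund_sol :: "real^'n::finite \<Rightarrow> real" where
  "fund_sol x =
     (if CARD('n) = 2 then - ln (norm x) / (2 * pi)
      else norm x powr (2 - real CARD('n)) /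
           (real CARD('n) * (real CARD('n) - 2) * unit_ball_vol (real CARD('n))))"

definition K_ker :: "'n::finite \<Rightarrow> 'n \<Rightarrow> real^'n \<Rightarrow> real" where
  "K_ker i j = partial i (partial j fund_sol)"


section \<open>Mild solutions of the Navier--Stokes equations\<close>

definition inv_neg_laplacian :: "(real^'n::finite \<Rightarrow> real) \<Rightarrow> real^'n \<Rightarrow> real" where
  "inv_neg_laplacian g x = (LINT y|lebesgue. fund_sol (x - y) * g y)"

text \<open>
  \<open>P = Id + \<nabla>(-\<Delta>)\<^sup>-\<^sup>1 div\<close>, applied below only to Gaussian fields, where the integral
  converges absolutely.
\<close>

definition leray :: "(real^'n::finite \<Rightarrow> real^'n) \<Rightarrow> real^'n \<Rightarrow> real^'n" where
  "leray v x = v x + gradient (inv_neg_laplacian (divergence v)) x"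

definition heat_conv :: "real \<Rightarrow> (real^'n::finite \<Rightarrow> real^'n) \<Rightarrow> real^'n \<Rightarrow> real^'n" where
  "heat_conv t f x = (LINT y|lebesgue. heat_kernel t (x - y) *\<^sub>R f y)"

text \<open>
  The operator \<open>F \<mapsto> G\<^sub>t * P div F\<close> on bounded matrix fields. Since \<open>P\<close> is not defined on
  \<open>L\<^sup>\<infinity>\<close>, it is, as usual, the convolution of \<open>F\<close> with the (integrable) first derivatives of the
  Oseen kernel, whose \<open>j\<close>-th column is \<open>P (G\<^sub>t e\<^sub>j)\<close>; here \<open>(div F)\<^sub>j = \<Sum>\<^sub>i \<partial>\<^sub>i F\<^sub>i\<^sub>j\<close>.
\<close>

definition oseen :: "real \<Rightarrow> 'n::finite \<Rightarrow> 'n \<Rightarrow> real^'n \<Rightarrow> real" where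
  "oseen t k j x = leray (\<lambda>y. heat_kernel t y *\<^sub>R axis j 1) x $ k"

definition heat_leray_div ::
    "real \<Rightarrow> (real^'n::finite \<Rightarrow> real^'n^'n) \<Rightarrow> real^'n \<Rightarrow> real^'n" where
  "heat_leray_div t F x =
     (\<chi> k. \<Sum>i\<in>UNIV. \<Sum>j\<in>UNIV. LINT y|lebesgue. partial i (oseen t k j) (x - y) * F y $ i $ j)"

definition tensor :: "real^'n::finite \<Rightarrow> real^'n \<Rightarrow> real^'n^'n" where
  "tensor v w = (\<chi> i j. v $ i * w $ j)"

definition Linf_norm :: "(real^'n::finite \<Rightarrow> real^'n) \<Rightarrow> ereal" where
  "Linf_norm f = esssup lebesgue (\<lambda>x. ereal (norm (f x)))"

definition in_Linf :: "(real^'n::finite \<Rightarrow> real^'n) \<Rightarrow> bool" where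
  "in_Linf f \<longleftrightarrow> f \<in> borel_measurable lebesgue \<and> Linf_norm f < \<infinity>"

text \<open>
  \<open>u \<in> C(I; L\<^sup>\<infinity>)\<close>, \<open>u(0) = u\<^sub>0\<close> and Duhamel's formula, for a time interval \<open>I\<close> with left endpoint
  \<open>0 \<in> I\<close>. Elements of \<open>L\<^sup>\<infinity>\<close> are represented by functions, so all identities between them are
  almost-everywhere identities. The formula at \<open>t = 0\<close> (where \<open>G\<^sub>0 = \<delta>\<^sub>0\<close>) is the initial condition.
\<close>

definition strong_solution ::
    "real \<Rightarrow> (real^'n::finite \<Rightarrow> real^'n) \<Rightarrow> real set \<Rightarrow> (real \<Rightarrow> real^'n \<Rightarrow> real^'n) \<Rightarrow> bool" where
  "strong_solution \<nu> u0 I u \<longleftrightarrow>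
     (\<forall>t\<in>I. in_Linf (u t)) \<and>
     (\<forall>t\<in>I. ((\<lambda>s. Linf_norm (\<lambda>x. u s x - u t x)) \<longlongrightarrow> 0) (at t within I)) \<and>
     (AE x in lebesgue. u 0 x = u0 x) \<and>
     (\<forall>t\<in>I. 0 < t \<longrightarrow>
        (AE x in lebesgue. u t x =
           heat_conv (\<nu> * t) u0 x
           - (LINT s:{0..t}|lebesgue.
                heat_leray_div (\<nu> * (t - s)) (\<lambda>y. tensor (u s y) (u s y)) x)))"

definition max_lifespan :: "real \<Rightarrow> (real^'n::finite \<Rightarrow> real^'n) \<Rightarrow> ereal" where
  "max_lifespan \<nu> u0 = Sup {ereal T | T. 0 < T \<and>
     (\<exists>u. strong_solution \<nu> u0 {0..T} u) \<and>
     (\<forall>u v. strong_solution \<nu> u0 {0..T} u \<and> strong_solution \<nu> u0 {0..T} v \<longrightarrow>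
        (\<forall>t\<in>{0..T}. AE x in lebesgue. u t x = v t x))}"

definition moment ::
    "(real \<Rightarrow> real^'n::finite \<Rightarrow> real^'n) \<Rightarrow> ('n \<Rightarrow> nat) \<Rightarrow> 'n \<Rightarrow> 'n \<Rightarrow> real \<Rightarrow> real" where
  "moment u \<alpha> i j t = (LINT y|lebesgue. multi_power y \<alpha> * (u t y $ i) * (u t y $ j))"

end

theory Submission
  imports Defs "HOL-Probability.Distributions"
begin

text \<open>
  Subordination to Gaussians gives \<open>\<partial>\<^sub>j \<Gamma> * G\<^sub>\<tau> = \<integral>\<^bsub>\<tau>\<^esub>\<^bsup>\<infinity>\<^esup> \<partial>\<^sub>j G\<^sub>s ds\<close>, so the first derivatives of the Oseen
  kernel at time \<open>\<tau>\<close> are bounded by a multiple of \<open>(\<surd>\<tau> + |x|) ^ (- d - 1)\<close>, whose integral is of order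
  \<open>\<tau> ^ (- 1 / 2)\<close>, and differ from \<open>\<partial>\<^sub>k K\<^sub>i\<^sub>j\<close> by \<open>O(\<tau> ^ N |x| ^ (- d - 1 - 2 N))\<close> for every \<open>N\<close>. A
  Gronwall argument in the norm with the weight \<open>(1 + |x|) ^ (d + 1)\<close> (truncated, so that the norm is finite a priori) shows
  \<open>u = O(|x| ^ (- d - 1))\<close> on compact time intervals. Hence \<open>u \<otimes> u = O(|x| ^ (- 2 d - 2))\<close> has absolutely convergent moments
  up to order \<open>d\<close>. In Duhamel's formula one replaces the kernel at \<open>x - y\<close> by the Taylor polynomial of
  \<open>\<partial>\<^sub>k K\<^sub>i\<^sub>j\<close> at \<open>x\<close> of degree \<open>d - 1\<close>. For \<open>|y| \<le> |x| / 2\<close> the error is \<open>O(|y| ^ d |x| ^ (- 2 d - 1))\<close>, and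
  for larger \<open>|y|\<close> the decay of \<open>u \<otimes> u\<close> suffices.
\<close>

section \<open>Homogeneous functions and their Taylor polynomials\<close>

text \<open>For d = 2 the fundamental solution is a logarithm and not a convergent superposition of
  Gaussians; only its differences are, and the additive constant this leaves disappears because
  \<partial>_j G has mean zero. The kernel decays no faster than |x| ^ (-d-1), so the Gronwall
  argument yields no better weight even for Gaussian data. That argument is linear: one factor of u
  \<otimes> u is estimated by the sup bound on the compact interval and only the other carries the
  weight, so no smallness of data or time enters. Moreover u(t) is a class modulo null sets:
  continuity in time gives convergence almost everywhere only along a sequence, with a null set
  depending on it. Hence continuity of parameter integrals is proved sequentially, and pointwise
  statements are made for the representative given by Duhamel's formula. Higher derivatives of K are
  never computed: a class of functions closed under differentiation provides their size and the
  symmetry of mixed derivatives, which makes the arbitrary enumeration in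
  \<open>multi_partial\<close> harmless.\<close>

lemma partial_eqI:
  fixes f :: "real^'n::finite \<Rightarrow> real"
  assumes "(f has_derivative L) (at x)"
  shows "partial i f x = L (axis i 1)"
proof -
  have L: "linear L" using assms has_derivative_linear by blast
  have "((\<lambda>h. f (x + h *\<^sub>R axis i 1)) has_derivative (\<lambda>h. L (h *\<^sub>R axis i 1))) (at 0)"
  proof -
    have g: "((\<lambda>h. x + h *\<^sub>R axis i 1) has_derivative (\<lambda>h. h *\<^sub>R axis i 1)) (at (0::real))"
      by (auto intro!: derivative_eq_intros)
    show ?thesis
      using has_derivative_compose[OF g] assms by simp
  qed
  then have "((\<lambda>h. f (x + h *\<^sub>R axis i 1)) has_field_derivative L (axis i 1)) (at 0)"
    using linear_scale[OF L] by (simp add: has_field_derivative_def mult.commute[of _ "L (axis i 1)"])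
  then show ?thesis unfolding partial_def by (rule DERIV_imp_deriv)
qed

lemma sum_axis_mult: "(\<Sum>j\<in>UNIV. axis i (1::real) $ j * D j) = D (i::'n::finite)"
  by (simp add: axis_def if_distrib[of "\<lambda>t. t * _"] cong: if_cong)

lemma partial_cong_open:
  assumes "open S" "x \<in> S" "\<And>y. y \<in> S \<Longrightarrow> f y = g y"
  shows "partial i f x = partial i g x"
proof -
  have "continuous (at 0) (\<lambda>h. x + h *\<^sub>R axis i (1::real))" by (intro continuous_intros)
  then have "((\<lambda>h. x + h *\<^sub>R axis i (1::real)) \<longlongrightarrow> x) (nhds 0)"
    unfolding continuous_at using tendsto_at_iff_tendsto_nhds[of "\<lambda>h. x + h *\<^sub>R axis i (1::real)" 0] by simp
  then have "\<forall>\<^sub>F h in nhds 0. x + h *\<^sub>R axis i (1::real) \<in> S"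
    using assms(1,2) by (rule topological_tendstoD)
  then have "\<forall>\<^sub>F h in nhds 0. f (x + h *\<^sub>R axis i (1::real)) = g (x + h *\<^sub>R axis i 1)"
    by eventually_elim (use assms(3) in auto)
  then show ?thesis unfolding partial_def by (intro deriv_cong_ev) auto
qed

text \<open>
  Functions on the punctured space that are, up to finite sums, products of coordinates with powers
  of \<open>norm x\<close>. They are homogeneous of degree \<open>-a\<close>; values at the origin are disregarded.
\<close>

inductive homog :: "int \<Rightarrow> (real^'n::finite \<Rightarrow> real) \<Rightarrow> bool" where
  homog_zero: "homog a (\<lambda>_. 0)"
| homog_const: "homog 0 (\<lambda>_. c)"
| homog_coord: "homog (-1) (\<lambda>x. x $ i)"
| homog_inverse_norm: "homog 1 (\<lambda>x. inverse (norm x))"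
| homog_add: "homog a f \<Longrightarrow> homog a g \<Longrightarrow> homog a (\<lambda>x. f x + g x)"
| homog_mult: "homog a f \<Longrightarrow> homog b g \<Longrightarrow> homog (a + b) (\<lambda>x. f x * g x)"
| homog_cong: "homog a f \<Longrightarrow> (\<forall>x. x \<noteq> 0 \<longrightarrow> g x = f x) \<Longrightarrow> homog a g"

lemma homog_cmult: "homog a f \<Longrightarrow> homog a (\<lambda>x. c * f x)"
  using homog_mult[OF homog_const, of a f c] by simp

lemma homog_power: "homog a f \<Longrightarrow> homog (int n * a) (\<lambda>x. f x ^ n)"
proof (induction n)
  case (Suc n)
  have "homog (a + int n * a) (\<lambda>x. f x * f x ^ n)" using Suc by (intro homog_mult) auto
  then show ?case by (simp add: algebra_simps)
qed (simp add: homog_const)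

lemma homog_bound:
  fixes f :: "real^'n::finite \<Rightarrow> real"
  assumes "homog a f"
  shows "\<exists>C\<ge>0. \<forall>x. x \<noteq> 0 \<longrightarrow> \<bar>f x\<bar> \<le> C * norm x powi (- a)"
  using assms
proof (induction rule: homog.induct)
  case (homog_zero a)
  then show ?case by auto
next
  case (homog_const c)
  then show ?case by (intro exI[of _ "\<bar>c\<bar>"]) auto
next
  case (homog_coord i)
  show ?case by (intro exI[of _ 1]) (use component_le_norm_cart in auto)
next
  case homog_inverse_norm
  then show ?case by (intro exI[of _ 1]) (auto simp: power_int_minus)
next
  case (homog_add a f g)
  then obtain C D where "C \<ge> 0" "D \<ge> 0" "\<forall>x. x \<noteq> 0 \<longrightarrow> \<bar>f x\<bar> \<le> C * norm x powi (- a)"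
    "\<forall>x. x \<noteq> 0 \<longrightarrow> \<bar>g x\<bar> \<le> D * norm x powi (- a)" by blast
  then show ?case
    by (intro exI[of _ "C + D"]) (force simp: distrib_right intro: order_trans[OF abs_triangle_ineq add_mono])
next
  case (homog_mult a f b g)
  then obtain C D where "C \<ge> 0" "D \<ge> 0" and *: "\<forall>x. x \<noteq> 0 \<longrightarrow> \<bar>f x\<bar> \<le> C * norm x powi (- a)"
    "\<forall>x. x \<noteq> 0 \<longrightarrow> \<bar>g x\<bar> \<le> D * norm x powi (- b)" by blast
  show ?case
  proof (intro exI[of _ "C * D"] conjI allI impI)
    fix x :: "real^'n" assume "x \<noteq> 0"
    have "\<bar>f x * g x\<bar> \<le> (C * norm x powi (- a)) * (D * norm x powi (- b))"
      unfolding abs_mult using * \<open>x \<noteq> 0\<close> \<open>C \<ge> 0\<close> by (intro mult_mono) auto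
    also have "\<dots> = C * D * norm x powi (- (a + b))"
      using \<open>x \<noteq> 0\<close> power_int_add[of "norm x" "-a" "-b"] by (simp add: algebra_simps)
    finally show "\<bar>f x * g x\<bar> \<le> C * D * norm x powi (- (a + b))" .
  qed (use \<open>C \<ge> 0\<close> \<open>D \<ge> 0\<close> in auto)
next
  case (homog_cong a f g)
  then show ?case by auto
qed

abbreviation "jac D \<equiv> \<lambda>x h. \<Sum>i\<in>UNIV. h $ i * D i x"

text \<open>The second derivatives \<open>E\<close> travel through the induction for their symmetry
  alone, which the sum and product rules preserve; this takes the place of Schwarz's theorem.
  Homogeneity is claimed only for \<open>D\<close>, because the lemma can then be applied to each
  \<open>D i\<close> again.\<close>

lemma homog_derivatives:
  fixes f :: "real^'n::finite \<Rightarrow> real"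
  assumes "homog a f"
  shows "\<exists>D E. (\<forall>i. homog (a + 1) (D i)) \<and>
    (\<forall>x. x \<noteq> 0 \<longrightarrow> (f has_derivative (jac D x)) (at x)) \<and>
    (\<forall>i x. x \<noteq> 0 \<longrightarrow> (D i has_derivative (jac (E i) x)) (at x)) \<and>
    (\<forall>i j x. x \<noteq> 0 \<longrightarrow> E i j x = E j i x)"
  using assms
proof (induction rule: homog.induct)
  case (homog_zero a)
  show ?case
    by (intro exI[of _ "\<lambda>i x. 0"] exI[of _ "\<lambda>i j x. 0"]) (auto intro: homog.homog_zero)
next
  case (homog_const c)
  show ?case
    by (intro exI[of _ "\<lambda>i x. 0"] exI[of _ "\<lambda>i j x. 0"]) (auto intro: homog.homog_zero)
next
  case (homog_coord i)
  have "homog 0 (\<lambda>x::real^'n. if k = i then 1 else 0)" for k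
    by (rule homog.homog_const)
  moreover have "((\<lambda>x::real^'n. x $ i) has_derivative (\<lambda>h. \<Sum>k\<in>UNIV. h $ k * (if k = i then 1 else 0))) (at x)" for x
    using bounded_linear_imp_has_derivative[OF bounded_linear_vec_nth[of i]] by (simp add: if_distrib cong: if_cong)
  ultimately show ?case
    by (intro exI[of _ "\<lambda>k x. if k = i then 1 else 0"] exI[of _ "\<lambda>i j x. 0"]) auto
next
  case homog_inverse_norm
  let ?D = "\<lambda>i (x::real^'n). - (x $ i * inverse (norm x) ^ 3)"
  let ?E = "\<lambda>i j (x::real^'n). 3 * x $ i * x $ j * inverse (norm x) ^ 5 - (if i = j then inverse (norm x) ^ 3 else 0)"
  have h3: "homog 3 (\<lambda>x::real^'n. inverse (norm x) ^ 3)"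
    using homog_power[OF homog.homog_inverse_norm, of 3] by simp
  have h: "homog 2 (?D i)" for i
    using homog_cmult[OF homog_mult[OF homog_coord[of i] h3], of "-1"] by simp
  have d: "((\<lambda>x::real^'n. inverse (norm x)) has_derivative (jac ?D x)) (at x)" if "x \<noteq> 0" for x
  proof -
    have "((\<lambda>x::real^'n. inverse (norm x)) has_derivative (\<lambda>h. - (inverse (norm x) * (h \<bullet> sgn x) * inverse (norm x)))) (at x)"
      using that by (auto intro!: derivative_eq_intros has_derivative_norm[THEN has_derivative_eq_rhs] simp: inner_commute)
    moreover have "(\<lambda>h. - (inverse (norm x) * (h \<bullet> sgn x) * inverse (norm x))) = (jac ?D x)"
      using that by (auto simp: fun_eq_iff sgn_div_norm inner_vec_def sum_distrib_left sum_distrib_right sum_negf[symmetric] power3_eq_cube intro!: sum.cong)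
    ultimately show ?thesis by simp
  qed
  have e: "(?D i has_derivative (jac (?E i) x)) (at x)" if "x \<noteq> 0" for x i
  proof -
    have "(?D i has_derivative (\<lambda>h. - (x $ i * (3 * (jac ?D x h) * inverse (norm x) ^ 2) + h $ i * inverse (norm x) ^ 3))) (at x)"
    proof -
      have "((\<lambda>x. x $ i) has_derivative (\<lambda>h. h $ i)) (at x)"
        by (rule bounded_linear_imp_has_derivative[OF bounded_linear_vec_nth])
      from has_derivative_minus[OF has_derivative_mult[OF this has_derivative_power[OF d[OF that], of 3]]]
      show ?thesis by simp
    qed
    moreover have "- (x $ i * (3 * (jac ?D x h) * inverse (norm x) ^ 2) + h $ i * inverse (norm x) ^ 3) = jac (?E i) x h" for h
    proof -
      have "(\<Sum>j\<in>UNIV. h $ j * (if i = j then inverse (norm x) ^ 3 else 0)) = h $ i * inverse (norm x) ^ 3"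
        by (simp add: if_distrib[of "\<lambda>t. _ * t"] cong: if_cong)
      moreover have "- (x $ i * (3 * (jac ?D x h) * inverse (norm x) ^ 2)) = (\<Sum>j\<in>UNIV. h $ j * (3 * x $ i * x $ j * inverse (norm x) ^ 5))"
        unfolding sum_distrib_left sum_distrib_right sum_negf[symmetric]
        by (intro sum.cong refl) (simp add: power_numeral_reduce algebra_simps)
      ultimately show ?thesis by (simp add: right_diff_distrib sum_subtractf)
    qed
    ultimately show ?thesis by simp
  qed
  show ?case
    by (rule exI[of _ ?D], rule exI[of _ ?E]) (use h d e in auto)
next
  case (homog_add a f g)
  then obtain D E D' E' where
    1: "\<forall>i. homog (a + 1) (D i)" "\<forall>x. x \<noteq> 0 \<longrightarrow> (f has_derivative (jac D x)) (at x)"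
      "\<forall>i x. x \<noteq> 0 \<longrightarrow> (D i has_derivative (jac (E i) x)) (at x)"
      "\<forall>i j x. x \<noteq> 0 \<longrightarrow> E i j x = E j i x" and
    2: "\<forall>i. homog (a + 1) (D' i)" "\<forall>x. x \<noteq> 0 \<longrightarrow> (g has_derivative (jac D' x)) (at x)"
      "\<forall>i x. x \<noteq> 0 \<longrightarrow> (D' i has_derivative (jac (E' i) x)) (at x)"
      "\<forall>i j x. x \<noteq> 0 \<longrightarrow> E' i j x = E' j i x" by (elim exE conjE) (rule that; assumption)
  show ?case
    apply (rule exI[of _ "\<lambda>i x. D i x + D' i x"], rule exI[of _ "\<lambda>i j x. E i j x + E' i j x"])
    using 1 2 by (auto intro!: homog.homog_add has_derivative_add simp: distrib_left sum.distrib)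
next
  case (homog_mult a f b g)
  then obtain D E D' E' where
    1: "\<forall>i. homog (a + 1) (D i)" "\<forall>x. x \<noteq> 0 \<longrightarrow> (f has_derivative (jac D x)) (at x)"
      "\<forall>i x. x \<noteq> 0 \<longrightarrow> (D i has_derivative (jac (E i) x)) (at x)"
      "\<forall>i j x. x \<noteq> 0 \<longrightarrow> E i j x = E j i x" and
    2: "\<forall>i. homog (b + 1) (D' i)" "\<forall>x. x \<noteq> 0 \<longrightarrow> (g has_derivative (jac D' x)) (at x)"
      "\<forall>i x. x \<noteq> 0 \<longrightarrow> (D' i has_derivative (jac (E' i) x)) (at x)"
      "\<forall>i j x. x \<noteq> 0 \<longrightarrow> E' i j x = E' j i x" by (elim exE conjE) (rule that; assumption)
  let ?D = "\<lambda>i x. f x * D' i x + D i x * g x"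
  let ?E = "\<lambda>i j x. (f x * E' i j x + D j x * D' i x) + (D i x * D' j x + E i j x * g x)"
  have h: "homog (a + b + 1) (?D i)" for i
    using homog.homog_mult[OF homog_mult.hyps(1), of "b + 1" "D' i"] homog.homog_mult[OF _ homog_mult.hyps(2), of "a + 1" "D i"] 1 2
    by (intro homog.homog_add) (auto simp: add_ac)
  have d: "((\<lambda>x. f x * g x) has_derivative (jac ?D x)) (at x)" if "x \<noteq> 0" for x
    using has_derivative_mult[OF 1(2)[rule_format, OF that] 2(2)[rule_format, OF that]]
    by (simp add: distrib_left sum.distrib sum_distrib_left sum_distrib_right mult_ac)
  have e: "(?D i has_derivative (jac (?E i) x)) (at x)" if "x \<noteq> 0" for x i
    using has_derivative_add[OF has_derivative_mult[OF 1(2)[rule_format, OF that] 2(3)[rule_format, OF that, of i]]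
      has_derivative_mult[OF 1(3)[rule_format, OF that, of i] 2(2)[rule_format, OF that]]]
    by (simp add: distrib_left sum.distrib sum_distrib_left sum_distrib_right mult_ac)
  have s: "?E i j x = ?E j i x" if "x \<noteq> 0" for i j x
    using 1(4)[rule_format, OF that, of i j] 2(4)[rule_format, OF that, of i j] by simp
  show ?case
    by (rule exI[of _ ?D], rule exI[of _ ?E]) (use h d e s in blast)
next
  case (homog_cong a f g)
  then obtain D E where
    1: "\<forall>i. homog (a + 1) (D i)" "\<forall>x. x \<noteq> 0 \<longrightarrow> (f has_derivative (jac D x)) (at x)"
      "\<forall>i x. x \<noteq> 0 \<longrightarrow> (D i has_derivative (jac (E i) x)) (at x)"
      "\<forall>i j x. x \<noteq> 0 \<longrightarrow> E i j x = E j i x" by (elim exE conjE) (rule that; assumption)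
  have "(g has_derivative (jac D x)) (at x)" if "x \<noteq> 0" for x
    by (rule has_derivative_transform_within_open[OF 1(2)[rule_format, OF that], of "- {0}"])
      (use that homog_cong in auto)
  then show ?case using 1 by blast
qed

text \<open>The witnesses of \<open>homog_derivatives\<close> are identified with
  \<open>partial\<close>. The punctured space is open, so \<open>partial j f\<close> may be replaced
  by \<open>D j\<close> near the point before differentiating once more.\<close>

lemma homog_partial:
  assumes "homog a f"
  shows "homog (a + 1) (partial i f)"
    and "x \<noteq> 0 \<Longrightarrow> (f has_derivative (\<lambda>h. \<Sum>i\<in>UNIV. h $ i * partial i f x)) (at x)"
    and "x \<noteq> 0 \<Longrightarrow> partial i (partial j f) x = partial j (partial i f) x"
proof -
  obtain D E where
    1: "\<forall>i. homog (a + 1) (D i)" "\<forall>x. x \<noteq> 0 \<longrightarrow> (f has_derivative (jac D x)) (at x)"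
      "\<forall>i x. x \<noteq> 0 \<longrightarrow> (D i has_derivative (jac (E i) x)) (at x)"
      "\<forall>i j x. x \<noteq> 0 \<longrightarrow> E i j x = E j i x" using homog_derivatives[OF assms] by (elim exE conjE) (rule that; assumption)
  have p: "partial i f x = D i x" if "x \<noteq> 0" for i x
    using partial_eqI[OF 1(2)[rule_format, OF that]] by (simp add: sum_axis_mult)
  show "homog (a + 1) (partial i f)"
    using homog_cong[of "a + 1" "D i" "partial i f"] 1(1) p by blast
  show "x \<noteq> 0 \<Longrightarrow> (f has_derivative (\<lambda>h. \<Sum>i\<in>UNIV. h $ i * partial i f x)) (at x)"
    using 1(2) p by simp
  have q: "partial i (partial j f) x = E j i x" if "x \<noteq> 0" for i j x
  proof -
    have "partial i (partial j f) x = partial i (D j) x"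
      by (rule partial_cong_open[of "-{0}"]) (use that p in auto)
    also have "\<dots> = E j i x"
      using partial_eqI[OF 1(3)[rule_format, OF that]] by (simp add: sum_axis_mult)
    finally show ?thesis .
  qed
  show "x \<noteq> 0 \<Longrightarrow> partial i (partial j f) x = partial j (partial i f) x"
    using q 1(4) by metis
qed

section \<open>Iterated partial derivatives along a multi-index\<close>

lemma homog_partial_funpow: "homog a f \<Longrightarrow> homog (a + int n) ((partial i ^^ n) f)"
proof (induction n)
  case (Suc n)
  then show ?case using homog_partial(1)[OF Suc.IH[OF Suc.prems]] by (simp add: add_ac)
qed simp

text \<open>\<open>multi_partial\<close> with the enumeration \<open>index_list\<close> replaced by
  an arbitrary list, so that induction on the list becomes possible.\<close>

definition fold_partial :: "'n list \<Rightarrow> ('n::finite \<Rightarrow> nat) \<Rightarrow> (real^'n \<Rightarrow> real) \<Rightarrow> real^'n \<Rightarrow> real" where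
  "fold_partial L \<alpha> = foldr (\<lambda>i g. (partial i ^^ \<alpha> i) \<circ> g) L id"

lemma fold_partial_simps [simp]:
  "fold_partial [] \<alpha> f = f"
  "fold_partial (i # L) \<alpha> f = (partial i ^^ \<alpha> i) (fold_partial L \<alpha> f)"
  by (simp_all add: fold_partial_def)

lemma homog_fold_partial: "homog a f \<Longrightarrow> homog (a + (\<Sum>i\<leftarrow>L. int (\<alpha> i))) (fold_partial L \<alpha> f)"
proof (induction L)
  case (Cons i L)
  have "homog (a + (\<Sum>i\<leftarrow>L. int (\<alpha> i)) + int (\<alpha> i)) ((partial i ^^ \<alpha> i) (fold_partial L \<alpha> f))"
    by (intro homog_partial_funpow) (use Cons in auto)
  then show ?case by (simp add: add_ac)
qed simp

lemma partial_funpow_cong: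
  assumes "\<And>x. x \<noteq> 0 \<Longrightarrow> f x = g x" "x \<noteq> 0"
  shows "(partial i ^^ n) f x = (partial i ^^ n) g x"
  using assms(2)
proof (induction n arbitrary: x)
  case (Suc n)
  have "partial i ((partial i ^^ n) f) x = partial i ((partial i ^^ n) g) x"
    by (rule partial_cong_open[of "-{0}"]) (use Suc in auto)
  then show ?case by simp
qed (simp add: assms(1))

lemma partial_funpow_commute:
  assumes "homog a f" "x \<noteq> 0"
  shows "partial i ((partial j ^^ n) f) x = (partial j ^^ n) (partial i f) x"
  using assms(2)
proof (induction n arbitrary: x)
  case (Suc n)
  have "partial i (partial j ((partial j ^^ n) f)) x = partial j (partial i ((partial j ^^ n) f)) x"
    using homog_partial(3)[OF homog_partial_funpow[OF assms(1)] Suc.prems] .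
  also have "\<dots> = partial j ((partial j ^^ n) (partial i f)) x"
    by (rule partial_cong_open[of "-{0}"]) (use Suc in auto)
  finally show ?case by simp
qed simp

lemma partial_fold_partial:
  assumes "homog a f" "x \<noteq> 0"
  shows "partial i (fold_partial L \<alpha> f) x = fold_partial L \<alpha> (partial i f) x"
  using assms(2)
proof (induction L arbitrary: x)
  case (Cons j L)
  have "partial i ((partial j ^^ \<alpha> j) (fold_partial L \<alpha> f)) x = (partial j ^^ \<alpha> j) (partial i (fold_partial L \<alpha> f)) x"
    using partial_funpow_commute[OF homog_fold_partial[OF assms(1)] Cons.prems] .
  also have "\<dots> = (partial j ^^ \<alpha> j) (fold_partial L \<alpha> (partial i f)) x"
    by (rule partial_funpow_cong) (use Cons in auto)
  finally show ?case by simp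
qed simp

lemma fold_partial_cong:
  "(\<And>j. j \<in> set L \<Longrightarrow> \<beta> j = \<alpha> j) \<Longrightarrow> fold_partial L \<beta> f = fold_partial L \<alpha> f"
  by (induction L) auto

text \<open>In a distinct list i occurs once, so raising its exponent inserts exactly one further
  \<open>partial i\<close> at that position; the derivatives in front of it commute with it.\<close>

lemma fold_partial_Suc:
  assumes "homog a f" "x \<noteq> 0" "i \<in> set L" "distinct L"
    and \<beta>: "\<beta> i = Suc (\<alpha> i)" "\<And>j. j \<noteq> i \<Longrightarrow> \<beta> j = \<alpha> j"
  shows "fold_partial L \<beta> f x = partial i (fold_partial L \<alpha> f) x"
  using assms(2-4)
proof (induction L arbitrary: x)
  case (Cons j L)
  show ?case
  proof (cases "j = i")
    case True
    have "fold_partial L \<beta> f = fold_partial L \<alpha> f"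
      by (rule fold_partial_cong) (use Cons.prems True \<beta>(2) in force)
    then show ?thesis using True \<beta> by simp
  next
    case False
    have "(partial j ^^ \<alpha> j) (fold_partial L \<beta> f) x = (partial j ^^ \<alpha> j) (partial i (fold_partial L \<alpha> f)) x"
      by (rule partial_funpow_cong) (use Cons False in auto)
    also have "\<dots> = partial i ((partial j ^^ \<alpha> j) (fold_partial L \<alpha> f)) x"
      using partial_funpow_commute[OF homog_fold_partial[OF assms(1)] Cons.prems(1)] by simp
    finally show ?thesis using False \<beta> by simp
  qed
qed simp

lemma index_list: "distinct (index_list :: 'n::finite list)" "set (index_list :: 'n list) = UNIV"
proof -
  obtain L :: "'n list" where "set L = UNIV" "distinct L"
    using finite_distinct_list[of "UNIV :: 'n set"] by auto
  from this(2,1) have "distinct (index_list :: 'n list) \<and> set (index_list :: 'n list) = UNIV"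
    unfolding index_list_def by (rule someI[of "\<lambda>is. distinct is \<and> set is = UNIV", OF conjI])
  then show "distinct (index_list :: 'n list)" "set (index_list :: 'n list) = UNIV" by auto
qed

lemma multi_partial_fold: "multi_partial \<alpha> f = fold_partial index_list \<alpha> f"
  by (simp add: multi_partial_def fold_partial_def)

lemma homog_multi_partial:
  assumes "homog a f"
  shows "homog (a + int (multi_order \<alpha>)) (multi_partial \<alpha> f)"
proof -
  have "(\<Sum>i\<leftarrow>index_list. int (\<alpha> i)) = int (multi_order \<alpha>)"
    by (simp add: sum_list_distinct_conv_sum_set index_list multi_order_def)
  then show ?thesis using homog_fold_partial[OF assms, where L = index_list and \<alpha> = \<alpha>] by (simp add: multi_partial_fold)
qed

text \<open>The first form matches the gradient in the asymptotic expansion with the Taylor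
  coefficients of \<open>partial k (K_ker i j)\<close>; the second differentiates a Taylor sum along
  a segment.\<close>

lemma partial_multi_partial:
  assumes "homog a f" "x \<noteq> 0"
  shows "partial i (multi_partial \<alpha> f) x = multi_partial \<alpha> (partial i f) x"
    and "partial i (multi_partial \<alpha> f) x = multi_partial (\<alpha>(i := Suc (\<alpha> i))) f x"
  unfolding multi_partial_fold using assms
  by (simp add: partial_fold_partial) (rule fold_partial_Suc[symmetric], use assms in \<open>auto simp: index_list\<close>)

lemma multi_partial_zero: "multi_partial (\<lambda>_. 0) f = f"
proof -
  have "fold_partial L (\<lambda>_. 0) f = f" for L by (induction L) auto
  then show ?thesis by (simp add: multi_partial_fold)
qed

section \<open>Multi-index combinatorics\<close>

lemma finite_multi_order: "finite {\<alpha> :: 'n::finite \<Rightarrow> nat. multi_order \<alpha> \<le> m}"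
proof (rule finite_subset)
  show "{\<alpha> :: 'n \<Rightarrow> nat. multi_order \<alpha> \<le> m} \<subseteq> {\<alpha>. \<forall>i. \<alpha> i \<in> {..m}}"
    using member_le_sum[of _ "UNIV :: 'n set"] by (auto simp: multi_order_def intro: order_trans)
  have "finite (Pi\<^sub>E (UNIV :: 'n set) (\<lambda>_. {..m}))" by (intro finite_PiE) auto
  then show "finite {\<alpha> :: 'n \<Rightarrow> nat. \<forall>i. \<alpha> i \<in> {..m}}" by (rule rev_finite_subset) auto
qed

lemma multi_power_bound: "\<bar>multi_power y \<alpha>\<bar> \<le> norm y ^ multi_order \<alpha>"
proof -
  have "\<bar>multi_power y \<alpha>\<bar> = (\<Prod>i\<in>UNIV. \<bar>y $ i\<bar> ^ \<alpha> i)"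
    by (simp add: multi_power_def abs_prod power_abs)
  also have "\<dots> \<le> (\<Prod>i\<in>UNIV. norm y ^ \<alpha> i)"
    by (intro prod_mono conjI power_mono component_le_norm_cart) auto
  finally show ?thesis by (simp add: multi_order_def power_sum)
qed

lemma multi_fact_Suc: "multi_fact (\<alpha>(i := Suc (\<alpha> i))) = real (Suc (\<alpha> i)) * multi_fact \<alpha>"
  for \<alpha> :: "'n::finite \<Rightarrow> nat"
  unfolding multi_fact_def
  by (subst (1 2) prod.remove[of UNIV i]) (auto intro!: prod.cong simp: mult.assoc)

lemma multi_power_Suc: "multi_power y (\<alpha>(i := Suc (\<alpha> i))) = y $ i * multi_power y \<alpha>"
  unfolding multi_power_def
  by (subst (1 2) prod.remove[of UNIV i]) (auto intro!: prod.cong simp: mult.assoc)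

lemma multi_order_Suc: "multi_order (\<alpha>(i := Suc (\<alpha> i))) = Suc (multi_order \<alpha>)"
  unfolding multi_order_def
  by (subst (1 2) sum.remove[of UNIV i]) (auto intro!: sum.cong)

lemma multi_fact_pos: "multi_fact \<alpha> > 0"
  by (auto simp: multi_fact_def intro!: prod_pos)

lemma finite_multi_order_eq: "finite {\<alpha> :: 'n::finite \<Rightarrow> nat. multi_order \<alpha> = m}"
  by (rule finite_subset[OF _ finite_multi_order[of m]]) auto

text \<open>Each \<open>\<beta>\<close> of order \<open>m + 1\<close> arises as \<open>\<alpha> + e\<^sub>i\<close> once for every \<open>i\<close> with \<open>\<beta> i \<noteq> 0\<close>, and
  \<open>\<Sum>\<^sub>i \<beta> i / \<beta>! = (m + 1) / \<beta>!\<close>.\<close>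

lemma sum_multi_order_Suc:
  fixes F :: "('n::finite \<Rightarrow> nat) \<Rightarrow> real"
  shows "(\<Sum>\<alpha> | multi_order \<alpha> = m. \<Sum>i\<in>UNIV. F (\<alpha>(i := Suc (\<alpha> i))) / multi_fact \<alpha>) =
    real (Suc m) * (\<Sum>\<beta> | multi_order \<beta> = Suc m. F \<beta> / multi_fact \<beta>)"
proof -
  let ?A = "{\<alpha> :: 'n \<Rightarrow> nat. multi_order \<alpha> = m}" and ?B = "{\<beta> :: 'n \<Rightarrow> nat. multi_order \<beta> = Suc m}"
  have "(\<Sum>\<alpha>\<in>?A. F (\<alpha>(i := Suc (\<alpha> i))) / multi_fact \<alpha>) = (\<Sum>\<beta>\<in>?B. real (\<beta> i) * F \<beta> / multi_fact \<beta>)" for i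
  proof -
    have "(\<Sum>\<alpha>\<in>?A. F (\<alpha>(i := Suc (\<alpha> i))) / multi_fact \<alpha>) = (\<Sum>\<beta>\<in>{\<beta>\<in>?B. \<beta> i \<noteq> 0}. real (\<beta> i) * F \<beta> / multi_fact \<beta>)"
    proof (rule sum.reindex_bij_witness[of _ "\<lambda>\<beta>. \<beta>(i := \<beta> i - 1)" "\<lambda>\<alpha>. \<alpha>(i := Suc (\<alpha> i))"])
      fix \<beta> assume b: "\<beta> \<in> {\<beta>\<in>?B. \<beta> i \<noteq> 0}"
      then have *: "(\<beta>(i := \<beta> i - 1))(i := Suc ((\<beta>(i := \<beta> i - 1)) i)) = \<beta>" by auto
      from * show "(\<beta>(i := \<beta> i - 1))(i := Suc ((\<beta>(i := \<beta> i - 1)) i)) = \<beta>" .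
      show "\<beta>(i := \<beta> i - 1) \<in> ?A"
        using b multi_order_Suc[of "\<beta>(i := \<beta> i - 1)" i, unfolded *] by simp
    next
      fix \<alpha> assume "\<alpha> \<in> ?A"
      then show "\<alpha>(i := Suc (\<alpha> i)) \<in> {\<beta>\<in>?B. \<beta> i \<noteq> 0}" using multi_order_Suc[of \<alpha> i] by simp
      show "real ((\<alpha>(i := Suc (\<alpha> i))) i) * F (\<alpha>(i := Suc (\<alpha> i))) / multi_fact (\<alpha>(i := Suc (\<alpha> i))) =
          F (\<alpha>(i := Suc (\<alpha> i))) / multi_fact \<alpha>"
        unfolding multi_fact_Suc by (simp del: of_nat_Suc)
    qed auto
    also have "\<dots> = (\<Sum>\<beta>\<in>?B. real (\<beta> i) * F \<beta> / multi_fact \<beta>)"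
      by (intro sum.mono_neutral_left finite_multi_order_eq) auto
    finally show ?thesis .
  qed
  then have "(\<Sum>\<alpha>\<in>?A. \<Sum>i\<in>UNIV. F (\<alpha>(i := Suc (\<alpha> i))) / multi_fact \<alpha>) = (\<Sum>\<beta>\<in>?B. \<Sum>i\<in>UNIV. real (\<beta> i) * F \<beta> / multi_fact \<beta>)"
    by (subst (1 2) sum.swap) simp
  also have "\<dots> = (\<Sum>\<beta>\<in>?B. real (Suc m) * (F \<beta> / multi_fact \<beta>))"
  proof (intro sum.cong refl)
    fix \<beta> :: "'n \<Rightarrow> nat" assume "\<beta> \<in> ?B"
    then have "(\<Sum>i\<in>UNIV. real (\<beta> i)) = real (Suc m)" by (simp add: multi_order_def flip: of_nat_sum)
    then show "(\<Sum>i\<in>UNIV. real (\<beta> i) * F \<beta> / multi_fact \<beta>) = real (Suc m) * (F \<beta> / multi_fact \<beta>)"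
      by (simp only: sum_distrib_right[symmetric] sum_divide_distrib[symmetric] times_divide_eq_right)
  qed
  finally show ?thesis by (simp only: sum_distrib_left)
qed

section \<open>Taylor expansion with remainder for homogeneous functions\<close>

definition taylor_poly :: "nat \<Rightarrow> (real^'n::finite \<Rightarrow> real) \<Rightarrow> real^'n \<Rightarrow> real^'n \<Rightarrow> real" where
  "taylor_poly m f x y =
     (\<Sum>\<alpha> | multi_order \<alpha> < m. (-1) ^ multi_order \<alpha> / multi_fact \<alpha> * multi_power y \<alpha> * multi_partial \<alpha> f x)"

text \<open>The expansion is that of y \<mapsto> f (x - y) at 0, whence the alternating signs. If 2
  |y| \<le> |x|, the segment from x to x - y stays outside the ball of radius |x| / 2, where
  homogeneity controls the derivatives of order m; a + m \<ge> 0 makes the worst case the smallest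
  distance from the origin.\<close>

lemma homog_taylor_bound:
  fixes f :: "real^'n::finite \<Rightarrow> real"
  assumes f: "homog a f" and m: "a + int m \<ge> 0"
  shows "\<exists>C\<ge>0. \<forall>x y. x \<noteq> 0 \<and> 2 * norm y \<le> norm x \<longrightarrow>
    \<bar>f (x - y) - taylor_poly m f x y\<bar> \<le> C * norm y ^ m / norm x powi (a + int m)"
proof -
  let ?A = "\<lambda>m. {\<alpha> :: 'n \<Rightarrow> nat. multi_order \<alpha> = m}"
  have "\<exists>C\<ge>0. \<forall>x. x \<noteq> 0 \<longrightarrow> \<bar>multi_partial \<alpha> f x\<bar> \<le> C * norm x powi (- (a + int (multi_order \<alpha>)))" for \<alpha>
    using homog_bound[OF homog_multi_partial[OF f]] .
  then obtain C where C: "\<And>\<alpha>. C \<alpha> \<ge> 0"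
    "\<And>\<alpha> x. x \<noteq> 0 \<Longrightarrow> \<bar>multi_partial \<alpha> f x\<bar> \<le> C \<alpha> * norm x powi (- (a + int (multi_order \<alpha>)))" by metis
  define B where "B = (\<Sum>\<alpha>\<in>?A m. C \<alpha> / multi_fact \<alpha>) * 2 powi (a + int m)"
  have B: "B \<ge> 0" unfolding B_def using C multi_fact_pos by (intro mult_nonneg_nonneg sum_nonneg divide_nonneg_pos) auto
  have "\<bar>f (x - y) - taylor_poly m f x y\<bar> \<le> B * norm y ^ m / norm x powi (a + int m)"
    if x: "x \<noteq> 0" and y: "2 * norm y \<le> norm x" for x y
  proof -
    \<comment> \<open>\<open>D k\<close> is the k-th derivative of s \<mapsto> f (x - s y), written
      as a multinomial sum. The bound then follows from the one-dimensional Lagrange remainder on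
      [0, 1].\<close>
    define D where "D k s = (\<Sum>\<alpha>\<in>?A k. fact k * (-1) ^ k * multi_power y \<alpha> * multi_partial \<alpha> f (x - s *\<^sub>R y) / multi_fact \<alpha>)" for k s
    have nz: "x - s *\<^sub>R y \<noteq> 0" "norm x / 2 \<le> norm (x - s *\<^sub>R y)" if "0 \<le> s" "s \<le> 1" for s
    proof -
      have "norm (s *\<^sub>R y) \<le> norm y" using that by (simp add: mult_left_le_one_le)
      then show "norm x / 2 \<le> norm (x - s *\<^sub>R y)" using norm_triangle_ineq2[of x "s *\<^sub>R y"] y by linarith
      then show "x - s *\<^sub>R y \<noteq> 0" using x by (metis half_gt_zero leD norm_zero zero_less_norm_iff)
    qed
    have "(D k has_real_derivative D (Suc k) s) (at s)" if s: "0 \<le> s" "s \<le> 1" for k s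
    proof -
      have 1: "((\<lambda>s. multi_partial \<alpha> f (x - s *\<^sub>R y)) has_real_derivative
        (\<Sum>i\<in>UNIV. - (y $ i) * multi_partial (\<alpha>(i := Suc (\<alpha> i))) f (x - s *\<^sub>R y))) (at s)" for \<alpha>
      proof -
        have "((\<lambda>s. x - s *\<^sub>R y) has_derivative (\<lambda>h. - (h *\<^sub>R y))) (at s)"
          by (auto intro!: derivative_eq_intros)
        from has_derivative_compose[OF this homog_partial(2)[OF homog_multi_partial[OF f] nz(1)[OF s]]]
        have "((\<lambda>s. multi_partial \<alpha> f (x - s *\<^sub>R y)) has_derivative
          (\<lambda>h. \<Sum>i\<in>UNIV. - (h * y $ i) * partial i (multi_partial \<alpha> f) (x - s *\<^sub>R y))) (at s)" by simp
        then show ?thesis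
          unfolding has_field_derivative_def
          by (rule has_derivative_eq_rhs)
            (simp add: fun_eq_iff partial_multi_partial(2)[OF f nz(1)[OF s]] sum_distrib_left sum_distrib_right mult_ac)
      qed
      have "(D k has_real_derivative (\<Sum>\<alpha>\<in>?A k. fact k * (-1) ^ k * multi_power y \<alpha> *
          (\<Sum>i\<in>UNIV. - (y $ i) * multi_partial (\<alpha>(i := Suc (\<alpha> i))) f (x - s *\<^sub>R y)) / multi_fact \<alpha>)) (at s)"
        unfolding D_def by (intro DERIV_sum DERIV_cdivide DERIV_cmult 1)
      moreover have "(\<Sum>\<alpha>\<in>?A k. fact k * (-1) ^ k * multi_power y \<alpha> *
          (\<Sum>i\<in>UNIV. - (y $ i) * multi_partial (\<alpha>(i := Suc (\<alpha> i))) f (x - s *\<^sub>R y)) / multi_fact \<alpha>) =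
          fact k * (-1) ^ Suc k * (\<Sum>\<alpha>\<in>?A k. \<Sum>i\<in>UNIV. (\<lambda>\<beta>. multi_power y \<beta> * multi_partial \<beta> f (x - s *\<^sub>R y)) (\<alpha>(i := Suc (\<alpha> i))) / multi_fact \<alpha>)"
        unfolding multi_power_Suc sum_distrib_left sum_divide_distrib
        by (intro sum.cong refl) (simp add: mult_ac)
      moreover have "\<dots> = D (Suc k) s"
        unfolding sum_multi_order_Suc[of "\<lambda>\<beta>. multi_power y \<beta> * multi_partial \<beta> f (x - s *\<^sub>R y)"]
        by (simp add: D_def sum_distrib_left algebra_simps)
      ultimately show ?thesis by simp
    qed
    note deriv_D = this
    have "{\<alpha> :: 'n \<Rightarrow> nat. multi_order \<alpha> = 0} = {\<lambda>_. 0}"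
      by (auto simp: multi_order_def fun_eq_iff)
    then have "D 0 = (\<lambda>s. f (x - s *\<^sub>R y))"
      by (simp add: D_def fun_eq_iff multi_power_def multi_fact_def multi_partial_zero)
    then have "\<exists>t. 0 < t \<and> t \<le> 1 \<and> f (x - 1 *\<^sub>R y) = (\<Sum>k<m. D k 0 / fact k * 1 ^ k) + D m t / fact m * 1 ^ m"
      by (intro Maclaurin2) (use deriv_D in auto)
    then obtain t where t: "0 < t" "t \<le> 1" "f (x - y) = (\<Sum>k<m. D k 0 / fact k) + D m t / fact m" by auto
    have "(\<Sum>k<m. D k 0 / fact k) = (\<Sum>k<m. \<Sum>\<alpha>\<in>?A k. (-1) ^ multi_order \<alpha> / multi_fact \<alpha> * multi_power y \<alpha> * multi_partial \<alpha> f x)"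
      by (intro sum.cong refl) (auto simp: D_def sum_divide_distrib intro!: sum.cong)
    also have "\<dots> = taylor_poly m f x y"
      unfolding taylor_poly_def
      by (subst sum.UNION_disjoint[symmetric]) (auto intro!: sum.cong finite_multi_order_eq)
    finally have "f (x - y) - taylor_poly m f x y = D m t / fact m" using t(3) by simp
    also have "\<bar>\<dots>\<bar> \<le> (\<Sum>\<alpha>\<in>?A m. \<bar>multi_power y \<alpha>\<bar> * \<bar>multi_partial \<alpha> f (x - t *\<^sub>R y)\<bar> / multi_fact \<alpha>)"
      unfolding D_def sum_divide_distrib
      using multi_fact_pos[THEN less_imp_le] by (intro order_trans[OF sum_abs] sum_mono) (simp add: abs_mult abs_of_pos[OF multi_fact_pos])
    also have "\<dots> \<le> (\<Sum>\<alpha>\<in>?A m. norm y ^ m * (C \<alpha> * (2 powi (a + int m) / norm x powi (a + int m))) / multi_fact \<alpha>)"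
    proof (intro sum_mono divide_right_mono mult_mono)
      fix \<alpha> assume \<alpha>: "\<alpha> \<in> ?A m"
      show "\<bar>multi_power y \<alpha>\<bar> \<le> norm y ^ m" using multi_power_bound[of y \<alpha>] \<alpha> by simp
      have "\<bar>multi_partial \<alpha> f (x - t *\<^sub>R y)\<bar> \<le> C \<alpha> * norm (x - t *\<^sub>R y) powi (- (a + int m))"
        using C(2)[of "x - t *\<^sub>R y" \<alpha>] nz[of t] t \<alpha> by simp
      also have "norm (x - t *\<^sub>R y) powi (- (a + int m)) \<le> 2 powi (a + int m) / norm x powi (a + int m)"
      proof -
        have "(norm x / 2) powi (a + int m) \<le> norm (x - t *\<^sub>R y) powi (a + int m)"
          by (rule power_int_mono) (use m nz(2)[of t] t in auto)
        then have "inverse (norm (x - t *\<^sub>R y) powi (a + int m)) \<le> inverse ((norm x / 2) powi (a + int m))"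
          by (rule le_imp_inverse_le) (use x in \<open>auto intro: zero_less_power_int\<close>)
        then show ?thesis
          unfolding power_int_minus by (simp add: power_int_divide_distrib)
      qed
      finally show "\<bar>multi_partial \<alpha> f (x - t *\<^sub>R y)\<bar> \<le> C \<alpha> * (2 powi (a + int m) / norm x powi (a + int m))"
        using C(1)[of \<alpha>] by (simp add: mult_left_mono)
      show "0 \<le> multi_fact \<alpha>" using multi_fact_pos[of \<alpha>] by simp
    qed auto
    also have "\<dots> = B * norm y ^ m / norm x powi (a + int m)"
      by (simp add: B_def sum_distrib_left sum_distrib_right sum_divide_distrib mult_ac)
    finally show ?thesis .
  qed
  then show ?thesis using B by blast
qed

section \<open>Gaussian integrals and the algebraic weight\<close>

lemma lborel_integral_affine:
  fixes f :: "'a::euclidean_space \<Rightarrow> real"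
  assumes f: "f \<in> borel_measurable borel" and c: "c \<noteq> 0"
  shows "integrable lborel (\<lambda>x. f (t + c *\<^sub>R x)) \<longleftrightarrow> integrable lborel f"
    and "integral\<^sup>L lborel f = \<bar>c\<bar> ^ DIM('a) * (LINT x|lborel. f (t + c *\<^sub>R x))"
proof -
  have m: "(\<lambda>x. t + c *\<^sub>R x) \<in> measurable lborel borel" by measurable
  show "integrable lborel (\<lambda>x. f (t + c *\<^sub>R x)) \<longleftrightarrow> integrable lborel f"
    by (subst (2) lborel_affine[OF c, of t])
      (use f c m in \<open>simp add: integrable_density integrable_distr_eq\<close>)
  show "integral\<^sup>L lborel f = \<bar>c\<bar> ^ DIM('a) * (LINT x|lborel. f (t + c *\<^sub>R x))"
    by (subst lborel_affine[OF c, of t])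
      (use f c m in \<open>simp add: integral_density integral_distr\<close>)
qed

lemma power_exp_bound:
  fixes x :: real
  assumes "x \<ge> 0"
  shows "x ^ n * exp (- x) \<le> fact n"
proof -
  have "(\<Sum>k\<in>{n}. x ^ k /\<^sub>R fact k) \<le> (\<Sum>k. x ^ k /\<^sub>R fact k)"
    by (rule sum_le_suminf) (use assms summable_exp_generic[of x] in auto)
  then have "x ^ n / fact n \<le> exp x" by (simp add: exp_def divide_inverse mult.commute)
  then show ?thesis by (simp add: exp_minus field_simps)
qed

text \<open>Squaring turns the left side into (2 \<rho> ^ 2) ^ n times z ^ n exp (-z) with z = r ^ 2
  / (2 \<rho> ^ 2); the square root in the constant comes from there.\<close>

lemma power_gauss_bound:
  fixes r \<rho> :: real
  assumes "\<rho> > 0" "r \<ge> 0"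
  shows "r ^ n * exp (- r\<^sup>2 / (4 * \<rho>\<^sup>2)) \<le> sqrt (2 ^ n * fact n) * \<rho> ^ n"
proof (rule power2_le_imp_le)
  have "(r ^ n * exp (- r\<^sup>2 / (4 * \<rho>\<^sup>2)))\<^sup>2 = (2 * \<rho>\<^sup>2) ^ n * ((r\<^sup>2 / (2 * \<rho>\<^sup>2)) ^ n * exp (- (r\<^sup>2 / (2 * \<rho>\<^sup>2))))"
    using assms by (simp add: power_mult_distrib power_divide exp_double[symmetric] mult.commute[of n] flip: power_mult)
  also have "\<dots> \<le> (2 * \<rho>\<^sup>2) ^ n * fact n"
    by (intro mult_left_mono power_exp_bound) (use assms in auto)
  also have "\<dots> = (sqrt (2 ^ n * fact n) * \<rho> ^ n)\<^sup>2"
    by (simp add: power_mult_distrib mult_ac flip: power_mult)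
  finally show "(r ^ n * exp (- r\<^sup>2 / (4 * \<rho>\<^sup>2)))\<^sup>2 \<le> (sqrt (2 ^ n * fact n) * \<rho> ^ n)\<^sup>2" .
qed (use assms in auto)

text \<open>Two roles: with \<rho> the square root of \<tau> it is the size of the first derivatives
  of the Oseen kernel at time \<tau>, and with \<rho> = 1 it is the decay profile of the
  solution.\<close>

definition wgt :: "real \<Rightarrow> real^'n::finite \<Rightarrow> real" where
  "wgt \<rho> z = 1 / (\<rho> + norm z) ^ (CARD('n) + 1)"

lemma wgt_nonneg: "\<rho> \<ge> 0 \<Longrightarrow> 0 \<le> wgt \<rho> z"
  by (simp add: wgt_def)

lemma wgt_minus [simp]: "wgt \<rho> (- z) = wgt \<rho> z"
  by (simp add: wgt_def)

lemma borel_wgt [measurable]: "wgt \<rho> \<in> borel_measurable borel"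
  unfolding wgt_def by measurable

lemma integrable_powr_tail:
  assumes a: "a > (0::real)"
  shows "integrable lborel (\<lambda>t. (1 + \<bar>t\<bar>) powr (- 1 - a))"
proof -
  let ?f = "\<lambda>t::real. (1 + \<bar>t\<bar>) powr (- 1 - a)"
  have 1: "(\<integral>\<^sup>+t. ennreal (?f t) * indicator {0..} t \<partial>lborel) = ennreal (1 / a)"
  proof -
    have "((\<lambda>t::real. - ((1 + t) powr - a) / a) \<longlongrightarrow> - 0 / a) at_top"
      by (intro tendsto_intros tendsto_neg_powr filterlim_tendsto_add_at_top[OF tendsto_const]) (use a in \<open>auto simp: filterlim_ident\<close>)
    moreover have ex: "- 1 - a = - a - 1" by simp
    ultimately have "(\<integral>\<^sup>+t. ennreal ((1 + t) powr (- 1 - a)) * indicator {0..} t \<partial>lborel) = ennreal (- 0 / a - (- ((1 + 0) powr - a) / a))"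
      by (intro nn_integral_FTC_atLeast[where F = "\<lambda>t. - ((1 + t) powr - a) / a"])
        (use a in \<open>auto intro!: derivative_eq_intros simp: ex\<close>)
    also have "(\<integral>\<^sup>+t. ennreal ((1 + t) powr (- 1 - a)) * indicator {0..} t \<partial>lborel) = (\<integral>\<^sup>+t. ennreal (?f t) * indicator {0..} t \<partial>lborel)"
      by (intro nn_integral_cong) (auto split: split_indicator)
    finally show ?thesis by simp
  qed
  have 2: "(\<integral>\<^sup>+t. ennreal (?f t) * indicator {..0} t \<partial>lborel) = ennreal (1 / a)"
    using nn_integral_real_affine[of "\<lambda>t. ennreal (?f t) * indicator {..0} t" "-1" 0] 1
    by (simp add: indicator_def)
  have "(\<integral>\<^sup>+t. ennreal (?f t) \<partial>lborel) \<le> (\<integral>\<^sup>+t. ennreal (?f t) * indicator {0..} t + ennreal (?f t) * indicator {..0} t \<partial>lborel)"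
    by (intro nn_integral_mono) (auto split: split_indicator)
  also have "\<dots> = ennreal (1 / a) + ennreal (1 / a)"
    using 1 2 by (subst nn_integral_add) auto
  also have "\<dots> < \<infinity>" by simp
  finally show ?thesis by (intro integrableI_nonneg) auto
qed

text \<open>Every coordinate is at most the norm, so (1 + |y|) ^ (-d-1) is bounded by the product
  over the d coordinates of (1 + |y_b|) to the power -1 - 1/d. Tonelli then reduces the claim to one
  dimension.\<close>

lemma integrable_wgt_lborel: "integrable lborel (wgt 1 :: real^'n::finite \<Rightarrow> real)"
proof -
  define a :: real where "a = 1 / real CARD('n)"
  have a: "a > 0" "- 1 - a = - (real CARD('n) + 1) / real CARD('n)" by (auto simp: a_def field_simps)
  have "(\<integral>\<^sup>+y. ennreal (wgt 1 (y::real^'n)) \<partial>lborel) \<le> (\<integral>\<^sup>+(y::real^'n). (\<Prod>b\<in>Basis. ennreal ((1 + \<bar>y \<bullet> b\<bar>) powr (- 1 - a))) \<partial>lborel)"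
  proof (intro nn_integral_mono)
    fix y :: "real^'n"
    have "wgt 1 y = (1 + norm y) powr (- (real CARD('n) + 1))"
    proof -
      have "1 + norm y > 0" by (simp add: add_pos_nonneg)
      then have "(1 + norm y) powr real (CARD('n) + 1) = (1 + norm y) ^ (CARD('n) + 1)" by (rule powr_realpow)
      then have "(1 + norm y) powr (- real (CARD('n) + 1)) = inverse ((1 + norm y) ^ (CARD('n) + 1))"
        by (simp only: powr_minus)
      then show ?thesis by (simp only: wgt_def inverse_eq_divide of_nat_add of_nat_1)
    qed
    also have "\<dots> = (\<Prod>b\<in>(Basis::(real^'n) set). (1 + norm y) powr (- 1 - a))"
    proof -
      have "0 < 1 + norm y" by (simp add: add_pos_nonneg)
      then have "((1 + norm y) powr (- 1 - a)) ^ CARD('n) = ((1 + norm y) powr (- 1 - a)) powr real CARD('n)"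
        by (intro powr_realpow[symmetric]) simp
      also have "\<dots> = (1 + norm y) powr (- (real CARD('n) + 1))" unfolding a(2) powr_powr by simp
      finally show ?thesis unfolding prod_constant by simp
    qed
    also have "\<dots> \<le> (\<Prod>b\<in>Basis. (1 + \<bar>y \<bullet> b\<bar>) powr (- 1 - a))"
      by (intro prod_mono conjI powr_mono2') (use a in \<open>auto simp: Basis_le_norm\<close>)
    finally show "ennreal (wgt 1 y) \<le> (\<Prod>b\<in>Basis. ennreal ((1 + \<bar>y \<bullet> b\<bar>) powr (- 1 - a)))"
      by (simp add: prod_ennreal ennreal_leI)
  qed
  also have "\<dots> = (\<Prod>b\<in>(Basis::(real^'n) set). \<integral>\<^sup>+t. ennreal ((1 + \<bar>t\<bar>) powr (- 1 - a)) \<partial>lborel)"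
    by (rule nn_integral_lborel_prod) auto
  also have "\<dots> < \<infinity>"
    using integrable_powr_tail[OF a(1)] unfolding integrable_iff_bounded
    by (auto simp: ennreal_prod_eq_top less_top prod_constant power_less_top_ennreal)
  finally show ?thesis by (intro integrableI_nonneg) (auto simp: wgt_nonneg)
qed

definition wint :: "'n::finite itself \<Rightarrow> real" where
  "wint _ = (LINT y|lborel. wgt 1 (y :: real^'n))"

lemma wint_nonneg: "wint TYPE('n::finite) \<ge> 0"
  unfolding wint_def by (intro integral_nonneg_AE) (auto simp: wgt_nonneg)

text \<open>The substitution y = x - \<rho> z gives \<rho> ^ d from the volume and \<rho> ^ (-d-1)
  from the weight. The resulting 1 / \<rho> is the weak singularity in time of Duhamel's
  integrand.\<close>

lemma wgt_shift:
  fixes x :: "real^'n::finite"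
  assumes \<rho>: "\<rho> > 0"
  shows "integrable lebesgue (\<lambda>y. wgt \<rho> (x - y))"
    and "(LINT y|lebesgue. wgt \<rho> (x - y)) = wint TYPE('n) / \<rho>"
proof -
  let ?f = "\<lambda>y. wgt \<rho> (x - y)"
  have m: "?f \<in> borel_measurable borel" by measurable
  have e: "?f (x + (- \<rho>) *\<^sub>R z) = wgt 1 z / \<rho> ^ (CARD('n) + 1)" for z
  proof -
    have "?f (x + (- \<rho>) *\<^sub>R z) = 1 / (\<rho> * (1 + norm z)) ^ (CARD('n) + 1)"
    proof -
      have "\<rho> + norm (x - (x + (- \<rho>) *\<^sub>R z)) = \<rho> * (1 + norm z)"
        using \<rho> by (simp add: distrib_left)
      then show ?thesis unfolding wgt_def by (rule arg_cong)
    qed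
    also have "\<dots> = wgt 1 z / \<rho> ^ (CARD('n) + 1)"
      unfolding power_mult_distrib wgt_def by (simp only: divide_divide_eq_left mult.commute)
    finally show ?thesis .
  qed
  have "integrable lborel (\<lambda>z. wgt 1 z / \<rho> ^ (CARD('n) + 1))"
    by (rule integrable_divide[OF integrable_wgt_lborel])
  then have i: "integrable lborel (\<lambda>z. ?f (x + (- \<rho>) *\<^sub>R z))" unfolding e .
  have c: "- \<rho> \<noteq> 0" using \<rho> by simp
  have "integrable lborel ?f"
    by (rule iffD1[OF lborel_integral_affine(1)[OF m c] i])
  then show "integrable lebesgue ?f" using m by (subst integrable_completion) auto
  have "(LINT y|lborel. ?f y) = \<rho> ^ CARD('n) * (wint TYPE('n) / \<rho> ^ (CARD('n) + 1))"
  proof -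
    have "(LINT z|lborel. wgt 1 (z::real^'n) / \<rho> ^ (CARD('n) + 1)) = wint TYPE('n) / \<rho> ^ (CARD('n) + 1)"
      unfolding wint_def by (rule integral_divide_zero)
    then show ?thesis
      using \<rho> unfolding lborel_integral_affine(2)[OF m c, of x] e by (simp del: power_Suc)
  qed
  also have "\<dots> = wint TYPE('n) / \<rho>" using \<rho> by simp
  finally show "(LINT y|lebesgue. wgt \<rho> (x - y)) = wint TYPE('n) / \<rho>"
    using m by (subst integral_completion) auto
qed

lemma wgt_lebesgue:
  shows "integrable lebesgue (wgt 1 :: real^'n::finite \<Rightarrow> real)"
    and "(LINT y|lebesgue. wgt 1 (y :: real^'n)) = wint TYPE('n)"
  using wgt_shift[of 1 "0 :: real^'n"] by simp_all

section \<open>Pointwise bounds and moments of Gaussians\<close>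

lemma heat_kernel_eq:
  assumes "t > 0"
  shows "heat_kernel t (x :: real^'n::finite) = exp (- (norm x)\<^sup>2 / (4 * t)) / sqrt (4 * pi * t) ^ CARD('n)"
proof -
  have "(4 * pi * t) powr (- real CARD('n) / 2) = inverse (((4 * pi * t) powr (1 / 2)) powr real CARD('n))"
    using assms by (simp add: powr_powr powr_minus)
  also have "\<dots> = inverse (sqrt (4 * pi * t) ^ CARD('n))"
    using assms by (simp add: powr_half_sqrt powr_realpow)
  finally have *: "(4 * pi * t) powr (- real CARD('n) / 2) = inverse (sqrt (4 * pi * t) ^ CARD('n))" .
  show ?thesis unfolding heat_kernel_def * by (simp only: divide_inverse[of "exp _" "_ ^ _"] mult.commute)
qed

definition gcon :: "nat \<Rightarrow> real" where "gcon n = sqrt (2 ^ n * fact n)"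

lemma gcon_nonneg: "gcon n \<ge> 0" by (simp add: gcon_def)

lemma power_sum_le:
  fixes a b :: real
  assumes "a \<ge> 0" "b \<ge> 0"
  shows "(a + b) ^ m \<le> 2 ^ m * (a ^ m + b ^ m)"
proof -
  have "(a + b) ^ m \<le> (2 * max a b) ^ m" by (intro power_mono) (use assms in auto)
  also have "\<dots> = 2 ^ m * max a b ^ m" by (simp add: power_mult_distrib)
  also have "max a b ^ m \<le> a ^ m + b ^ m" using assms by (auto simp: max_def)
  finally show ?thesis by simp
qed

lemma heat_kernel_nonneg: "heat_kernel t x \<ge> 0"
  by (simp add: heat_kernel_def)

lemma heat_kernel_bound:
  fixes z :: "real^'n::finite"
  assumes \<rho>: "\<rho> > 0"
  shows "norm z ^ m * heat_kernel (\<rho>\<^sup>2) z \<le> gcon m * \<rho> ^ m / \<rho> ^ CARD('n)"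
proof -
  have s: "sqrt (4 * pi * \<rho>\<^sup>2) \<ge> \<rho>"
  proof -
    have "\<rho>\<^sup>2 * 1 \<le> \<rho>\<^sup>2 * (4 * pi)" using pi_gt3 by (intro mult_left_mono) auto
    then show ?thesis using \<rho> by (intro real_le_rsqrt) (simp add: mult_ac)
  qed
  have "norm z ^ m * heat_kernel (\<rho>\<^sup>2) z = (norm z ^ m * exp (- (norm z)\<^sup>2 / (4 * \<rho>\<^sup>2))) / sqrt (4 * pi * \<rho>\<^sup>2) ^ CARD('n)"
    using \<rho> by (simp add: heat_kernel_eq)
  also have "\<dots> \<le> (gcon m * \<rho> ^ m) / \<rho> ^ CARD('n)"
    unfolding gcon_def by (intro frac_le power_gauss_bound power_mono s) (use \<rho> in auto)
  finally show ?thesis .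
qed

text \<open>Multiplying by (\<rho> + |z|) ^ (d+1) and splitting this power into \<rho> ^ (d+1) and
  |z| ^ (d+1) leaves two instances of \<open>heat_kernel_bound\<close>, of orders m and m + d +
  1.\<close>

lemma heat_kernel_wgt_bound:
  fixes z :: "real^'n::finite"
  assumes \<rho>: "\<rho> > 0"
  shows "norm z ^ m * heat_kernel (\<rho>\<^sup>2) z \<le> 2 ^ (CARD('n) + 1) * (gcon m + gcon (m + CARD('n) + 1)) * \<rho> ^ (m + 1) * wgt \<rho> z"
proof -
  let ?d = "CARD('n) + 1"
  have p: "(\<rho> + norm z) ^ ?d > 0" using \<rho> by (intro zero_less_power add_pos_nonneg) auto
  have "norm z ^ m * heat_kernel (\<rho>\<^sup>2) z * (\<rho> + norm z) ^ ?d \<le> norm z ^ m * heat_kernel (\<rho>\<^sup>2) z * (2 ^ ?d * (\<rho> ^ ?d + norm z ^ ?d))"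
    by (intro mult_left_mono power_sum_le mult_nonneg_nonneg heat_kernel_nonneg) (use \<rho> in auto)
  also have "\<dots> = 2 ^ ?d * (\<rho> ^ ?d * (norm z ^ m * heat_kernel (\<rho>\<^sup>2) z) + norm z ^ (m + ?d) * heat_kernel (\<rho>\<^sup>2) z)"
    by (simp only: power_add distrib_left mult_ac)
  also have "\<dots> \<le> 2 ^ ?d * (\<rho> ^ ?d * (gcon m * \<rho> ^ m / \<rho> ^ CARD('n)) + gcon (m + ?d) * \<rho> ^ (m + ?d) / \<rho> ^ CARD('n))"
    by (intro mult_left_mono add_mono heat_kernel_bound) (use \<rho> in auto)
  also have "\<dots> = 2 ^ ?d * (gcon m + gcon (m + ?d)) * \<rho> ^ (m + 1)"
    using \<rho> by (simp add: power_add field_simps)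
  finally have "norm z ^ m * heat_kernel (\<rho>\<^sup>2) z \<le> 2 ^ ?d * (gcon m + gcon (m + ?d)) * \<rho> ^ (m + 1) / (\<rho> + norm z) ^ ?d"
    using p by (simp only: pos_le_divide_eq)
  then show ?thesis by (simp add: wgt_def add_ac)
qed

lemma gauss_integral:
  fixes m :: "real^'n::finite"
  assumes a: "a > 0"
  shows "integrable lborel (\<lambda>y. exp (- a * (norm (y - m))\<^sup>2))"
    and "(LINT y|lborel. exp (- a * (norm (y - m))\<^sup>2)) = sqrt (pi / a) ^ CARD('n)"
proof -
  \<comment> \<open>The standard deviation for which the normal density has exponent -a t ^ 2; the
    Gaussian is then a multiple of a product of normal densities, each of mass one.\<close>
  define \<sigma> where "\<sigma> = sqrt (1 / (2 * a))"
  have \<sigma>: "\<sigma> > 0" "\<sigma>\<^sup>2 = 1 / (2 * a)" using a by (auto simp: \<sigma>_def)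
  have e: "exp (- a * (norm (y - m))\<^sup>2) = sqrt (pi / a) ^ CARD('n) * (\<Prod>b\<in>Basis. normal_density (m \<bullet> b) \<sigma> (y \<bullet> b))" for y
  proof -
    have "(\<Prod>b\<in>Basis. normal_density (m \<bullet> b) \<sigma> (y \<bullet> b)) = (\<Prod>b\<in>(Basis::(real^'n) set). 1 / sqrt (pi / a)) * (\<Prod>b\<in>Basis. exp (- a * ((y - m) \<bullet> b)\<^sup>2))"
      unfolding normal_density_def prod.distrib \<sigma>(2) using a by (simp add: inner_diff_left mult_ac)
    also have "(\<Prod>b\<in>Basis. exp (- a * ((y - m) \<bullet> b)\<^sup>2)) = exp (- a * (norm (y - m))\<^sup>2)"
    proof -
      have "(norm (y - m))\<^sup>2 = (\<Sum>b\<in>Basis. ((y - m) \<bullet> b)\<^sup>2)"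
        unfolding power2_norm_eq_inner by (subst euclidean_inner) (simp add: power2_eq_square)
      then show ?thesis by (simp only: exp_sum[OF finite_Basis, symmetric] sum_distrib_left[symmetric])
    qed
    finally show ?thesis using a by (simp add: power_divide)
  qed
  have "(\<integral>\<^sup>+y. ennreal (exp (- a * (norm (y - m))\<^sup>2)) \<partial>lborel) =
      (\<integral>\<^sup>+y. ennreal (sqrt (pi / a) ^ CARD('n)) * (\<Prod>b\<in>Basis. ennreal (normal_density (m \<bullet> b) \<sigma> (y \<bullet> b))) \<partial>lborel)"
    unfolding e using a by (intro nn_integral_cong) (simp add: ennreal_mult prod_ennreal prod_nonneg)
  also have "\<dots> = ennreal (sqrt (pi / a) ^ CARD('n)) * (\<integral>\<^sup>+y. (\<Prod>b\<in>Basis. ennreal (normal_density (m \<bullet> b) \<sigma> (y \<bullet> b))) \<partial>lborel)"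
    by (intro nn_integral_cmult) measurable
  also have "(\<integral>\<^sup>+y. (\<Prod>b\<in>Basis. ennreal (normal_density (m \<bullet> b) \<sigma> (y \<bullet> b))) \<partial>lborel) = (\<Prod>b\<in>Basis. \<integral>\<^sup>+t. ennreal (normal_density (m \<bullet> b) \<sigma> t) \<partial>lborel)"
    by (rule nn_integral_lborel_prod) auto
  also have "\<dots> = 1" using \<sigma>(1) by (intro prod.neutral) (simp add: nn_integral_eq_integral)
  finally have *: "(\<integral>\<^sup>+y. ennreal (exp (- a * (norm (y - m))\<^sup>2)) \<partial>lborel) = ennreal (sqrt (pi / a) ^ CARD('n))" by simp
  then show "integrable lborel (\<lambda>y. exp (- a * (norm (y - m))\<^sup>2))"
    by (intro integrableI_nonneg) auto
  show "(LINT y|lborel. exp (- a * (norm (y - m))\<^sup>2)) = sqrt (pi / a) ^ CARD('n)"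
    by (subst integral_eq_nn_integral) (use * a in auto)
qed

lemma gauss_moment_integrable:
  assumes a: "a > 0"
  shows "integrable lborel (\<lambda>y::real^'n::finite. norm y ^ k * exp (- a * (norm y)\<^sup>2))"
proof -
  define \<rho> where "\<rho> = 1 / (2 * sqrt a)"
  have \<rho>: "\<rho> > 0" "4 * \<rho>\<^sup>2 = 1 / a" using a by (auto simp: \<rho>_def power_divide power_mult_distrib)
  define A where "A = 2 ^ (CARD('n) + 1) * (gcon k + gcon (k + CARD('n) + 1)) * \<rho> ^ (k + 1)"
  have "integrable lborel (\<lambda>y::real^'n. sqrt (4 * pi * \<rho>\<^sup>2) ^ CARD('n) * (A * wgt \<rho> y))"
  proof -
    have "integrable lborel (wgt \<rho> :: real^'n \<Rightarrow> real)"
      using wgt_shift(1)[OF \<rho>(1), of "0 :: real^'n"] by (simp add: integrable_completion)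
    then show ?thesis by simp
  qed
  then show ?thesis
  proof (rule Bochner_Integration.integrable_bound)
    show "AE y in lborel. norm (norm y ^ k * exp (- a * (norm y)\<^sup>2)) \<le> norm (sqrt (4 * pi * \<rho>\<^sup>2) ^ CARD('n) * (A * wgt \<rho> (y::real^'n)))"
    proof (intro AE_I2)
      fix y :: "real^'n"
      have "norm y ^ k * exp (- a * (norm y)\<^sup>2) = sqrt (4 * pi * \<rho>\<^sup>2) ^ CARD('n) * (norm y ^ k * heat_kernel (\<rho>\<^sup>2) y)"
        using \<rho> a by (simp add: heat_kernel_eq power2_eq_square mult_ac)
      also have "\<dots> \<le> sqrt (4 * pi * \<rho>\<^sup>2) ^ CARD('n) * (A * wgt \<rho> y)"
        unfolding A_def by (intro mult_left_mono heat_kernel_wgt_bound \<rho>) auto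
      finally have "norm y ^ k * exp (- a * (norm y)\<^sup>2) \<le> sqrt (4 * pi * \<rho>\<^sup>2) ^ CARD('n) * (A * wgt \<rho> y)" .
      moreover have "0 \<le> norm y ^ k * exp (- a * (norm y)\<^sup>2)" by simp
      ultimately show "norm (norm y ^ k * exp (- a * (norm y)\<^sup>2)) \<le> norm (sqrt (4 * pi * \<rho>\<^sup>2) ^ CARD('n) * (A * wgt \<rho> y))"
        unfolding real_norm_def by linarith
    qed
  qed measurable
qed

text \<open>After centring at m the coordinate splits into m_j and an odd part, and the odd part
  integrates to zero by reflection.\<close>

lemma gauss_first_moment:
  fixes m :: "real^'n::finite"
  assumes a: "a > 0"
  shows "integrable lborel (\<lambda>y. y $ j * exp (- a * (norm (y - m))\<^sup>2))"
    and "(LINT y|lborel. y $ j * exp (- a * (norm (y - m))\<^sup>2)) = m $ j * sqrt (pi / a) ^ CARD('n)"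
proof -
  let ?g = "\<lambda>y::real^'n. y $ j * exp (- a * (norm y)\<^sup>2)"
  let ?f = "\<lambda>y::real^'n. y $ j * exp (- a * (norm (y - m))\<^sup>2)"
  have g: "integrable lborel ?g"
    by (rule Bochner_Integration.integrable_bound[OF gauss_moment_integrable[OF a, of 1]])
      (auto simp: component_le_norm_cart abs_mult intro!: AE_I2 mult_right_mono)
  have "integral\<^sup>L lborel ?g = - integral\<^sup>L lborel ?g"
    by (subst lborel_integral_affine(2)[where c = "-1" and t = 0]) auto
  then have g0: "integral\<^sup>L lborel ?g = 0" by simp
  have e: "?f (m + 1 *\<^sub>R y) = ?g y + m $ j * exp (- a * (norm y)\<^sup>2)" for y
    by (simp add: algebra_simps)
  have mf: "?f \<in> borel_measurable borel" by measurable
  have G: "integrable lborel (\<lambda>y::real^'n. exp (- a * (norm y)\<^sup>2))" "(LINT y|lborel. exp (- a * (norm (y::real^'n))\<^sup>2)) = sqrt (pi / a) ^ CARD('n)"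
    using gauss_integral[OF a, of 0] by simp_all
  show "integrable lborel ?f"
    using lborel_integral_affine(1)[OF mf, of 1 m] g G unfolding e by simp
  show "integral\<^sup>L lborel ?f = m $ j * sqrt (pi / a) ^ CARD('n)"
    using lborel_integral_affine(2)[OF mf, of 1 m] g G g0 unfolding e by simp
qed

section \<open>The fundamental solution as a superposition of Gaussians\<close>

text \<open>
  In the variable \<open>w = 1 / s\<close>, and with \<open>e = d - 2\<close>, one has
  \<open>jint e k (1 / \<tau>) (|x|\<^sup>2) = (4 \<pi>) ^ (d / 2) \<integral>\<^bsub>\<tau>\<^esub>\<^bsup>\<infinity>\<^esup> s ^ (- k - 1) G\<^sub>s(x) ds\<close>. The domain of
  integration is thus bounded, and \<open>jinf e k |x|\<close> is the limit \<open>\<tau> \<rightarrow> 0\<close>.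
\<close>

definition jker :: "nat \<Rightarrow> nat \<Rightarrow> real \<Rightarrow> real \<Rightarrow> real" where
  "jker e k v w = sqrt w ^ e * w ^ k * exp (- (v * w) / 4)"

definition jint :: "nat \<Rightarrow> nat \<Rightarrow> real \<Rightarrow> real \<Rightarrow> real" where
  "jint e k b v = integral {0..b} (jker e k v)"

definition jinf :: "nat \<Rightarrow> nat \<Rightarrow> real \<Rightarrow> real" where
  "jinf e k r = Gamma (real e / 2 + 1 + real k) * (2 / r) ^ (e + 2 + 2 * k)"

lemma continuous_jker: "continuous_on S (jker e k v)"
  unfolding jker_def by (intro continuous_intros) auto

lemma borel_jker [measurable]: "jker e k v \<in> borel_measurable borel"
  by (rule borel_measurable_continuous_onI[OF continuous_jker])

lemma jker_nonneg: "w \<ge> 0 \<Longrightarrow> jker e k v w \<ge> 0"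
  by (simp add: jker_def)

text \<open>Differentiating \<open>jker\<close> in v produces the factor -w / 4, which raises k by
  one. On the bounded interval this holds at every v, including v = 0, so the kernels built from
  \<open>jint\<close> are smooth at the origin.\<close>

lemma jint_has_derivative:
  "(jint e k b has_real_derivative (- jint e (Suc k) b v / 4)) (at v)"
proof -
  have "((\<lambda>v. integral (cbox 0 b) (jker e k v)) has_field_derivative
      integral (cbox 0 b) (\<lambda>w. - (1 / 4) * jker e (Suc k) v w)) (at v within UNIV)"
  proof (rule leibniz_rule_field_derivative)
    show "continuous_on (UNIV \<times> cbox 0 b) (\<lambda>(v, w). - (1 / 4) * jker e (Suc k) v w)"
      unfolding jker_def split_beta by (intro continuous_intros) auto
    show "jker e k v integrable_on cbox 0 b" for v
      by (intro integrable_continuous continuous_jker)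
    show "((\<lambda>v. jker e k v w) has_field_derivative - (1 / 4) * jker e (Suc k) v w) (at v within UNIV)" for v w
      unfolding jker_def by (auto intro!: derivative_eq_intros)
  qed auto
  then show ?thesis by (simp add: jint_def fun_eq_iff[symmetric] flip: jint_def)
qed

lemma jint_isCont: "isCont (jint e k b) v"
  by (rule DERIV_isCont[OF jint_has_derivative])

lemma jint_deriv_upper:
  assumes "0 < b"
  shows "((\<lambda>b. jint e k b v) has_real_derivative jker e k v b) (at b)"
proof -
  have "((\<lambda>b. integral {0..b} (jker e k v)) has_real_derivative jker e k v b) (at b within {0..b + 1})"
    by (rule integral_has_real_derivative[OF continuous_jker]) (use assms in auto)
  then show ?thesis
    using assms at_within_Icc_at[of 0 b "b + 1"] by (simp add: jint_def)
qed

lemma jint_isCont_upper: "0 < b \<Longrightarrow> isCont (\<lambda>b. jint e k b v) b"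
  by (rule DERIV_isCont[OF jint_deriv_upper])

lemma jint_nonneg: "jint e k b v \<ge> 0"
  unfolding jint_def by (intro integral_nonneg integrable_continuous_interval continuous_jker) (auto simp: jker_nonneg)

text \<open>The exponential is dropped; this is sharp in the parabolic region |x| ^ 2 \<le> \<tau>
  with b = 1 / \<tau>.\<close>

lemma jint_le:
  assumes "b \<ge> 0" "v \<ge> 0"
  shows "jint e k b v \<le> sqrt b ^ (e + 2 * k + 2)"
proof -
  have "jint e k b v \<le> integral {0..b} (\<lambda>w. sqrt b ^ e * b ^ k)"
    unfolding jint_def
  proof (intro integral_le integrable_continuous_interval continuous_jker)
    fix w assume w: "w \<in> {0..b}"
    have "sqrt w ^ e * w ^ k * exp (- (v * w) / 4) \<le> sqrt b ^ e * b ^ k * 1"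
      by (intro mult_mono power_mono) (use w assms in auto)
    then show "jker e k v w \<le> sqrt b ^ e * b ^ k" by (simp add: jker_def)
  qed auto
  also have "\<dots> = sqrt b ^ (e + 2 * k + 2)"
    using assms by (simp add: power_add power_mult)
  finally show ?thesis .
qed

lemma jint_lborel:
  shows "integrable lborel (\<lambda>w. indicator {0..b} w * jker e k v w)"
    and "jint e k b v = (LINT w|lborel. indicator {0..b} w * jker e k v w)"
  using borel_integrable_atLeastAtMost'[OF continuous_jker, of 0 b e k v]
    set_borel_integral_eq_integral(2)[OF borel_integrable_atLeastAtMost'[OF continuous_jker], of 0 b e k v]
  by (simp_all add: set_integrable_def set_lebesgue_integral_def jint_def)

text \<open>Euler's integral for Gamma at s = e / 2 + 1 + k, rescaled by c = r ^ 2 / 4.\<close>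

lemma jker_integral:
  assumes r: "r > 0"
  shows "has_bochner_integral lborel (\<lambda>w. indicator {0..} w * jker e k (r\<^sup>2) w) (jinf e k r)"
proof (rule has_bochner_integral_nn_integral)
  define s where "s = real e / 2 + 1 + real k"
  define c where "c = r\<^sup>2 / 4"
  have s: "s > 0" and c: "c > 0" using r by (auto simp: s_def c_def add_pos_nonneg)
  have cs: "c powr s = (r / 2) ^ (e + 2 + 2 * k)"
  proof -
    have "c powr s = ((r / 2) powr 2) powr s" using r by (simp add: c_def power_divide powr_numeral)
    also have "\<dots> = (r / 2) powr real (e + 2 + 2 * k)" by (simp add: powr_powr s_def algebra_simps)
    also have "\<dots> = (r / 2) ^ (e + 2 + 2 * k)" using r by (intro powr_realpow) auto
    finally show ?thesis .
  qed
  have "ennreal (Gamma s) = ennreal \<bar>c\<bar> * (\<integral>\<^sup>+w. ennreal (indicator {0..} (0 + c * w) * (0 + c * w) powr (s - 1) / exp (0 + c * w)) \<partial>lborel)"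
    unfolding Gamma_conv_nn_integral_real[OF s] by (rule nn_integral_real_affine) (use c in auto)
  also have "\<dots> = ennreal c * (\<integral>\<^sup>+w. ennreal (c powr (s - 1)) * ennreal (indicator {0..} w * jker e k (r\<^sup>2) w) \<partial>lborel)"
  proof -
    \<comment> \<open>The point w = 0 is excluded because for e = k = 0 the integrands differ there:
      \<open>0 powr 0 = 0\<close> but \<open>0 ^ 0 = 1\<close>.\<close>
    have "ennreal (indicator {0..} (0 + c * w) * (0 + c * w) powr (s - 1) / exp (0 + c * w)) =
       ennreal (c powr (s - 1)) * ennreal (indicator {0..} w * jker e k (r\<^sup>2) w)" if "w \<noteq> 0" for w
    proof (cases "w > 0")
      case True
      have "w powr (s - 1) = w powr (real e / 2) * w powr real k" by (simp add: s_def powr_add)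
      also have "w powr (real e / 2) = (w powr (1/2)) powr real e" by (simp add: powr_powr)
      finally have "w powr (s - 1) = sqrt w ^ e * w ^ k" using True by (simp add: powr_half_sqrt powr_realpow)
      then have j: "jker e k (r\<^sup>2) w = w powr (s - 1) * exp (- (c * w))"
        by (simp add: jker_def c_def)
      have m: "(c * w) powr (s - 1) = c powr (s - 1) * w powr (s - 1)" using True c by (simp add: powr_mult)
      have "0 + c * w \<in> {0..}" "w \<in> {0..}" using True c by auto
      then have "indicator {0..} (0 + c * w) * (0 + c * w) powr (s - 1) / exp (0 + c * w) = c powr (s - 1) * (indicator {0..} w * jker e k (r\<^sup>2) w)"
        unfolding j by (simp only: m indicator_simps add_0 mult_1 exp_minus divide_inverse mult.assoc)
      then show ?thesis using c by (simp only: ennreal_mult' powr_ge_zero)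
    next
      case False
      then show ?thesis using that c by (simp add: indicator_def zero_le_mult_iff)
    qed
    then show ?thesis using c AE_lborel_singleton[of 0]
      by (intro arg_cong2[of _ _ _ _ "(*)"] nn_integral_cong_AE) (auto elim!: eventually_mono)
  qed
  also have "\<dots> = ennreal (c powr s) * (\<integral>\<^sup>+w. ennreal (indicator {0..} w * jker e k (r\<^sup>2) w) \<partial>lborel)"
  proof -
    have "ennreal c * ennreal (c powr (s - 1)) = ennreal (c powr s)"
      using c by (subst ennreal_mult[symmetric]) (auto simp: powr_diff)
    then show ?thesis by (subst nn_integral_cmult) (auto simp: mult.assoc[symmetric])
  qed
  finally have *: "ennreal (c powr s) * (\<integral>\<^sup>+w. ennreal (indicator {0..} w * jker e k (r\<^sup>2) w) \<partial>lborel) = ennreal (Gamma s)" by simp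
  have "(\<integral>\<^sup>+w. ennreal (indicator {0..} w * jker e k (r\<^sup>2) w) \<partial>lborel) = ennreal (1 / c powr s) * (ennreal (c powr s) * (\<integral>\<^sup>+w. ennreal (indicator {0..} w * jker e k (r\<^sup>2) w) \<partial>lborel))"
    using c by (simp add: mult.assoc[symmetric] ennreal_mult'[symmetric])
  also have "\<dots> = ennreal (1 / c powr s * Gamma s)"
    unfolding * using Gamma_real_pos[OF s] by (subst ennreal_mult[symmetric]) auto
  also have "1 / c powr s * Gamma s = jinf e k r"
    unfolding cs unfolding jinf_def s_def using r by (simp add: power_divide)
  finally show "(\<integral>\<^sup>+w. ennreal (indicator {0..} w * jker e k (r\<^sup>2) w) \<partial>lborel) = ennreal (jinf e k r)" .
  show "0 \<le> jinf e k r" unfolding jinf_def using Gamma_real_pos[OF s] r by (simp add: s_def)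
qed (auto simp: jker_nonneg indicator_def)

lemma jinf_nonneg: "r > 0 \<Longrightarrow> jinf e k r \<ge> 0"
  unfolding jinf_def by (intro mult_nonneg_nonneg less_imp_le[OF Gamma_real_pos]) (auto intro: add_pos_nonneg)

lemma jint_le_jinf:
  assumes "r > 0"
  shows "jint e k b (r\<^sup>2) \<le> jinf e k r"
proof -
  have "jint e k b (r\<^sup>2) \<le> (LINT w|lborel. indicator {0..} w * jker e k (r\<^sup>2) w)"
    unfolding jint_lborel(2)
    by (rule integral_mono[OF jint_lborel(1)])
      (use jker_integral[OF assms, of e k] in \<open>auto simp: has_bochner_integral_iff jker_nonneg indicator_def\<close>)
  then show ?thesis using jker_integral[OF assms, of e k] by (simp add: has_bochner_integral_iff)
qed

text \<open>On the tail \<open>w > b\<close> the integrand gains the factor \<open>(w / b) ^ N \<ge> 1\<close>.\<close>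

lemma jinf_diff_jint:
  assumes r: "r > 0" and b: "b > 0"
  shows "\<bar>jinf e k r - jint e k b (r\<^sup>2)\<bar> \<le> jinf e (k + N) r / b ^ N"
proof -
  have "jinf e k r - jint e k b (r\<^sup>2) = (LINT w|lborel. indicator {0..} w * jker e k (r\<^sup>2) w - indicator {0..b} w * jker e k (r\<^sup>2) w)"
    using jker_integral[OF r, of e k] jint_lborel[where b = b and e = e and k = k and v = "r\<^sup>2"] by (simp add: has_bochner_integral_iff)
  also have "\<dots> \<le> (LINT w|lborel. indicator {0..} w * jker e (k + N) (r\<^sup>2) w / b ^ N)"
  proof (rule integral_mono)
    fix w :: real
    show "indicator {0..} w * jker e k (r\<^sup>2) w - indicator {0..b} w * jker e k (r\<^sup>2) w \<le> indicator {0..} w * jker e (k + N) (r\<^sup>2) w / b ^ N"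
    proof (cases "w > b")
      case True
      then have "b ^ N \<le> w ^ N" using b by (intro power_mono) auto
      then have "jker e k (r\<^sup>2) w * b ^ N \<le> jker e k (r\<^sup>2) w * w ^ N"
        using jker_nonneg[of w] True b by (intro mult_left_mono) auto
      then show ?thesis using True b by (simp add: jker_def power_add field_simps)
    next
      case False
      then show ?thesis using b jker_nonneg[of w] by (auto simp: indicator_def)
    qed
  qed (use jker_integral[OF r] jint_lborel in \<open>auto simp: has_bochner_integral_iff\<close>)
  also have "\<dots> = jinf e (k + N) r / b ^ N"
    using jker_integral[OF r, of e "k + N"] by (simp add: has_bochner_integral_iff)
  finally show ?thesis using jint_le_jinf[OF r, of e k b] by simp
qed

section \<open>The radial profile of the fundamental solution\<close>

definition fund_rad :: "nat \<Rightarrow> real \<Rightarrow> real" where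
  "fund_rad e r = (if e = 0 then - ln r / (2 * pi) else 1 / (r ^ e * ((real e + 2) * real e * unit_ball_vol (real e + 2))))"

lemma fund_sol_rad:
  assumes "CARD('n::finite) = e + 2" "x \<noteq> (0 :: real^'n)"
  shows "fund_sol x = fund_rad e (norm x)"
proof (cases "e = 0")
  case False
  have "norm x powr (2 - real CARD('n)) = inverse (norm x ^ e)"
    using assms by (simp add: powr_minus powr_realpow)
  then show ?thesis using False assms by (simp add: fund_sol_def fund_rad_def divide_inverse mult_ac add_ac)
qed (use assms in \<open>simp add: fund_sol_def fund_rad_def\<close>)

text \<open>Here the normalisation of \<open>fund_sol\<close> is reconciled with that of the heat
  kernel: the volume of the unit ball and the Gamma factor in \<open>jinf\<close> combine to (4 pi)
  ^ (-d/2). The logarithm is treated separately.\<close>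

lemma fund_rad_deriv:
  assumes r: "r > 0"
  shows "(fund_rad e has_real_derivative - (r / 2 * jinf e 0 r) / sqrt (4 * pi) ^ (e + 2)) (at r)"
proof (cases "e = 0")
  case True
  have "((\<lambda>r. - ln r / (2 * pi)) has_real_derivative - (1 / r) / (2 * pi)) (at r)"
    using r by (auto intro!: derivative_eq_intros simp: field_simps)
  moreover have "- (r / 2 * jinf 0 0 r) / sqrt (4 * pi) ^ 2 = - (1 / r) / (2 * pi)"
    using r by (simp add: jinf_def power_divide power2_eq_square field_simps)
  ultimately show ?thesis using True by (simp add: fund_rad_def[abs_def])
next
  case False
  define c where "c = (real e + 2) * real e * unit_ball_vol (real e + 2)"
  have c: "c > 0" using False by (auto simp: c_def intro!: mult_pos_pos)
  have "((\<lambda>r. 1 / (r ^ e * c)) has_real_derivative - (real e * r ^ (e - 1) * c) / (r ^ e * c)\<^sup>2) (at r)"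
    using r c by (auto intro!: derivative_eq_intros simp: power2_eq_square)
  moreover have "- (real e * r ^ (e - 1) * c) / (r ^ e * c)\<^sup>2 = - (r / 2 * jinf e 0 r) / sqrt (4 * pi) ^ (e + 2)"
  proof -
    have G: "Gamma (real e / 2 + 2) = (real e / 2 + 1) * Gamma (real e / 2 + 1)"
      using Gamma_plus1[of "real e / 2 + 1"] by (simp add: nonpos_Ints_def add_ac)
    have p: "pi powr ((real e + 2) / 2) = sqrt pi ^ (e + 2)"
    proof -
      have "pi powr ((real e + 2) / 2) = (pi powr (1 / 2)) powr real (e + 2)" by (simp add: powr_powr add_ac)
      also have "\<dots> = sqrt pi ^ (e + 2)" by (subst powr_realpow) (auto simp: powr_half_sqrt)
      finally show ?thesis .
    qed
    have u: "unit_ball_vol (real e + 2) = sqrt pi ^ (e + 2) / ((real e / 2 + 1) * Gamma (real e / 2 + 1))"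
    proof -
      have "(real e + 2) / 2 + 1 = real e / 2 + 2" by simp
      then show ?thesis unfolding unit_ball_vol_def p by (simp only: G)
    qed
    have "Gamma (real e / 2 + 1) > 0" by (intro Gamma_real_pos) (simp add: add_nonneg_pos)
    then have c': "c = 2 * real e * (sqrt pi ^ (e + 2)) / Gamma (real e / 2 + 1)" 
    proof -
      have "Q * E * (P / (Q / 2 * g)) = 2 * E * P / g" if "Q > 0" "g > 0" for Q E P g :: real
        using that by (simp add: field_simps)
      from this[of "real e + 2" "Gamma (real e / 2 + 1)"] \<open>Gamma (real e / 2 + 1) > 0\<close>
      show ?thesis unfolding c_def u by (simp add: add_divide_distrib del: power_Suc)
    qed
    have "- (real e * r ^ (e - 1) * c) / (r ^ e * c)\<^sup>2 = - (real e / (r ^ Suc e * c))"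
    proof -
      obtain m where "e = Suc m" using False by (cases e) auto
      then show ?thesis using r c by (simp add: power2_eq_square field_simps)
    qed
    also have "\<dots> = - (Gamma (real e / 2 + 1) / (2 * (sqrt pi ^ (e + 2)) * r ^ Suc e))"
      unfolding c' using False by (simp add: field_simps)
    also have "\<dots> = - (r / 2 * jinf e 0 r) / sqrt (4 * pi) ^ (e + 2)"
      using r by (simp add: jinf_def real_sqrt_mult power_mult_distrib power_divide field_simps)
    finally show ?thesis .
  qed
  ultimately show ?thesis using False by (simp add: fund_rad_def[abs_def] c_def)
qed

text \<open>Subtracting the value at a second radius makes the integral converge also for \<open>d = 2\<close>.\<close>

definition fker :: "nat \<Rightarrow> real \<Rightarrow> real \<Rightarrow> real \<Rightarrow> real" where
  "fker e p q w = indicator {0<..} w * (sqrt w ^ e / w * (exp (- (p\<^sup>2 * w) / 4) - exp (- (q\<^sup>2 * w) / 4)))"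

text \<open>The difference of exponentials is the integral of (\<rho> / 2)
  \<open>jker e 0 (\<rho>\<^sup>2) w\<close> over \<rho> in [p, q]. For p \<le> q everything is
  nonnegative, so Tonelli allows integrating in w before \<rho>; this gives
  \<open>jinf e 0 \<rho>\<close>, hence minus the derivative of \<open>fund_rad\<close> up to the
  normalising constant.\<close>

lemma fker_integral_le:
  assumes p: "0 < p" and pq: "p \<le> q"
  shows "has_bochner_integral lborel (fker e p q) (sqrt (4 * pi) ^ (e + 2) * (fund_rad e p - fund_rad e q))"
proof (rule has_bochner_integral_nn_integral)
  let ?f = "\<lambda>w \<rho>. ennreal (indicator {0..} w * (\<rho> / 2 * jker e 0 (\<rho>\<^sup>2) w)) * indicator {p..q} \<rho>"
  have F: "ennreal (fker e p q w) = (\<integral>\<^sup>+\<rho>. ?f w \<rho> \<partial>lborel)" if "w \<noteq> 0" for w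
  proof (cases "w > 0")
    case True
    have "(\<integral>\<^sup>+\<rho>. ennreal (\<rho> / 2 * jker e 0 (\<rho>\<^sup>2) w) * indicator {p..q} \<rho> \<partial>lborel) =
        ennreal (- (sqrt w ^ e / w * exp (- (q\<^sup>2 * w) / 4)) - - (sqrt w ^ e / w * exp (- (p\<^sup>2 * w) / 4)))"
    proof (rule nn_integral_FTC_Icc[OF _ _ _ pq])
      show "(\<lambda>\<rho>. \<rho> / 2 * jker e 0 (\<rho>\<^sup>2) w) \<in> borel_measurable borel" unfolding jker_def by measurable
      show "((\<lambda>\<rho>. - (sqrt w ^ e / w * exp (- (\<rho>\<^sup>2 * w) / 4))) has_real_derivative \<rho> / 2 * jker e 0 (\<rho>\<^sup>2) w) (at \<rho>)" for \<rho>
        unfolding jker_def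
        using True by (auto intro!: derivative_eq_intros simp: field_simps)
    qed (use p True in \<open>auto simp: jker_nonneg\<close>)
    then show ?thesis using True by (simp add: fker_def right_diff_distrib)
  next
    case False
    then show ?thesis using that by (simp add: fker_def)
  qed
  have "(\<integral>\<^sup>+w. ennreal (fker e p q w) \<partial>lborel) = (\<integral>\<^sup>+w. \<integral>\<^sup>+\<rho>. ?f w \<rho> \<partial>lborel \<partial>lborel)"
    using AE_lborel_singleton[of 0] F by (intro nn_integral_cong_AE) (auto elim!: eventually_mono)
  also have "\<dots> = (\<integral>\<^sup>+\<rho>. \<integral>\<^sup>+w. ?f w \<rho> \<partial>lborel \<partial>lborel)"
    by (rule lborel_pair.Fubini'[symmetric]) (unfold jker_def split_beta, measurable)
  also have "\<dots> = (\<integral>\<^sup>+\<rho>. ennreal (\<rho> / 2 * jinf e 0 \<rho>) * indicator {p..q} \<rho> \<partial>lborel)"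
  proof (intro nn_integral_cong)
    fix \<rho>
    show "(\<integral>\<^sup>+w. ?f w \<rho> \<partial>lborel) = ennreal (\<rho> / 2 * jinf e 0 \<rho>) * indicator {p..q} \<rho>"
    proof (cases "\<rho> \<in> {p..q}")
      case True
      then have \<rho>: "\<rho> > 0" using p by auto
      have "(\<integral>\<^sup>+w. ?f w \<rho> \<partial>lborel) = (\<integral>\<^sup>+w. ennreal (\<rho> / 2 * (indicator {0..} w * jker e 0 (\<rho>\<^sup>2) w)) \<partial>lborel)"
        using True by (simp add: mult_ac)
      also have "\<dots> = ennreal (\<rho> / 2 * jinf e 0 \<rho>)"
        using jker_integral[OF \<rho>, of e 0] \<rho> unfolding has_bochner_integral_iff
        by (subst nn_integral_eq_integral) (auto simp: jker_nonneg indicator_def intro!: AE_I2)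
      finally show ?thesis using True by simp
    qed simp
  qed
  also have "\<dots> = ennreal ((- (sqrt (4 * pi) ^ (e + 2) * fund_rad e q)) - (- (sqrt (4 * pi) ^ (e + 2) * fund_rad e p)))"
  proof (rule nn_integral_FTC_Icc[OF _ _ _ pq])
    show "(\<lambda>\<rho>. \<rho> / 2 * jinf e 0 \<rho>) \<in> borel_measurable borel" unfolding jinf_def by measurable
    fix \<rho> assume "\<rho> \<in> {p..q}"
    then have \<rho>: "\<rho> > 0" using p by auto
    show "((\<lambda>\<rho>. - (sqrt (4 * pi) ^ (e + 2) * fund_rad e \<rho>)) has_real_derivative \<rho> / 2 * jinf e 0 \<rho>) (at \<rho>)"
    proof -
      define S where "S = sqrt (4 * pi) ^ (e + 2)"
      have "S \<noteq> 0" by (simp add: S_def)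
      then show ?thesis
        unfolding S_def[symmetric]
        using DERIV_minus[OF DERIV_cmult[OF fund_rad_deriv[OF \<rho>, of e, folded S_def], of S]] by simp
    qed
    show "0 \<le> \<rho> / 2 * jinf e 0 \<rho>" using jinf_nonneg[OF \<rho>] \<rho> by simp
  qed
  finally show "(\<integral>\<^sup>+w. ennreal (fker e p q w) \<partial>lborel) = ennreal (sqrt (4 * pi) ^ (e + 2) * (fund_rad e p - fund_rad e q))"
    by (simp add: right_diff_distrib)
  have "fund_rad e q \<le> fund_rad e p"
  proof (rule DERIV_nonpos_imp_nonincreasing[OF pq])
    fix x assume "p \<le> x" "x \<le> q"
    then have "x > 0" using p by auto
    then show "\<exists>y. (fund_rad e has_real_derivative y) (at x) \<and> y \<le> 0"
      using fund_rad_deriv[of x e] jinf_nonneg[of x e 0] by (intro exI conjI) auto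
  qed
  then show "0 \<le> sqrt (4 * pi) ^ (e + 2) * (fund_rad e p - fund_rad e q)" by simp
  have "p\<^sup>2 * w \<le> q\<^sup>2 * w" if "w > 0" for w using that p pq by (intro mult_right_mono power_mono) auto
  then show "AE w in lborel. 0 \<le> fker e p q w" by (intro AE_I2) (auto simp: fker_def indicator_def)
qed (unfold fker_def, measurable)

lemma fker_integral:
  assumes "0 < p" "0 < q"
  shows "(LINT w|lborel. fker e p q w) = sqrt (4 * pi) ^ (e + 2) * (fund_rad e p - fund_rad e q)"
proof (cases "p \<le> q")
  case True
  then show ?thesis using fker_integral_le[OF assms(1) True] by (simp add: has_bochner_integral_iff)
next
  case False
  have "fker e p q w = - fker e q p w" for w by (simp add: fker_def algebra_simps)
  then show ?thesis using fker_integral_le[OF assms(2), of p e] False by (simp add: has_bochner_integral_iff algebra_simps)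
qed

section \<open>Convolution of the fundamental solution with a derivative of a Gaussian\<close>

lemma exp_minus_diff_le:
  fixes s t :: real
  assumes "s \<ge> 0" "t \<ge> 0"
  shows "\<bar>exp (- s) - exp (- t)\<bar> \<le> \<bar>s - t\<bar>"
proof -
  have *: "\<bar>exp (- s) - exp (- t)\<bar> \<le> \<bar>s - t\<bar>" if "0 \<le> s" "s \<le> t" for s t :: real
  proof -
    have "exp (- t) = exp (- s) * exp (- (t - s))" by (simp flip: exp_add)
    then have "exp (- s) - exp (- t) = exp (- s) * (1 - exp (- (t - s)))" by (simp add: right_diff_distrib)
    also have "\<dots> \<le> 1 * (t - s)"
    proof (rule mult_mono)
      show "1 - exp (- (t - s)) \<le> t - s" using exp_ge_add_one_self[of "- (t - s)"] by linarith
    qed (use that in auto)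
    finally show ?thesis using that by simp
  qed
  show ?thesis using *[of s t] *[of t s] assms by (cases "s \<le> t") (auto simp: abs_minus_commute)
qed

lemma complete_square:
  fixes x y :: "'a::real_inner"
  assumes "w > 0" "b > 0"
  shows "w * (norm (x - y))\<^sup>2 + b * (norm y)\<^sup>2 = (w + b) * (norm (y - (w / (w + b)) *\<^sub>R x))\<^sup>2 + (w * b / (w + b)) * (norm x)\<^sup>2"
proof -
  define s where "s = w + b"
  have s: "s > 0" "b = s - w" using assms by (auto simp: s_def)
  have "w * (norm (x - y))\<^sup>2 + b * (norm y)\<^sup>2 = w * (norm x)\<^sup>2 - 2 * w * (x \<bullet> y) + s * (norm y)\<^sup>2"
    unfolding power2_norm_eq_inner s(2) by (simp add: inner_diff_left inner_diff_right inner_commute algebra_simps)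
  moreover have "s * (norm (y - (w / s) *\<^sub>R x))\<^sup>2 = s * (norm y)\<^sup>2 - 2 * w * (x \<bullet> y) + w * w / s * (norm x)\<^sup>2"
    unfolding power2_norm_eq_inner using s(1) by (simp add: inner_diff_left inner_diff_right inner_commute field_simps)
  moreover have "w * w / s * (norm x)\<^sup>2 + w * b / s * (norm x)\<^sup>2 = w * (norm x)\<^sup>2"
    using s(1) unfolding s(2) by (simp add: field_simps)
  ultimately show ?thesis unfolding s_def[symmetric] by linarith
qed

text \<open>With b = 1 / \<tau>, a constant multiple of \<partial>_j of the heat kernel at time
  \<tau>, which is the divergence of the field G_\<tau> e_j.\<close>

definition gmom :: "real \<Rightarrow> 'n::finite \<Rightarrow> real^'n \<Rightarrow> real" where
  "gmom b j y = y $ j * exp (- (b * (norm y)\<^sup>2) / 4)"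

lemma borel_gmom [measurable]: "gmom b j \<in> borel_measurable borel"
  unfolding gmom_def by measurable

lemma gmom_abs_le: "\<bar>gmom b j y\<bar> \<le> norm y * exp (- (b / 4) * (norm y)\<^sup>2)"
  unfolding gmom_def by (simp add: abs_mult mult_right_mono component_le_norm_cart)

lemma gmom_integral:
  assumes "b > 0"
  shows "integrable lborel (gmom b j)" "(LINT y|lborel. gmom b j y) = 0"
  using gauss_first_moment[of "b / 4" j 0] assms by (simp_all add: gmom_def[abs_def])

lemma gmom_bounded:
  assumes b: "b > 0"
  obtains H where "H \<ge> 0" "\<And>y :: real^'n::finite. \<bar>gmom b j y\<bar> \<le> H"
proof
  define \<rho> where "\<rho> = 1 / sqrt b"
  have \<rho>: "\<rho> > 0" "\<rho>\<^sup>2 = 1 / b" using b by (auto simp: \<rho>_def power_divide)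
  show "0 \<le> sqrt (2 ^ 1 * fact 1) * \<rho> ^ 1" using \<rho> by simp
  fix y :: "real^'n"
  have "\<bar>gmom b j y\<bar> \<le> norm y ^ 1 * exp (- (norm y)\<^sup>2 / (4 * \<rho>\<^sup>2))"
    using gmom_abs_le[of b j y] by (simp add: \<rho>(2) mult_ac)
  also have "\<dots> \<le> sqrt (2 ^ 1 * fact 1) * \<rho> ^ 1" by (rule power_gauss_bound) (use \<rho> in auto)
  finally show "\<bar>gmom b j y\<bar> \<le> sqrt (2 ^ 1 * fact 1) * \<rho> ^ 1" .
qed

text \<open>Completing the square leaves one Gaussian centred at w x / (w + b), whose first moment
  is known. The new parameter w b / (w + b) is the reciprocal of 1 / w + 1 / b: this is the
  semigroup law in reciprocal times.\<close>

lemma gmom_gauss_conv: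
  fixes x :: "real^'n::finite"
  assumes w: "w > 0" and b: "b > 0"
  shows "integrable lborel (\<lambda>y. exp (- ((norm (x - y))\<^sup>2 * w) / 4) * gmom b j y)"
    and "(LINT y|lborel. exp (- ((norm (x - y))\<^sup>2 * w) / 4) * gmom b j y) =
      exp (- ((norm x)\<^sup>2 * (w * b / (w + b))) / 4) * (w / (w + b) * x $ j * sqrt (4 * pi / (w + b)) ^ CARD('n))"
proof -
  let ?m = "(w / (w + b)) *\<^sub>R x"
  have e: "exp (- ((norm (x - y))\<^sup>2 * w) / 4) * gmom b j y =
      exp (- ((norm x)\<^sup>2 * (w * b / (w + b))) / 4) * (y $ j * exp (- ((w + b) / 4) * (norm (y - ?m))\<^sup>2))" for y
  proof -
    have "- ((norm (x - y))\<^sup>2 * w) / 4 + - (b * (norm y)\<^sup>2) / 4 = - ((norm x)\<^sup>2 * (w * b / (w + b))) / 4 + - ((w + b) / 4) * (norm (y - ?m))\<^sup>2"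
    proof -
      define q s D where "q = w * b / (w + b)" and "s = w + b" and "D = (norm (y - ?m))\<^sup>2"
      have "w * (norm (x - y))\<^sup>2 + b * (norm y)\<^sup>2 = s * D + q * (norm x)\<^sup>2"
        using complete_square[OF w b, of x y] by (simp only: q_def s_def D_def)
      then show ?thesis unfolding q_def[symmetric] D_def[symmetric] unfolding s_def[symmetric] by (simp add: algebra_simps)
    qed
    then have "exp (- ((norm (x - y))\<^sup>2 * w) / 4) * exp (- (b * (norm y)\<^sup>2) / 4) = exp (- ((norm x)\<^sup>2 * (w * b / (w + b))) / 4) * exp (- ((w + b) / 4) * (norm (y - ?m))\<^sup>2)"
      unfolding exp_add[symmetric] by simp
    then show ?thesis by (simp add: gmom_def mult_ac)
  qed
  have "(w + b) / 4 > 0" using w b by simp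
  note G = gauss_first_moment[OF this, of j ?m]
  show "integrable lborel (\<lambda>y. exp (- ((norm (x - y))\<^sup>2 * w) / 4) * gmom b j y)"
    unfolding e by (intro integrable_mult_right G(1))
  show "(LINT y|lborel. exp (- ((norm (x - y))\<^sup>2 * w) / 4) * gmom b j y) =
      exp (- ((norm x)\<^sup>2 * (w * b / (w + b))) / 4) * (w / (w + b) * x $ j * sqrt (4 * pi / (w + b)) ^ CARD('n))"
    unfolding e integral_mult_right_zero G(2) by (simp add: mult.commute[of 4 pi])
qed

text \<open>The map w \<mapsto> w b / (w + b) carries (0, \<infinity>) increasingly onto (0, b) with
  derivative b ^ 2 / (w + b) ^ 2. In the time variable s = 1 / w it is the shift s \<mapsto> s + 1 /
  b, which explains why smoothing by G_\<tau> truncates the superposition at \<tau>.\<close>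

lemma jint_substitution:
  assumes b: "b > 0"
  shows "(LINT w:{0<..}|lborel. jker e 0 v (w * b / (w + b)) * (b\<^sup>2 / (w + b)\<^sup>2)) = jint e 0 b v"
proof -
  let ?\<theta> = "\<lambda>w. w * b / (w + b)"
  let ?f = "\<lambda>w. jker e 0 v (?\<theta> w) * (b\<^sup>2 / (w + b)\<^sup>2)"
  let ?F = "\<lambda>w. jint e 0 (?\<theta> w) v"
  have d: "(?F has_real_derivative ?f w) (at w)" if "w > 0" for w
  proof -
    have "(?\<theta> has_real_derivative b\<^sup>2 / (w + b)\<^sup>2) (at w)"
      using that b by (auto intro!: derivative_eq_intros simp: power2_eq_square algebra_simps)
    from DERIV_chain2[OF jint_deriv_upper this] that b show ?thesis by simp
  qed
  have c: "isCont ?f w" if "w > 0" for w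
  proof -
    have "w + b \<noteq> 0" using that b by simp
    then show ?thesis unfolding jker_def by (intro continuous_intros) auto
  qed
  have q: "((\<lambda>c. jint e 0 c v) \<longlongrightarrow> 0) (at_right 0)"
  proof -
    have "continuous_on {0..1} (\<lambda>c. jint e 0 c v)"
      unfolding jint_def by (rule indefinite_integral_continuous_1) (intro integrable_continuous_interval continuous_jker)
    then have "((\<lambda>c. jint e 0 c v) \<longlongrightarrow> jint e 0 0 v) (at 0 within {0..1})"
      by (auto simp: continuous_on_def)
    then show ?thesis by (simp add: at_within_Icc_at_right jint_def)
  qed
  have A: "(?F \<longlongrightarrow> 0) (at_right 0)"
  proof (rule filterlim_compose[OF q])
    have "(?\<theta> \<longlongrightarrow> 0 * b / (0 + b)) (at_right 0)" using b by (intro tendsto_intros) auto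
    moreover have "\<forall>\<^sub>F w in at_right 0. ?\<theta> w > 0"
      using b by (auto simp: eventually_at_right_less intro!: eventually_mono[OF eventually_at_right_less[of 0]])
    ultimately show "filterlim ?\<theta> (at_right 0) (at_right 0)"
      by (intro tendsto_imp_filterlim_at_right) auto
  qed
  have B: "(?F \<longlongrightarrow> jint e 0 b v) at_top"
  proof (rule isCont_tendsto_compose[OF jint_isCont_upper[OF b]])
    have "filterlim (\<lambda>w. w + b) at_top at_top"
      using filterlim_tendsto_add_at_top[OF tendsto_const[of b] filterlim_ident] by (simp add: add.commute)
    then have "((\<lambda>w. b - b\<^sup>2 / (w + b)) \<longlongrightarrow> b - 0) at_top"
      by (intro tendsto_diff tendsto_const real_tendsto_divide_at_top[OF tendsto_const])
    moreover have "\<forall>\<^sub>F w in at_top. b - b\<^sup>2 / (w + b) = ?\<theta> w"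
      by (rule eventually_mono[OF eventually_gt_at_top[of 0]]) (use b in \<open>simp add: field_simps power2_eq_square\<close>)
    ultimately show "(?\<theta> \<longlongrightarrow> b) at_top" by (simp add: tendsto_cong)
  qed
  have nn: "0 \<le> ?f w" if "w > 0" for w
    using that b by (intro mult_nonneg_nonneg jker_nonneg) auto
  have A': "((?F \<circ> real_of_ereal) \<longlongrightarrow> 0) (at_right 0)"
    unfolding zero_ereal_def ereal_tendsto_simps1 by (rule A)
  have B': "((?F \<circ> real_of_ereal) \<longlongrightarrow> jint e 0 b v) (at_left \<infinity>)"
    unfolding ereal_tendsto_simps1 by (rule B)
  have "(LBINT w=0..\<infinity>. ?f w) = jint e 0 b v - 0"
    by (rule interval_integral_FTC_nonneg(2)[OF _ _ _ _ A' B']) (use d c nn in auto)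
  then show ?thesis by (simp add: interval_lebesgue_integral_0_infty)
qed

text \<open>The exponential at the reference radius 1 does not depend on y, so its contribution
  vanishes with the mean of \<open>gmom\<close>. The remaining powers of w and b are arranged to
  exhibit the Jacobian of \<open>jint_substitution\<close>.\<close>

lemma fker_gmom_integral:
  fixes x :: "real^'n::finite"
  assumes d: "CARD('n) = e + 2" and b: "b > 0" and w: "w > 0"
  shows "integrable lborel (\<lambda>y. fker e (norm (x - y)) 1 w * gmom b j y)"
    and "(LINT y|lborel. fker e (norm (x - y)) 1 w * gmom b j y) =
      sqrt (4 * pi) ^ (e + 2) * x $ j / (b * sqrt b ^ (e + 2)) * (jker e 0 ((norm x)\<^sup>2) (w * b / (w + b)) * (b\<^sup>2 / (w + b)\<^sup>2))"
proof -
  have f: "fker e (norm (x - y)) 1 w * gmom b j y = sqrt w ^ e / w * (exp (- ((norm (x - y))\<^sup>2 * w) / 4) * gmom b j y - exp (- w / 4) * gmom b j y)" for y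
    using w by (simp add: fker_def algebra_simps)
  note G = gmom_gauss_conv[OF w b, of x j] gmom_integral[OF b, of j]
  show "integrable lborel (\<lambda>y. fker e (norm (x - y)) 1 w * gmom b j y)"
    unfolding f by (intro integrable_mult_right Bochner_Integration.integrable_diff G)
  have "(LINT y|lborel. fker e (norm (x - y)) 1 w * gmom b j y) = sqrt w ^ e / w * (exp (- ((norm x)\<^sup>2 * (w * b / (w + b))) / 4) * (w / (w + b) * x $ j * sqrt (4 * pi / (w + b)) ^ CARD('n)))"
    unfolding f integral_mult_right_zero using G by simp
  also have "\<dots> = x $ j * exp (- ((norm x)\<^sup>2 * (w * b / (w + b))) / 4) * (sqrt w ^ e / (w + b) * sqrt (4 * pi / (w + b)) ^ (e + 2))"
    using w unfolding d by (simp del: power_Suc)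
  also have "sqrt w ^ e / (w + b) * sqrt (4 * pi / (w + b)) ^ (e + 2) = sqrt (4 * pi) ^ (e + 2) / (b * sqrt b ^ (e + 2)) * (sqrt (w * b / (w + b)) ^ e * (b\<^sup>2 / (w + b)\<^sup>2))"
  proof -
    define B S where "B = sqrt b" and "S = sqrt (w + b)"
    have BS: "B > 0" "S > 0" "b = B\<^sup>2" "w + b = S\<^sup>2" using w b by (auto simp: B_def S_def)
    have "sqrt w ^ e / S\<^sup>2 * (sqrt (4 * pi) / S) ^ (e + 2) = sqrt (4 * pi) ^ (e + 2) / (B\<^sup>2 * B ^ (e + 2)) * ((sqrt w * B / S) ^ e * ((B\<^sup>2)\<^sup>2 / (S\<^sup>2)\<^sup>2))"
      using BS(1,2) by (simp add: power_mult_distrib power_divide power_add field_simps power2_eq_square)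
    then have "sqrt w ^ e / (w + b) * (sqrt (4 * pi) / S) ^ (e + 2) = sqrt (4 * pi) ^ (e + 2) / (b * B ^ (e + 2)) * ((sqrt w * B / S) ^ e * (b\<^sup>2 / (w + b)\<^sup>2))"
      unfolding BS(3,4)[symmetric] .
    then show ?thesis
      unfolding real_sqrt_divide real_sqrt_mult[of w b] B_def S_def .
  qed
  finally show "(LINT y|lborel. fker e (norm (x - y)) 1 w * gmom b j y) =
      sqrt (4 * pi) ^ (e + 2) * x $ j / (b * sqrt b ^ (e + 2)) * (jker e 0 ((norm x)\<^sup>2) (w * b / (w + b)) * (b\<^sup>2 / (w + b)\<^sup>2))"
    by (simp add: jker_def del: power_Suc)
qed

text \<open>This is what Fubini requires. For w \<le> 1 the difference of exponentials is O(w) and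
  cancels the factor 1 / w. For w \<ge> 1 the Gaussian in x - y has mass of order w ^ (-d/2), which
  together with w ^ (d/2 - 2) gives w ^ (-2), and the reference term is exponentially small. The
  exponent is written -1 - 1 to fit \<open>integrable_powr_tail\<close>.\<close>

lemma fker_gmom_norm_integral:
  fixes x :: "real^'n::finite"
  assumes d: "CARD('n) = e + 2" and b: "b > 0"
  obtains D where "\<And>w. w > 0 \<Longrightarrow> (LINT y|lborel. \<bar>fker e (norm (x - y)) 1 w * gmom b j y\<bar>) \<le> D * (1 + \<bar>w\<bar>) powr (- 1 - 1)"
proof -
  define a where "a = b / 4"
  have a: "a > 0" using b by (simp add: a_def)
  define g1 where "g1 y = (2 * (norm x)\<^sup>2 + 1) * (norm y ^ 1 * exp (- a * (norm y)\<^sup>2)) + 2 * (norm y ^ 3 * exp (- a * (norm y)\<^sup>2))" for y :: "real^'n"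
  have g1: "integrable lborel g1"
    unfolding g1_def by (intro Bochner_Integration.integrable_add integrable_mult_right gauss_moment_integrable a)
  obtain H where H: "H \<ge> 0" "\<And>y :: real^'n. \<bar>gmom b j y\<bar> \<le> H" using gmom_bounded[OF b, of j] by blast
  define L where "L = (LINT y|lborel. \<bar>gmom b j y\<bar>)"
  define M where "M = (LINT y|lborel. g1 y)"
  have L: "L \<ge> 0" unfolding L_def by simp
  have M: "M \<ge> 0" unfolding M_def g1_def by (intro integral_nonneg_AE AE_I2) auto
  \<comment> \<open>The first summand comes from the Gaussian mass times the sup bound H on
    \<open>gmom\<close>, the second from the reference term, where exp (-w/4) absorbs the power w ^
    (e+2).\<close>
  define E where "E = H * sqrt (4 * pi) ^ (e + 2) + 4 ^ (e + 2) * fact (e + 2) * L"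
  have E: "E \<ge> 0" unfolding E_def using H L by simp
  note mf = fker_gmom_integral(1)[OF d b, of _ x j, THEN integrable_abs]
  have 1: "(LINT y|lborel. \<bar>fker e (norm (x - y)) 1 w * gmom b j y\<bar>) \<le> M" if w: "0 < w" "w \<le> 1" for w
    unfolding M_def
  proof (rule integral_mono[OF mf[OF w(1)] g1])
    fix y :: "real^'n"
    have "\<bar>exp (- ((norm (x - y))\<^sup>2 * w / 4)) - exp (- (w / 4))\<bar> \<le> \<bar>(norm (x - y))\<^sup>2 * w / 4 - w / 4\<bar>"
      by (rule exp_minus_diff_le) (use w in auto)
    also have "\<dots> \<le> (norm (x - y))\<^sup>2 * w / 4 + w / 4" using w by (intro order_trans[OF abs_triangle_ineq4]) auto
    also have "\<dots> \<le> w * ((norm (x - y))\<^sup>2 + 1)"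
    proof -
      have "0 \<le> w * (norm (x - y))\<^sup>2" using w by simp
      then show ?thesis using w unfolding distrib_left mult.commute[of "(norm (x - y))\<^sup>2" w] by linarith
    qed
    also have "(norm (x - y))\<^sup>2 \<le> 2 * (norm x)\<^sup>2 + 2 * (norm y)\<^sup>2"
    proof -
      have "(norm (x - y))\<^sup>2 \<le> (norm x + norm y)\<^sup>2" by (intro power_mono norm_triangle_ineq4) auto
      also have "\<dots> \<le> 2 * (norm x)\<^sup>2 + 2 * (norm y)\<^sup>2"
        using sum_squares_bound[of "norm x" "norm y"] by (simp add: power2_sum)
      finally show ?thesis .
    qed
    finally have q: "\<bar>exp (- ((norm (x - y))\<^sup>2 * w / 4)) - exp (- (w / 4))\<bar> \<le> w * (2 * (norm x)\<^sup>2 + 2 * (norm y)\<^sup>2 + 1)"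
      using w by simp
    have "\<bar>fker e (norm (x - y)) 1 w\<bar> = sqrt w ^ e / w * \<bar>exp (- ((norm (x - y))\<^sup>2 * w / 4)) - exp (- (w / 4))\<bar>"
      using w by (simp add: fker_def abs_mult)
    also have "\<dots> \<le> 1 / w * (w * (2 * (norm x)\<^sup>2 + 2 * (norm y)\<^sup>2 + 1))"
      by (intro mult_mono q divide_right_mono power_le_one) (use w in auto)
    finally have "\<bar>fker e (norm (x - y)) 1 w\<bar> \<le> 2 * (norm x)\<^sup>2 + 2 * (norm y)\<^sup>2 + 1" using w by simp
    then have "\<bar>fker e (norm (x - y)) 1 w * gmom b j y\<bar> \<le> (2 * (norm x)\<^sup>2 + 2 * (norm y)\<^sup>2 + 1) * (norm y * exp (- a * (norm y)\<^sup>2))"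
      unfolding abs_mult a_def by (intro mult_mono gmom_abs_le) auto
    then show "\<bar>fker e (norm (x - y)) 1 w * gmom b j y\<bar> \<le> g1 y"
      by (simp add: g1_def algebra_simps power_numeral_reduce)
  qed
  have 2: "(LINT y|lborel. \<bar>fker e (norm (x - y)) 1 w * gmom b j y\<bar>) \<le> E / w\<^sup>2" if w: "1 \<le> w" for w
  proof -
    have w0: "w > 0" using w by simp
    have G: "integrable lborel (\<lambda>y. exp (- (w / 4) * (norm (y - x))\<^sup>2))"
      "(LINT y|lborel. exp (- (w / 4) * (norm (y - x))\<^sup>2)) = sqrt (pi / (w / 4)) ^ CARD('n)"
      using gauss_integral[of "w / 4" x] w0 by simp_all
    have Li: "integrable lborel (\<lambda>y::real^'n. \<bar>gmom b j y\<bar>)" using gmom_integral(1)[OF b] by (rule integrable_abs)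
    have "(LINT y|lborel. \<bar>fker e (norm (x - y)) 1 w * gmom b j y\<bar>) \<le>
      (LINT y|lborel. sqrt w ^ e / w * (H * exp (- (w / 4) * (norm (y - x))\<^sup>2) + exp (- (w / 4)) * \<bar>gmom b j y\<bar>))"
    proof (rule integral_mono[OF mf[OF w0]])
      show "integrable lborel (\<lambda>y. sqrt w ^ e / w * (H * exp (- (w / 4) * (norm (y - x))\<^sup>2) + exp (- (w / 4)) * \<bar>gmom b j y\<bar>))"
        using G(1) Li by (intro integrable_mult_right Bochner_Integration.integrable_add) auto
      fix y :: "real^'n"
      have "\<bar>fker e (norm (x - y)) 1 w * gmom b j y\<bar> = sqrt w ^ e / w * (\<bar>exp (- (w / 4) * (norm (y - x))\<^sup>2) - exp (- (w / 4))\<bar> * \<bar>gmom b j y\<bar>)"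
        using w0 by (simp add: fker_def abs_mult norm_minus_commute mult_ac)
      also have "\<dots> \<le> sqrt w ^ e / w * (exp (- (w / 4) * (norm (y - x))\<^sup>2) * \<bar>gmom b j y\<bar> + exp (- (w / 4)) * \<bar>gmom b j y\<bar>)"
        unfolding distrib_right[symmetric] using w0 by (intro mult_left_mono mult_right_mono order_trans[OF abs_triangle_ineq4]) auto
      also have "\<dots> \<le> sqrt w ^ e / w * (exp (- (w / 4) * (norm (y - x))\<^sup>2) * H + exp (- (w / 4)) * \<bar>gmom b j y\<bar>)"
        using w0 H by (intro mult_left_mono add_mono) auto
      finally show "\<bar>fker e (norm (x - y)) 1 w * gmom b j y\<bar> \<le> sqrt w ^ e / w * (H * exp (- (w / 4) * (norm (y - x))\<^sup>2) + exp (- (w / 4)) * \<bar>gmom b j y\<bar>)"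
        by (simp only: mult.commute[of H])
    qed
    also have "\<dots> = sqrt w ^ e / w * (H * sqrt (pi / (w / 4)) ^ CARD('n) + exp (- (w / 4)) * L)"
      using G Li by (simp add: L_def)
    also have "\<dots> = H * (sqrt w ^ e / w * sqrt (pi / (w / 4)) ^ (e + 2)) + (sqrt w ^ e / w * exp (- (w / 4))) * L"
      unfolding d by (simp only: distrib_left mult_ac)
    also have "sqrt w ^ e / w * sqrt (pi / (w / 4)) ^ (e + 2) = sqrt (4 * pi) ^ (e + 2) / w\<^sup>2"
    proof -
      have sq: "sqrt (pi / (w / 4)) = sqrt (4 * pi) / sqrt w" by (simp add: real_sqrt_divide real_sqrt_mult)
      have "sqrt w ^ e / w * sqrt (pi / (w / 4)) ^ (e + 2) = sqrt (4 * pi) ^ (e + 2) / (w * (sqrt w)\<^sup>2)"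
      proof -
        have "T ^ e / w * (Z / T) ^ (e + 2) = Z ^ (e + 2) / (w * T\<^sup>2)" if "T > 0" for T Z :: real
          using that w0 by (simp add: power_divide power_add power2_eq_square)
        from this[of "sqrt w" "sqrt (4 * pi)"] show ?thesis unfolding sq using w0 by (simp only: real_sqrt_gt_0_iff)
      qed
      then show ?thesis using w0 by (simp add: power2_eq_square)
    qed
    also have "sqrt w ^ e / w * exp (- (w / 4)) \<le> 4 ^ (e + 2) * fact (e + 2) / w\<^sup>2"
    proof -
      have "sqrt w \<le> w" using w by (simp add: sqrt_le_D real_sqrt_le_iff' power2_eq_square)
      then have "sqrt w ^ e / w \<le> w ^ e / 1" using w by (intro frac_le power_mono) auto
      then have "sqrt w ^ e / w * exp (- (w / 4)) * w\<^sup>2 \<le> w ^ e * exp (- (w / 4)) * w\<^sup>2" by (intro mult_right_mono) auto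
      also have "\<dots> = 4 ^ (e + 2) * ((w / 4) ^ (e + 2) * exp (- (w / 4)))" by (simp add: power_divide power_add power2_eq_square)
      also have "\<dots> \<le> 4 ^ (e + 2) * fact (e + 2)" using power_exp_bound[of "w / 4" "e + 2"] w0 by (intro mult_left_mono) auto
      finally show ?thesis using w0 by (simp add: pos_le_divide_eq)
    qed
    finally show ?thesis using L by (simp add: E_def add_divide_distrib mult_right_mono)
  qed
  show ?thesis
  proof
    fix w :: real assume w: "w > 0"
    have p: "(1 + \<bar>w\<bar>) powr (- 1 - 1) = 1 / (1 + w)\<^sup>2"
      using w by (simp add: powr_minus_divide powr_numeral)
    have "M \<le> 4 * (M + E) * (1 / (1 + w)\<^sup>2)" if "w \<le> 1"
    proof -
      have "(1 + w)\<^sup>2 \<le> 2\<^sup>2" using w that by (intro power_mono) auto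
      then have "M * (1 + w)\<^sup>2 \<le> (M + E) * 2\<^sup>2" using M E by (intro mult_mono) auto
      then show ?thesis using w by (simp add: pos_le_divide_eq)
    qed
    moreover have "E / w\<^sup>2 \<le> 4 * (M + E) * (1 / (1 + w)\<^sup>2)" if "w \<ge> 1"
    proof -
      have "(1 + w)\<^sup>2 \<le> (2 * w)\<^sup>2" using w that by (intro power_mono) auto
      then have "E * (1 + w)\<^sup>2 \<le> (M + E) * (4 * w\<^sup>2)" using M E by (intro mult_mono) (auto simp: power_mult_distrib)
      then show ?thesis using w by (simp add: field_simps)
    qed
    ultimately show "(LINT y|lborel. \<bar>fker e (norm (x - y)) 1 w * gmom b j y\<bar>) \<le> 4 * (M + E) * (1 + \<bar>w\<bar>) powr (- 1 - 1)"
      unfolding p using 1[of w] 2[of w] w by (cases "w \<le> 1") (auto intro: order_trans)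
  qed
qed

text \<open>Off the null set y = x, \<open>fund_sol\<close> is the w-integral of \<open>fker\<close>
  plus the constant \<open>fund_rad e 1\<close>. Fubini and \<open>jint_substitution\<close>
  evaluate the first part; the constant drops out against the mean-zero \<open>gmom\<close>.\<close>

lemma fund_sol_gmom_conv:
  fixes x :: "real^'n::finite"
  assumes d: "CARD('n) = e + 2" and b: "b > 0"
  shows "(LINT y|lborel. fund_sol (x - y) * gmom b j y) = x $ j * jint e 0 b ((norm x)\<^sup>2) / (b * sqrt b ^ (e + 2))"
proof -
  let ?S = "sqrt (4 * pi) ^ (e + 2)"
  define f where "f w y = fker e (norm (x - y)) 1 w * gmom b j y" for w and y :: "real^'n"
  obtain D where D: "\<And>w. w > 0 \<Longrightarrow> (LINT y|lborel. \<bar>f w y\<bar>) \<le> D * (1 + \<bar>w\<bar>) powr (- 1 - 1)"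
    using fker_gmom_norm_integral[OF d b, of x j] unfolding f_def by blast
  have f0: "f w y = 0" if "w \<le> 0" for w y using that by (simp add: f_def fker_def)
  have m [measurable]: "case_prod f \<in> borel_measurable (lborel \<Otimes>\<^sub>M lborel)"
    unfolding f_def fker_def split_beta by measurable
  have int: "integrable (lborel \<Otimes>\<^sub>M lborel) (case_prod f)"
  proof (rule lborel_pair.Fubini_integrable[OF m])
    show "AE w in lborel. integrable lborel (\<lambda>y. case_prod f (w, y))"
    proof (intro AE_I2)
      fix w show "integrable lborel (\<lambda>y. case_prod f (w, y))"
      proof (cases "w > 0")
        case True
        then show ?thesis using fker_gmom_integral(1)[OF d b True, of x j] by (simp add: f_def)
      next
        case False
        then show ?thesis by (simp add: f0)
      qed
    qed
    show "integrable lborel (\<lambda>w. LINT y|lborel. norm (case_prod f (w, y)))"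
    proof (rule Bochner_Integration.integrable_bound)
      show "integrable lborel (\<lambda>w::real. \<bar>D\<bar> * (1 + \<bar>w\<bar>) powr (- 1 - 1))"
        by (intro integrable_mult_right integrable_powr_tail) auto
      show "AE w in lborel. norm (LINT y|lborel. norm (case_prod f (w, y))) \<le> norm (\<bar>D\<bar> * (1 + \<bar>w\<bar>) powr (- 1 - 1))"
      proof (intro AE_I2)
        fix w
        show "norm (LINT y|lborel. norm (case_prod f (w, y))) \<le> norm (\<bar>D\<bar> * (1 + \<bar>w\<bar>) powr (- 1 - 1))"
        proof (cases "w > 0")
          case True
          have "D * (1 + \<bar>w\<bar>) powr (- 1 - 1) \<le> \<bar>D\<bar> * (1 + \<bar>w\<bar>) powr (- 1 - 1)" by (intro mult_right_mono) auto
          then show ?thesis using D[OF True] by simp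
        qed (simp add: f0)
      qed
    qed measurable
  qed
  have "(LINT y|lborel. LINT w|lborel. f w y) = (LINT w|lborel. LINT y|lborel. f w y)"
    by (rule lborel_pair.Fubini_integral[OF int])
  also have "(LINT w|lborel. LINT y|lborel. f w y) =
     (LINT w|lborel. ?S * x $ j / (b * sqrt b ^ (e + 2)) * (indicator {0<..} w *\<^sub>R (jker e 0 ((norm x)\<^sup>2) (w * b / (w + b)) * (b\<^sup>2 / (w + b)\<^sup>2))))"
  proof (intro Bochner_Integration.integral_cong refl)
    fix w
    show "(LINT y|lborel. f w y) = ?S * x $ j / (b * sqrt b ^ (e + 2)) * (indicator {0<..} w *\<^sub>R (jker e 0 ((norm x)\<^sup>2) (w * b / (w + b)) * (b\<^sup>2 / (w + b)\<^sup>2)))"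
    proof (cases "w > 0")
      case True
      then show ?thesis using fker_gmom_integral(2)[OF d b True, of x j] by (simp add: f_def)
    qed (simp add: f0)
  qed
  also have "\<dots> = ?S * x $ j / (b * sqrt b ^ (e + 2)) * jint e 0 b ((norm x)\<^sup>2)"
    unfolding integral_mult_right_zero using jint_substitution[OF b, of e "(norm x)\<^sup>2"] by (simp add: set_lebesgue_integral_def)
  finally have I: "(LINT y|lborel. LINT w|lborel. f w y) = ?S * x $ j / (b * sqrt b ^ (e + 2)) * jint e 0 b ((norm x)\<^sup>2)" .
  have i: "integrable lborel (\<lambda>y. LINT w|lborel. f w y)"
    by (rule lborel_pair.integrable_snd[OF int])
  have "(LINT y|lborel. fund_sol (x - y) * gmom b j y) = (LINT y|lborel. (LINT w|lborel. f w y) / ?S + fund_rad e 1 * gmom b j y)"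
  proof (rule integral_cong_AE)
    show "(\<lambda>y. fund_sol (x - y) * gmom b j y) \<in> borel_measurable lborel"
      unfolding fund_sol_def by measurable
    show "(\<lambda>y. (LINT w|lborel. f w y) / ?S + fund_rad e 1 * gmom b j y) \<in> borel_measurable lborel"
      using i by (intro borel_measurable_add borel_measurable_divide) auto
    show "AE y in lborel. fund_sol (x - y) * gmom b j y = (LINT w|lborel. f w y) / ?S + fund_rad e 1 * gmom b j y"
      using AE_lborel_singleton[of x]
    proof eventually_elim
      case (elim y)
      then have "(LINT w|lborel. f w y) = ?S * (fund_rad e (norm (x - y)) - fund_rad e 1) * gmom b j y"
        using fker_integral[of "norm (x - y)" 1 e] by (simp add: f_def)
      moreover have "?S \<noteq> 0" by simp
      moreover have "fund_sol (x - y) = fund_rad e (norm (x - y))" using fund_sol_rad[OF d, of "x - y"] elim by simp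
      ultimately show ?case by (simp add: field_simps)
    qed
  qed
  also have "\<dots> = (LINT y|lborel. LINT w|lborel. f w y) / ?S"
    using i gmom_integral[OF b, of j] by (subst Bochner_Integration.integral_add) auto
  also have "\<dots> = x $ j * jint e 0 b ((norm x)\<^sup>2) / (b * sqrt b ^ (e + 2))"
    unfolding I by simp
  finally show ?thesis .
qed

section \<open>The derivatives of the Oseen kernel\<close>

definition ecard :: "'n::finite itself \<Rightarrow> nat" where "ecard _ = CARD('n) - 2"

text \<open>The power of 4 pi is the Gaussian normalisation; the factor 1/2 comes from \<partial>_j
  exp (-|x| ^ 2 w / 4).\<close>

definition cnorm :: "'n::finite itself \<Rightarrow> real" where "cnorm _ = 1 / (2 * sqrt (4 * pi) ^ CARD('n))"

lemma cnorm_pos: "cnorm TYPE('n::finite) > 0"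
  by (simp add: cnorm_def)

lemma has_derivative_radial:
  fixes x :: "real^'n::finite"
  assumes "(\<phi> has_real_derivative D) (at ((norm x)\<^sup>2))"
  shows "((\<lambda>x. \<phi> ((norm x)\<^sup>2)) has_derivative (\<lambda>h. 2 * (x \<bullet> h) * D)) (at x)"
proof -
  have "((\<lambda>x. x \<bullet> x) has_derivative (\<lambda>h. x \<bullet> h + h \<bullet> x)) (at x)"
    by (intro has_derivative_inner has_derivative_ident)
  then have "((\<lambda>x. (norm x)\<^sup>2) has_derivative (\<lambda>h. 2 * (x \<bullet> h))) (at x)"
    by (simp add: power2_norm_eq_inner inner_commute)
  from has_derivative_compose[OF this, of \<phi> "(*) D"] assms
  show ?thesis by (simp add: has_field_derivative_def mult_ac)
qed

lemma has_derivative_heat_kernel: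
  assumes \<tau>: "\<tau> > 0"
  shows "(heat_kernel \<tau> has_derivative (\<lambda>h. - (x \<bullet> h) / (2 * \<tau>) * heat_kernel \<tau> x)) (at (x :: real^'n::finite))"
proof -
  let ?\<phi> = "\<lambda>v. exp (- v / (4 * \<tau>)) / sqrt (4 * pi * \<tau>) ^ CARD('n)"
  have "(?\<phi> has_real_derivative - (1 / (4 * \<tau>)) * ?\<phi> ((norm x)\<^sup>2)) (at ((norm x)\<^sup>2))"
    using \<tau> by (auto intro!: derivative_eq_intros)
  from has_derivative_radial[OF this] show ?thesis
    using \<tau> unfolding heat_kernel_eq[OF \<tau>, abs_def] by (simp add: field_simps)
qed

lemma partial_heat_kernel:
  assumes "\<tau> > 0"
  shows "partial i (heat_kernel \<tau>) x = - (x $ i / (2 * \<tau>)) * heat_kernel \<tau> x"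
  using partial_eqI[OF has_derivative_heat_kernel[OF assms, of x], where i = i] by (simp add: inner_axis)

lemma has_derivative_imp_coordinate:
  "((\<lambda>x. x $ j) has_derivative (\<lambda>h. h $ j)) (at x)"
  by (rule bounded_linear_imp_has_derivative[OF bounded_linear_vec_nth])

lemma axis_component: "axis i (1::real) $ j = (if i = j then 1 else 0)"
  by (auto simp: axis_def)

text \<open>
  If \<open>\<partial>\<^sub>l A\<^sub>m = - x\<^sub>l A\<^sub>m\<^sub>+\<^sub>1 / 2\<close>, then \<open>second_ker\<close> and \<open>third_ker\<close> are \<open>\<partial>\<^sub>k\<close> and \<open>\<partial>\<^sub>i \<partial>\<^sub>k\<close> of
  \<open>- cnorm x\<^sub>j A\<^sub>0\<close>. Both \<open>jint\<close> and \<open>jinf\<close> satisfy this recursion.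
\<close>

definition second_ker :: "'n::finite \<Rightarrow> 'n \<Rightarrow> real^'n \<Rightarrow> real \<Rightarrow> real \<Rightarrow> real" where
  "second_ker k j x A0 A1 = cnorm TYPE('n) * (x $ j * x $ k * A1 / 2 - (if j = k then A0 else 0))"

definition third_ker :: "'n::finite \<Rightarrow> 'n \<Rightarrow> 'n \<Rightarrow> real^'n \<Rightarrow> real \<Rightarrow> real \<Rightarrow> real" where
  "third_ker i j k x A1 A2 = cnorm TYPE('n) *
     (((if j = k then x $ i else 0) + (if i = j then x $ k else 0) + (if i = k then x $ j else 0)) * A1 / 2
      - x $ i * x $ j * x $ k * A2 / 4)"

lemma partial_first_ker:
  fixes x :: "real^'n::finite"
  assumes "(A0 has_derivative (\<lambda>h. - (x \<bullet> h) / 2 * A1 x)) (at x)"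
  shows "partial k (\<lambda>x. - cnorm TYPE('n) * (x $ j * A0 x)) x = second_ker k j x (A0 x) (A1 x)"
proof -
  have "((\<lambda>x. - cnorm TYPE('n) * (x $ j * A0 x)) has_derivative
      (\<lambda>h. - cnorm TYPE('n) * (x $ j * (- (x \<bullet> h) / 2 * A1 x) + h $ j * A0 x))) (at x)"
    by (intro has_derivative_mult_right has_derivative_mult has_derivative_imp_coordinate assms)
  from partial_eqI[OF this, of k] show ?thesis
    by (cases "j = k") (simp_all add: second_ker_def inner_axis axis_component algebra_simps)
qed

lemma has_derivative_second_ker:
  fixes x :: "real^'n::finite"
  assumes "(A0 has_derivative (\<lambda>h. - (x \<bullet> h) / 2 * A1 x)) (at x)"
    and "(A1 has_derivative (\<lambda>h. - (x \<bullet> h) / 2 * A2 x)) (at x)"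
  obtains L where "((\<lambda>x. second_ker k j x (A0 x) (A1 x)) has_derivative L) (at x)"
    "\<And>i. L (axis i 1) = third_ker i j k x (A1 x) (A2 x)"
proof
  let ?L = "\<lambda>h. cnorm TYPE('n) * ((x $ j * x $ k * (- (x \<bullet> h) / 2 * A2 x) + (x $ j * h $ k + h $ j * x $ k) * A1 x) / 2
     - (if j = k then - (x \<bullet> h) / 2 * A1 x else 0))"
  have "((\<lambda>x. if j = k then A0 x else 0) has_derivative (\<lambda>h. if j = k then - (x \<bullet> h) / 2 * A1 x else 0)) (at x)"
    using assms(1) by (cases "j = k") auto
  then have "((\<lambda>x. cnorm TYPE('n) * (x $ j * x $ k * A1 x / 2 - (if j = k then A0 x else 0))) has_derivative ?L) (at x)"
    by (intro has_derivative_mult_right has_derivative_diff bounded_linear.has_derivative[OF bounded_linear_divide]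
        has_derivative_mult has_derivative_imp_coordinate assms(2))
  then show "((\<lambda>x. second_ker k j x (A0 x) (A1 x)) has_derivative ?L) (at x)"
    by (simp add: second_ker_def)
  show "?L (axis i 1) = third_ker i j k x (A1 x) (A2 x)" for i
    by (cases "i = j"; cases "j = k"; cases "i = k")
      (simp_all add: third_ker_def inner_axis axis_component field_simps)
qed

lemma jint_radial_derivative:
  "((\<lambda>x. jint e k b ((norm x)\<^sup>2)) has_derivative (\<lambda>h. - (x \<bullet> h) / 2 * jint e (Suc k) b ((norm x)\<^sup>2))) (at (x :: real^'n::finite))"
  using has_derivative_radial[OF jint_has_derivative, of e k b x] by (simp add: mult_ac)

text \<open>The same recursion as for \<open>jint\<close>, obtained here from Gamma (s + 1) = s
  Gamma s.\<close>

lemma jinf_deriv: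
  assumes r: "r > 0"
  shows "(jinf e k has_real_derivative - (r / 2) * jinf e (Suc k) r) (at r)"
proof -
  define s where "s = real e / 2 + 1 + real k"
  define m where "m = e + 1 + 2 * k"
  have s: "s > 0" "real (Suc m) = 2 * s" by (auto simp: s_def m_def add_pos_nonneg)
  have G: "Gamma (s + 1) = s * Gamma s"
    by (rule Gamma_plus1) (use s in \<open>auto simp: nonpos_Ints_def\<close>)
  have 1: "((\<lambda>r. (2 / r) ^ Suc m) has_real_derivative real (Suc m) * (2 / r) ^ m * - (2 / r\<^sup>2)) (at r)"
    using r by (auto intro!: derivative_eq_intros simp: power2_eq_square simp del: power_Suc of_nat_Suc)
  have 2: "jinf e k = (\<lambda>r. Gamma s * (2 / r) ^ Suc m)"
    by (simp add: jinf_def fun_eq_iff s_def m_def)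
  have 3: "jinf e (Suc k) r = s * Gamma s * ((2 / r) ^ m * (2 / r) ^ 3)"
  proof -
    have "real e / 2 + 1 + real (Suc k) = s + 1" by (simp add: s_def)
    moreover have "e + 2 + 2 * Suc k = m + 3" by (simp add: m_def)
    ultimately show ?thesis unfolding jinf_def by (simp only: G power_add)
  qed
  have "Gamma s * (real (Suc m) * (2 / r) ^ m * - (2 / r\<^sup>2)) = - (r / 2) * jinf e (Suc k) r"
    unfolding 3 s(2) using r by (simp add: power2_eq_square power3_eq_cube field_simps)
  then show ?thesis
    using DERIV_cong[OF DERIV_cmult[OF 1, of "Gamma s"]] unfolding 2[symmetric] by (simp only: 2)
qed

lemma jinf_radial_derivative:
  assumes "x \<noteq> (0 :: real^'n::finite)"
  shows "((\<lambda>x. jinf e k (norm x)) has_derivative (\<lambda>h. - (x \<bullet> h) / 2 * jinf e (Suc k) (norm x))) (at x)"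
proof -
  have "((\<lambda>x. jinf e k (norm x)) has_derivative (\<lambda>h. (- (norm x / 2) * jinf e (Suc k) (norm x)) * (h \<bullet> sgn x))) (at x)"
    using has_derivative_compose[OF has_derivative_norm[OF assms] jinf_deriv[of "norm x" e k, unfolded has_field_derivative_def]] assms
    by (simp add: mult_ac)
  then show ?thesis
    by (rule has_derivative_eq_rhs) (use assms in \<open>auto simp: fun_eq_iff sgn_div_norm inner_commute\<close>)
qed

text \<open>The first summand stems from the identity in the Leray projector, the second from its
  gradient part.\<close>

definition oker :: "real \<Rightarrow> 'n::finite \<Rightarrow> 'n \<Rightarrow> 'n \<Rightarrow> real^'n \<Rightarrow> real" where
  "oker \<tau> i j k x = (if j = k then - (x $ i / (2 * \<tau>)) * heat_kernel \<tau> x else 0) +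
     third_ker i j k x (jint (ecard TYPE('n)) 1 (1 / \<tau>) ((norm x)\<^sup>2)) (jint (ecard TYPE('n)) 2 (1 / \<tau>) ((norm x)\<^sup>2))"

lemma divergence_heat_axis:
  assumes "\<tau> > 0"
  shows "divergence (\<lambda>y. heat_kernel \<tau> y *\<^sub>R axis j 1) = partial j (heat_kernel \<tau> :: real^'n::finite \<Rightarrow> real)"
proof
  fix x :: "real^'n"
  have z: "partial i (\<lambda>_. 0) x = 0" for i :: 'n by (simp add: partial_def)
  have "partial i (\<lambda>y. (heat_kernel \<tau> y *\<^sub>R axis j 1) $ i) x = (if i = j then partial j (heat_kernel \<tau>) x else 0)" for i
    by (cases "i = j") (simp_all add: axis_component z)
  then show "divergence (\<lambda>y. heat_kernel \<tau> y *\<^sub>R axis j 1) x = partial j (heat_kernel \<tau>) x"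
    by (simp add: divergence_def)
qed

text \<open>The divergence is \<partial>_j G_\<tau>, a multiple c of \<open>gmom\<close> at b = 1 /
  \<tau>, so \<open>fund_sol_gmom_conv\<close> applies; the powers of b cancel and only
  \<open>cnorm\<close> remains.\<close>

lemma inv_neg_laplacian_heat:
  assumes d: "CARD('n::finite) \<ge> 2" and \<tau>: "\<tau> > 0"
  shows "inv_neg_laplacian (divergence (\<lambda>y. heat_kernel \<tau> y *\<^sub>R axis j 1)) (x :: real^'n) =
    - cnorm TYPE('n) * (x $ j * jint (ecard TYPE('n)) 0 (1 / \<tau>) ((norm x)\<^sup>2))"
proof -
  define e where "e = ecard TYPE('n)"
  have e: "CARD('n) = e + 2" using d by (simp add: e_def ecard_def)
  define b where "b = 1 / \<tau>"
  have b: "b > 0" "\<tau> = 1 / b" using \<tau> by (auto simp: b_def)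
  define c where "c = - (b / 2) / sqrt (4 * pi / b) ^ (e + 2)"
  have "divergence (\<lambda>y. heat_kernel \<tau> y *\<^sub>R axis j 1) y = c * gmom b j y" for y :: "real^'n"
    unfolding divergence_heat_axis[OF \<tau>] unfolding partial_heat_kernel[OF \<tau>] unfolding heat_kernel_eq[OF \<tau>] e
    by (simp add: b(2) c_def gmom_def mult_ac del: power_Suc)
  then have "inv_neg_laplacian (divergence (\<lambda>y. heat_kernel \<tau> y *\<^sub>R axis j 1)) x = (LINT y|lebesgue. c * (fund_sol (x - y) * gmom b j y))"
    by (simp add: inv_neg_laplacian_def mult_ac)
  also have "\<dots> = (LINT y|lborel. c * (fund_sol (x - y) * gmom b j y))"
    by (rule integral_completion) (unfold fund_sol_def, measurable)
  also have "\<dots> = c * (x $ j * jint e 0 b ((norm x)\<^sup>2) / (b * sqrt b ^ (e + 2)))"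
    unfolding integral_mult_right_zero fund_sol_gmom_conv[OF e b(1)] by simp
  also have "\<dots> = - cnorm TYPE('n) * (x $ j * jint e 0 b ((norm x)\<^sup>2))"
  proof -
    have "sqrt (4 * pi / b) ^ (e + 2) * sqrt b ^ (e + 2) = sqrt (4 * pi) ^ (e + 2)"
      using b by (simp only: power_mult_distrib[symmetric] real_sqrt_mult[symmetric]) simp
    then have "- (b / 2) / sqrt (4 * pi / b) ^ (e + 2) * (X / (b * sqrt b ^ (e + 2))) = - (1 / (2 * sqrt (4 * pi) ^ (e + 2))) * X" for X
      using b by (simp add: divide_simps del: power_Suc)
    then show ?thesis unfolding c_def cnorm_def e .
  qed
  finally show ?thesis unfolding e_def b_def .
qed

lemma oseen_eq:
  assumes d: "CARD('n::finite) \<ge> 2" and \<tau>: "\<tau> > 0"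
  shows "oseen \<tau> k j (x :: real^'n) = (if j = k then heat_kernel \<tau> x else 0) +
     second_ker k j x (jint (ecard TYPE('n)) 0 (1 / \<tau>) ((norm x)\<^sup>2)) (jint (ecard TYPE('n)) 1 (1 / \<tau>) ((norm x)\<^sup>2))"
proof -
  have "partial k (inv_neg_laplacian (divergence (\<lambda>y. heat_kernel \<tau> y *\<^sub>R axis j 1))) x =
     second_ker k j x (jint (ecard TYPE('n)) 0 (1 / \<tau>) ((norm x)\<^sup>2)) (jint (ecard TYPE('n)) 1 (1 / \<tau>) ((norm x)\<^sup>2))"
    unfolding inv_neg_laplacian_heat[OF d \<tau>, abs_def]
    by (rule partial_first_ker) (use jint_radial_derivative[of _ 0] in simp)
  then show ?thesis
    by (simp add: oseen_def leray_def gradient_def axis_component)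
qed

lemma partial_oseen:
  assumes d: "CARD('n::finite) \<ge> 2" and \<tau>: "\<tau> > 0"
  shows "partial i (oseen \<tau> k j) (x :: real^'n) = oker \<tau> i j k x"
proof -
  let ?A = "\<lambda>l x::real^'n. jint (ecard TYPE('n)) l (1 / \<tau>) ((norm x)\<^sup>2)"
  have J: "(?A 0 has_derivative (\<lambda>h. - (x \<bullet> h) / 2 * ?A 1 x)) (at x)" "(?A 1 has_derivative (\<lambda>h. - (x \<bullet> h) / 2 * ?A 2 x)) (at x)"
    using jint_radial_derivative[of "ecard TYPE('n)" 0 "1 / \<tau>" x] jint_radial_derivative[of "ecard TYPE('n)" 1 "1 / \<tau>" x]
    by (simp_all add: numeral_2_eq_2)
  obtain L where L: "((\<lambda>x::real^'n. second_ker k j x (?A 0 x) (?A 1 x)) has_derivative L) (at x)"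
    "\<And>i. L (axis i 1) = third_ker i j k x (?A 1 x) (?A 2 x)"
    using has_derivative_second_ker[where k = k and j = j and ?A0.0 = "?A 0" and ?A1.0 = "?A 1" and ?A2.0 = "?A 2", OF J] by blast
  have "((\<lambda>x::real^'n. if j = k then heat_kernel \<tau> x else 0) has_derivative (\<lambda>h. if j = k then - (x \<bullet> h) / (2 * \<tau>) * heat_kernel \<tau> x else 0)) (at x)"
    using has_derivative_heat_kernel[OF \<tau>] by (cases "j = k") auto
  from partial_eqI[OF has_derivative_add[OF this L(1)], of i]
  show ?thesis unfolding oseen_eq[OF d \<tau>, abs_def] oker_def L(2)
    by (simp add: inner_axis)
qed

section \<open>Derivatives of the fundamental solution\<close>

lemma partial_fund_sol:
  assumes d: "CARD('n::finite) \<ge> 2" and x: "x \<noteq> (0 :: real^'n)"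
  shows "partial j fund_sol x = - cnorm TYPE('n) * (x $ j * jinf (ecard TYPE('n)) 0 (norm x))"
proof -
  define e where "e = ecard TYPE('n)"
  have e: "CARD('n) = e + 2" using d by (simp add: e_def ecard_def)
  have 1: "partial j fund_sol x = partial j (\<lambda>x::real^'n. fund_rad e (norm x)) x"
    by (rule partial_cong_open[of "- {0}"]) (use x fund_sol_rad[OF e] in auto)
  have r: "norm x > 0" using x by simp
  have "((\<lambda>x::real^'n. fund_rad e (norm x)) has_derivative
      (\<lambda>h. - (norm x / 2 * jinf e 0 (norm x)) / sqrt (4 * pi) ^ (e + 2) * (h \<bullet> sgn x))) (at x)"
    by (rule has_derivative_compose[OF has_derivative_norm[OF x] fund_rad_deriv[OF r, of e, unfolded has_field_derivative_def]])
  from partial_eqI[OF this, of j]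
  have "partial j (\<lambda>x::real^'n. fund_rad e (norm x)) x = - (norm x / 2 * jinf e 0 (norm x)) / sqrt (4 * pi) ^ (e + 2) * (x $ j / norm x)"
    by (simp add: sgn_div_norm inner_axis' del: power_Suc)
  also have "\<dots> = - cnorm TYPE('n) * (x $ j * jinf e 0 (norm x))"
    using x by (simp add: cnorm_def e field_simps del: power_Suc)
  finally show ?thesis unfolding 1 e_def .
qed

text \<open>\<open>third_ker\<close> is symmetric in its three indices. Thus \<partial>_k K_ij,
  differentiated in another order than the Oseen entry (k, j) by \<partial>_i, still has the form of
  \<open>oker\<close> with \<open>jint\<close> replaced by its limit \<open>jinf\<close> and without
  the heat term.\<close>

lemma partial_K_ker:
  assumes d: "CARD('n::finite) \<ge> 2" and x: "x \<noteq> (0 :: real^'n)"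
  shows "partial k (K_ker i j) x = third_ker i j k x (jinf (ecard TYPE('n)) 1 (norm x)) (jinf (ecard TYPE('n)) 2 (norm x))"
proof -
  let ?e = "ecard TYPE('n)"
  have 1: "K_ker i j y = second_ker i j y (jinf ?e 0 (norm y)) (jinf ?e 1 (norm y))" if "y \<noteq> 0" for y
  proof -
    have "K_ker i j y = partial i (\<lambda>x. - cnorm TYPE('n) * (x $ j * jinf ?e 0 (norm x))) y"
      unfolding K_ker_def by (rule partial_cong_open[of "- {0}"]) (use that partial_fund_sol[OF d] in auto)
    also have "\<dots> = second_ker i j y (jinf ?e 0 (norm y)) (jinf ?e 1 (norm y))"
      by (rule partial_first_ker) (use jinf_radial_derivative[OF that, of _ 0] in simp)
    finally show ?thesis .
  qed
  let ?A = "\<lambda>l x::real^'n. jinf ?e l (norm x)"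
  have J: "(?A 0 has_derivative (\<lambda>h. - (x \<bullet> h) / 2 * ?A 1 x)) (at x)" "(?A 1 has_derivative (\<lambda>h. - (x \<bullet> h) / 2 * ?A 2 x)) (at x)"
    using jinf_radial_derivative[OF x, of ?e 0] jinf_radial_derivative[OF x, of ?e 1]
    by (simp_all add: numeral_2_eq_2)
  obtain L where L: "((\<lambda>x::real^'n. second_ker i j x (?A 0 x) (?A 1 x)) has_derivative L) (at x)"
    "\<And>k. L (axis k 1) = third_ker k j i x (?A 1 x) (?A 2 x)"
    using has_derivative_second_ker[where k = i and j = j and ?A0.0 = "?A 0" and ?A1.0 = "?A 1" and ?A2.0 = "?A 2", OF J] by blast
  have "partial k (K_ker i j) x = partial k (\<lambda>x. second_ker i j x (jinf ?e 0 (norm x)) (jinf ?e 1 (norm x))) x"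
    by (rule partial_cong_open[of "- {0}"]) (use x 1 in auto)
  also have "\<dots> = third_ker k j i x (jinf ?e 1 (norm x)) (jinf ?e 2 (norm x))"
    using partial_eqI[OF L(1)] L(2) by simp
  also have "\<dots> = third_ker i j k x (jinf ?e 1 (norm x)) (jinf ?e 2 (norm x))"
    by (auto simp: third_ker_def mult_ac)
  finally show ?thesis .
qed

text \<open>The induction starts at \<partial>_j of the fundamental solution, a multiple of x_j |x|
  ^ (-d), since the logarithm for d = 2 is not homogeneous. Closure under \<open>partial\<close>
  does the rest.\<close>

lemma homog_K_ker:
  assumes d: "CARD('n::finite) \<ge> 2"
  shows "homog (int CARD('n)) (K_ker i j :: real^'n \<Rightarrow> real)"
    and "homog (int CARD('n) + 1) (partial k (K_ker i j) :: real^'n \<Rightarrow> real)"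
proof -
  let ?e = "ecard TYPE('n)"
  let ?c = "- cnorm TYPE('n) * Gamma (real ?e / 2 + 1) * 2 ^ (?e + 2)"
  have "homog (- 1 + int (?e + 2) * 1) (\<lambda>x::real^'n. x $ j * inverse (norm x) ^ (?e + 2))"
    by (intro homog_mult homog_coord homog_power homog_inverse_norm)
  then have "homog (int CARD('n) - 1) (\<lambda>x::real^'n. ?c * (x $ j * inverse (norm x) ^ (?e + 2)))"
    using d by (intro homog_cmult) (simp add: ecard_def of_nat_diff del: power_Suc)
  then have "homog (int CARD('n) - 1) (partial j fund_sol :: real^'n \<Rightarrow> real)"
  proof (rule homog_cong, intro allI impI)
    fix x :: "real^'n" assume "x \<noteq> 0"
    have "jinf ?e 0 (norm x) = Gamma (real ?e / 2 + 1) * (2 ^ (?e + 2) * inverse (norm x) ^ (?e + 2))"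
      unfolding jinf_def divide_inverse[of 2] power_mult_distrib by (simp del: power_Suc)
    then show "partial j fund_sol x = ?c * (x $ j * inverse (norm x) ^ (?e + 2))"
      unfolding partial_fund_sol[OF d \<open>x \<noteq> 0\<close>] by (simp only: mult_minus_left mult_minus_right mult.assoc mult.left_commute mult.commute)
  qed
  from homog_partial(1)[OF this, of i] show *: "homog (int CARD('n)) (K_ker i j :: real^'n \<Rightarrow> real)"
    by (simp add: K_ker_def)
  from homog_partial(1)[OF *, of k] show "homog (int CARD('n) + 1) (partial k (K_ker i j) :: real^'n \<Rightarrow> real)" .
qed

section \<open>Size of the kernel and its distance from the limit\<close>

lemma third_ker_diff: "third_ker i j k x A1 A2 - third_ker i j k x B1 B2 = third_ker i j k x (A1 - B1) (A2 - B2)"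
  by (simp add: third_ker_def algebra_simps diff_divide_distrib)

lemma third_ker_abs_le:
  fixes x :: "real^'n::finite"
  assumes "\<bar>A1\<bar> \<le> B1" "\<bar>A2\<bar> \<le> B2"
  shows "\<bar>third_ker i j k x A1 A2\<bar> \<le> cnorm TYPE('n) * (2 * (norm x * B1) + norm x ^ 3 * B2)"
proof -
  have n: "\<bar>x $ l\<bar> \<le> norm x" for l by (rule component_le_norm_cart)
  have B: "B1 \<ge> 0" "B2 \<ge> 0" using assms by auto
  have "\<bar>(if j = k then x $ i else 0) + (if i = j then x $ k else 0) + (if i = k then x $ j else 0)\<bar> \<le> 3 * norm x"
    using n[of i] n[of j] n[of k] norm_ge_zero[of x] by (auto simp: abs_if split: if_splits)
  then have 1: "\<bar>((if j = k then x $ i else 0) + (if i = j then x $ k else 0) + (if i = k then x $ j else 0)) * A1 / 2\<bar> \<le> 3 * norm x * B1 / 2"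
  proof -
    have "\<bar>(if j = k then x $ i else 0) + (if i = j then x $ k else 0) + (if i = k then x $ j else 0)\<bar> * \<bar>A1\<bar> \<le> 3 * norm x * B1"
      by (rule mult_mono) (use assms \<open>_ \<le> 3 * norm x\<close> in auto)
    then show ?thesis unfolding abs_divide abs_mult by simp
  qed
  have "\<bar>x $ i\<bar> * \<bar>x $ j\<bar> * \<bar>x $ k\<bar> * \<bar>A2\<bar> \<le> norm x * norm x * norm x * B2"
    using assms by (intro mult_mono n) auto
  then have 2: "\<bar>x $ i * x $ j * x $ k * A2 / 4\<bar> \<le> norm x ^ 3 * B2 / 4"
    unfolding abs_divide abs_mult by (simp add: power3_eq_cube)
  have "0 \<le> norm x * B1" "0 \<le> norm x ^ 3 * B2" using B by auto
  then have "\<bar>((if j = k then x $ i else 0) + (if i = j then x $ k else 0) + (if i = k then x $ j else 0)) * A1 / 2 - x $ i * x $ j * x $ k * A2 / 4\<bar>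
      \<le> 2 * (norm x * B1) + norm x ^ 3 * B2"
    using 1 2 by linarith
  then show ?thesis unfolding third_ker_def abs_mult using cnorm_pos[where 'n = 'n] by simp
qed

text \<open>The hypothesis on p says p = 2 k - 1, the number of coordinate factors in front of the
  k-th term of \<open>third_ker\<close>. For |x| \<le> \<rho> the crude bound \<open>jint_le\<close>
  is used, for |x| > \<rho> the comparison with \<open>jinf\<close>; the larger of \<rho> and |x| is
  at least half their sum.\<close>

lemma jint_wgt_bound:
  assumes d: "CARD('n::finite) \<ge> 2" and kp: "p + CARD('n) + 1 = CARD('n) + 2 * k"
  shows "\<exists>C\<ge>0. \<forall>\<rho>>0. \<forall>x::real^'n. norm x ^ p * jint (ecard TYPE('n)) k (1 / \<rho>\<^sup>2) ((norm x)\<^sup>2) \<le> C * wgt \<rho> x"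
proof -
  let ?e = "ecard TYPE('n)" and ?d = "CARD('n) + 1"
  define q where "q = ?e + 2 + 2 * k"
  have q: "q = p + ?d" using d kp by (simp add: q_def ecard_def)
  \<comment> \<open>The constant 1 serves the region |x| \<le> \<rho>, the Gamma factor the other
    one.\<close>
  define G where "G = max 1 (Gamma (real ?e / 2 + 1 + real k) * 2 ^ q)"
  show ?thesis
  proof (intro exI[of _ "G * 2 ^ ?d"] conjI allI impI)
    show "0 \<le> G * 2 ^ ?d" by (simp add: G_def)
    fix \<rho> :: real and x :: "real^'n" assume \<rho>: "\<rho> > 0"
    let ?J = "jint ?e k (1 / \<rho>\<^sup>2) ((norm x)\<^sup>2)"
    define m where "m = max \<rho> (norm x)"
    have m: "m > 0" using \<rho> by (simp add: m_def)
    have "norm x ^ p * ?J \<le> G / m ^ ?d"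
    proof (cases "norm x \<le> \<rho>")
      case True
      then have "m = \<rho>" by (simp add: m_def)
      have "?J \<le> sqrt (1 / \<rho>\<^sup>2) ^ (?e + 2 * k + 2)" by (rule jint_le) auto
      also have "\<dots> = 1 / \<rho> ^ q" using \<rho> by (simp add: real_sqrt_divide power_divide q_def add_ac)
      finally have "norm x ^ p * ?J \<le> \<rho> ^ p * (1 / \<rho> ^ q)"
        using True \<rho> by (intro mult_mono power_mono) (auto simp: jint_nonneg)
      also have "\<dots> = 1 / m ^ ?d" unfolding q \<open>m = \<rho>\<close> using \<rho> by (simp add: power_add)
      also have "\<dots> \<le> G / m ^ ?d" using m by (intro divide_right_mono) (auto simp: G_def)
      finally show ?thesis .
    next
      case False
      then have mx: "m = norm x" "norm x > 0" using \<rho> by (auto simp: m_def)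
      have "?J \<le> jinf ?e k (norm x)" by (rule jint_le_jinf) fact
      also have "\<dots> = Gamma (real ?e / 2 + 1 + real k) * 2 ^ q / norm x ^ q"
        by (simp add: jinf_def q_def power_divide)
      also have "\<dots> \<le> G / norm x ^ q" using mx by (intro divide_right_mono) (auto simp: G_def)
      finally have "norm x ^ p * ?J \<le> norm x ^ p * (G / norm x ^ q)" by (intro mult_left_mono) auto
      also have "\<dots> = G / m ^ ?d" unfolding q mx(1) using mx(2) by (simp add: power_add)
      finally show ?thesis .
    qed
    also have "\<dots> \<le> G / ((\<rho> + norm x) / 2) ^ ?d"
      using \<rho> m by (intro divide_left_mono power_mono mult_pos_pos zero_less_power) (auto simp: G_def m_def add_pos_nonneg)
    also have "\<dots> = G * 2 ^ ?d * wgt \<rho> x"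
      by (simp add: wgt_def power_divide)
    finally show "norm x ^ p * ?J \<le> G * 2 ^ ?d * wgt \<rho> x" .
  qed
qed

lemma oker_bound:
  assumes d: "CARD('n::finite) \<ge> 2"
  shows "\<exists>C\<ge>0. \<forall>\<tau>>0. \<forall>i j k. \<forall>x::real^'n. \<bar>oker \<tau> i j k x\<bar> \<le> C * wgt (sqrt \<tau>) x"
proof -
  let ?e = "ecard TYPE('n)"
  obtain C1 where C1: "C1 \<ge> 0" "\<And>\<rho> x. \<rho> > 0 \<Longrightarrow> norm (x::real^'n) ^ 1 * jint ?e 1 (1 / \<rho>\<^sup>2) ((norm x)\<^sup>2) \<le> C1 * wgt \<rho> x"
    using jint_wgt_bound[OF d, of 1 1] by auto
  obtain C2 where C2: "C2 \<ge> 0" "\<And>\<rho> x. \<rho> > 0 \<Longrightarrow> norm (x::real^'n) ^ 3 * jint ?e 2 (1 / \<rho>\<^sup>2) ((norm x)\<^sup>2) \<le> C2 * wgt \<rho> x"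
    using jint_wgt_bound[OF d, of 3 2] by auto
  define C3 where "C3 = 2 ^ (CARD('n) + 1) * (gcon 1 + gcon (1 + CARD('n) + 1))"
  have C3: "C3 \<ge> 0" unfolding C3_def by (simp add: gcon_nonneg)
  define C where "C = C3 + cnorm TYPE('n) * (2 * C1 + C2)"
  show ?thesis
  proof (intro exI[of _ C] conjI allI impI)
    show "0 \<le> C" unfolding C_def using C1 C2 C3 cnorm_pos[where 'n = 'n] by simp
    fix \<tau> :: real and i j k :: 'n and x :: "real^'n" assume \<tau>: "\<tau> > 0"
    define \<rho> where "\<rho> = sqrt \<tau>"
    have \<rho>: "\<rho> > 0" "\<tau> = \<rho>\<^sup>2" using \<tau> by (auto simp: \<rho>_def)
    have h: "\<bar>- (x $ i / (2 * \<tau>)) * heat_kernel \<tau> x\<bar> \<le> C3 * wgt \<rho> x"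
    proof -
      have "\<bar>- (x $ i / (2 * \<tau>)) * heat_kernel \<tau> x\<bar> \<le> (norm x ^ 1 * heat_kernel (\<rho>\<^sup>2) x) / (2 * \<rho>\<^sup>2)"
        using \<tau> component_le_norm_cart[of x i] heat_kernel_nonneg[of \<tau> x] by (simp add: abs_mult \<rho>(2) divide_simps mult_right_mono)
      also have "\<dots> \<le> (C3 * \<rho> ^ (1 + 1) * wgt \<rho> x) / (2 * \<rho>\<^sup>2)"
        unfolding C3_def by (intro divide_right_mono heat_kernel_wgt_bound \<rho>) auto
      also have "\<dots> \<le> C3 * wgt \<rho> x"
        using \<rho>(1) C3 wgt_nonneg[of \<rho> x] by (simp add: power2_eq_square)
      finally show ?thesis .
    qed
    have "\<bar>oker \<tau> i j k x\<bar> \<le> C3 * wgt \<rho> x + cnorm TYPE('n) * (2 * (norm x * jint ?e 1 (1 / \<tau>) ((norm x)\<^sup>2)) + norm x ^ 3 * jint ?e 2 (1 / \<tau>) ((norm x)\<^sup>2))"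
      unfolding oker_def
      using h C3 wgt_nonneg[of \<rho> x] \<rho>(1)
      by (intro order_trans[OF abs_triangle_ineq] add_mono third_ker_abs_le) (auto simp: jint_nonneg)
    also have "\<dots> \<le> C3 * wgt \<rho> x + cnorm TYPE('n) * (2 * (C1 * wgt \<rho> x) + C2 * wgt \<rho> x)"
      using C1(2)[OF \<rho>(1), of x] C2(2)[OF \<rho>(1), of x] cnorm_pos[where 'n = 'n] unfolding \<rho>(2)
      by (intro add_mono order_refl mult_left_mono) auto
    also have "\<dots> = C * wgt (sqrt \<tau>) x" unfolding C_def \<rho>_def by (simp add: algebra_simps)
    finally show "\<bar>oker \<tau> i j k x\<bar> \<le> C * wgt (sqrt \<tau>) x" .
  qed
qed

text \<open>The two \<open>jint\<close> terms gain (\<tau> / |x| ^ 2) ^ N by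
  \<open>jinf_diff_jint\<close> with b = 1 / \<tau>. The heat term has no counterpart in the limit
  but satisfies the same bound, because a Gaussian decays faster than every power.\<close>

lemma oker_diff:
  assumes d: "CARD('n::finite) \<ge> 2"
  shows "\<exists>C\<ge>0. \<forall>\<tau>>0. \<forall>i j k. \<forall>x::real^'n. x \<noteq> 0 \<longrightarrow>
    \<bar>oker \<tau> i j k x - partial k (K_ker i j) x\<bar> \<le> C * \<tau> ^ N / norm x ^ (CARD('n) + 1 + 2 * N)"
proof -
  let ?e = "ecard TYPE('n)" and ?m = "CARD('n) + 1 + 2 * N"
  define G where "G k = Gamma (real ?e / 2 + 1 + real (k + N)) * 2 ^ (?e + 2 + 2 * (k + N))" for k
  have G: "G k \<ge> 0" for k unfolding G_def by (intro mult_nonneg_nonneg less_imp_le[OF Gamma_real_pos]) (auto intro: add_pos_nonneg)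
  have J: "norm x ^ p * \<bar>jint ?e k (1 / \<tau>) ((norm x)\<^sup>2) - jinf ?e k (norm x)\<bar> \<le> G k * \<tau> ^ N / norm x ^ ?m"
    if "x \<noteq> 0" "\<tau> > 0" "p + 1 = 2 * k" for x :: "real^'n" and \<tau> p k
  proof -
    have "\<bar>jint ?e k (1 / \<tau>) ((norm x)\<^sup>2) - jinf ?e k (norm x)\<bar> \<le> jinf ?e (k + N) (norm x) / (1 / \<tau>) ^ N"
      using jinf_diff_jint[of "norm x" "1 / \<tau>" ?e k N] that by (simp add: abs_minus_commute)
    also have "\<dots> = G k * \<tau> ^ N / norm x ^ (?e + 2 + 2 * (k + N))"
      using that by (simp add: jinf_def G_def power_divide del: power_Suc)
    also have "?e + 2 + 2 * (k + N) = p + ?m" using that(3) d by (simp add: ecard_def)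
    finally have "norm x ^ p * \<bar>jint ?e k (1 / \<tau>) ((norm x)\<^sup>2) - jinf ?e k (norm x)\<bar> \<le> norm x ^ p * (G k * \<tau> ^ N / norm x ^ (p + ?m))"
      by (intro mult_left_mono) auto
    also have "\<dots> = G k * \<tau> ^ N / norm x ^ ?m" unfolding power_add[of _ p] using that(1) by simp
    finally show ?thesis .
  qed
  define g where "g = gcon (?m + 1)"
  define C where "C = g + cnorm TYPE('n) * (2 * G 1 + G 2)"
  show ?thesis
  proof (intro exI[of _ C] conjI allI impI)
    show "0 \<le> C" unfolding C_def g_def using G gcon_nonneg cnorm_pos[where 'n = 'n] by simp
    fix \<tau> :: real and i j k :: 'n and x :: "real^'n" assume \<tau>: "\<tau> > 0" and x: "x \<noteq> 0"
    define \<rho> where "\<rho> = sqrt \<tau>"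
    have \<rho>: "\<rho> > 0" "\<tau> = \<rho>\<^sup>2" using \<tau> by (auto simp: \<rho>_def)
    have h: "\<bar>- (x $ i / (2 * \<tau>)) * heat_kernel \<tau> x\<bar> \<le> g * \<tau> ^ N / norm x ^ ?m"
    proof -
      have "\<bar>- (x $ i / (2 * \<tau>)) * heat_kernel \<tau> x\<bar> \<le> (norm x * heat_kernel (\<rho>\<^sup>2) x) / (2 * \<rho>\<^sup>2)"
        using \<tau> component_le_norm_cart[of x i] heat_kernel_nonneg[of \<tau> x] by (simp add: abs_mult \<rho>(2) divide_simps mult_right_mono)
      also have "\<dots> \<le> (norm x * heat_kernel (\<rho>\<^sup>2) x) / \<rho>\<^sup>2"
        using \<rho> heat_kernel_nonneg[of "\<rho>\<^sup>2" x] by (simp add: divide_simps)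
      \<comment> \<open>The moment of order m + 1 = d + 2 + 2 N yields \<rho> ^ (2 + 2 N) after
        division by \<rho> ^ d, and \<rho> ^ 2 cancels the factor 1 / \<tau>.\<close>
      also have "norm x * heat_kernel (\<rho>\<^sup>2) x = (norm x ^ (?m + 1) * heat_kernel (\<rho>\<^sup>2) x) / norm x ^ ?m"
        using x by simp
      also have "\<dots> / \<rho>\<^sup>2 \<le> (g * \<rho> ^ (?m + 1) / \<rho> ^ CARD('n)) / norm x ^ ?m / \<rho>\<^sup>2"
        unfolding g_def by (intro divide_right_mono heat_kernel_bound \<rho>) auto
      also have "\<rho> ^ (?m + 1) = \<rho> ^ CARD('n) * (\<rho>\<^sup>2 * \<tau> ^ N)"
        unfolding \<rho>(2) power_mult[symmetric] power_add[symmetric] by (rule arg_cong[where f = "(^) \<rho>"]) simp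
      also have "g * (\<rho> ^ CARD('n) * (\<rho>\<^sup>2 * \<tau> ^ N)) / \<rho> ^ CARD('n) / norm x ^ ?m / \<rho>\<^sup>2 = g * \<tau> ^ N / norm x ^ ?m"
        using \<rho>(1) by simp
      finally show ?thesis .
    qed
    have e0: "0 \<le> g * \<tau> ^ N / norm x ^ ?m" using \<tau> by (simp add: g_def gcon_nonneg)
    have "oker \<tau> i j k x - partial k (K_ker i j) x = (if j = k then - (x $ i / (2 * \<tau>)) * heat_kernel \<tau> x else 0) +
        third_ker i j k x (jint ?e 1 (1 / \<tau>) ((norm x)\<^sup>2) - jinf ?e 1 (norm x)) (jint ?e 2 (1 / \<tau>) ((norm x)\<^sup>2) - jinf ?e 2 (norm x))"
      unfolding oker_def partial_K_ker[OF d x] third_ker_diff[symmetric] by simp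
    also have "\<bar>\<dots>\<bar> \<le> g * \<tau> ^ N / norm x ^ ?m + cnorm TYPE('n) *
       (2 * (norm x * \<bar>jint ?e 1 (1 / \<tau>) ((norm x)\<^sup>2) - jinf ?e 1 (norm x)\<bar>) + norm x ^ 3 * \<bar>jint ?e 2 (1 / \<tau>) ((norm x)\<^sup>2) - jinf ?e 2 (norm x)\<bar>)"
      using h e0 by (intro order_trans[OF abs_triangle_ineq] add_mono third_ker_abs_le) auto
    also have "\<dots> \<le> g * \<tau> ^ N / norm x ^ ?m + cnorm TYPE('n) * (2 * (G 1 * \<tau> ^ N / norm x ^ ?m) + G 2 * \<tau> ^ N / norm x ^ ?m)"
      using J[OF x \<tau>, of 1 1] J[OF x \<tau>, of 3 2] cnorm_pos[where 'n = 'n]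
      by (intro add_mono order_refl mult_left_mono) auto
    also have "\<dots> = C * \<tau> ^ N / norm x ^ ?m" unfolding C_def by (simp add: algebra_simps add_divide_distrib del: power_Suc)
    finally show "\<bar>oker \<tau> i j k x - partial k (K_ker i j) x\<bar> \<le> C * \<tau> ^ N / norm x ^ ?m" .
  qed
qed

lemma continuous_heat_kernel: "\<tau> > 0 \<Longrightarrow> continuous_on S (heat_kernel \<tau> :: real^'n::finite \<Rightarrow> real)"
  unfolding heat_kernel_def by (intro continuous_intros) auto

lemma continuous_oker:
  assumes "\<tau> > 0"
  shows "continuous_on UNIV (oker \<tau> i j k :: real^'n::finite \<Rightarrow> real)"
proof -
  have j: "continuous_on UNIV (\<lambda>x::real^'n. jint e l b ((norm x)\<^sup>2))" for e l b
    by (rule continuous_on_compose2[of UNIV "jint e l b"])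
      (auto simp: continuous_on_eq_continuous_at jint_isCont intro!: continuous_intros)
  have "continuous_on UNIV (\<lambda>x::real^'n. if j = k then - (x $ i / (2 * \<tau>)) * heat_kernel \<tau> x else 0)"
    by (cases "j = k") (auto intro!: continuous_intros continuous_heat_kernel assms simp: assms less_imp_neq[OF assms, symmetric])
  moreover have "continuous_on UNIV (\<lambda>x::real^'n. if P then x $ l else 0)" for P l
    by (cases P) (auto intro!: continuous_intros)
  ultimately show ?thesis
    unfolding oker_def[abs_def] third_ker_def by (intro continuous_intros j) auto
qed

lemma isCont_oker_time:
  assumes "\<tau> > 0"
  shows "isCont (\<lambda>\<tau>. oker \<tau> i j k (x :: real^'n::finite)) \<tau>"
proof -
  have j: "isCont (\<lambda>\<tau>. jint e l (1 / \<tau>) v) \<tau>" for e l v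
    by (rule isCont_o2[where f = "\<lambda>\<tau>. 1 / \<tau>" and g = "\<lambda>b. jint e l b v"])
      (use assms jint_isCont_upper[of "1 / \<tau>" e l v] in \<open>auto intro!: continuous_intros\<close>)
  have "isCont (\<lambda>\<tau>. - (x $ i / (2 * \<tau>)) * heat_kernel \<tau> x) \<tau>"
    unfolding heat_kernel_def using assms by (intro continuous_intros) auto
  then have "isCont (\<lambda>\<tau>. if j = k then - (x $ i / (2 * \<tau>)) * heat_kernel \<tau> x else 0) \<tau>"
    by (cases "j = k") auto
  then show ?thesis
    unfolding oker_def third_ker_def by (intro continuous_intros j) auto
qed

section \<open>Weighted convolutions and time integrals\<close>

text \<open>Pointwise convergence is required only along sequences, and almost everywhere with a
  null set that may depend on the sequence. This is all that continuity in time with values in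
  \<open>L\<^sup>\<infinity>\<close> provides.\<close>

lemma continuous_on_integral_dominated:
  fixes f :: "'a::{first_countable_topology, t2_space} \<Rightarrow> 'b \<Rightarrow> 'c::{banach, second_countable_topology}"
  assumes "\<And>s. s \<in> S \<Longrightarrow> f s \<in> borel_measurable M" and "integrable M g"
    and "\<And>s. s \<in> S \<Longrightarrow> AE y in M. norm (f s y) \<le> g y"
    and "\<And>\<sigma> s. (\<And>n. \<sigma> n \<in> S) \<Longrightarrow> s \<in> S \<Longrightarrow> \<sigma> \<longlonglongrightarrow> s \<Longrightarrow> AE y in M. (\<lambda>n. f (\<sigma> n) y) \<longlonglongrightarrow> f s y"
  shows "continuous_on S (\<lambda>s. integral\<^sup>L M (f s))"
proof (rule continuous_on_sequentiallyI)
  fix \<sigma> s assume *: "\<forall>n. \<sigma> n \<in> S" "s \<in> S" "\<sigma> \<longlonglongrightarrow> s"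
  show "(\<lambda>n. integral\<^sup>L M (f (\<sigma> n))) \<longlonglongrightarrow> integral\<^sup>L M (f s)"
    by (rule integral_dominated_convergence[where w = g]) (use * assms in auto)
qed

text \<open>Duhamel's kernel is singular at s = t, so an integrable majorant is available only on
  [0, t'] with t' < t.\<close>

lemma continuous_on_half_open:
  fixes f :: "real \<Rightarrow> 'a::topological_space"
  assumes "\<And>t'. t' < t \<Longrightarrow> continuous_on {0..t'} f"
  shows "continuous_on {0..<t} f"
  unfolding continuous_on_eq_continuous_within
proof
  fix s assume s: "s \<in> {0..<t}"
  define t' where "t' = (s + t) / 2"
  have t': "s < t'" "t' < t" using s by (auto simp: t'_def)
  have "at s within {0..<t} = at s within {0..t'}"
    by (rule at_within_nhd[of s "{..<t'}"]) (use t' in auto)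
  moreover have "continuous (at s within {0..t'}) f"
    using assms[OF t'(2)] s t' by (auto simp: continuous_on_eq_continuous_within)
  ultimately show "continuous (at s within {0..<t}) f" by simp
qed

lemma time_powr:
  assumes a: "a > -1" and t: "t \<ge> (0::real)"
  shows "set_integrable lebesgue {0..t} (\<lambda>s. (t - s) powr a)"
    and "(LINT s:{0..t}|lebesgue. (t - s) powr a) = t powr (a + 1) / (a + 1)"
proof -
  let ?f = "\<lambda>s. indicator {0..t} s * s powr a"
  have m: "?f \<in> borel_measurable borel" by measurable
  have "((\<lambda>s. s powr a) has_integral (t powr (a + 1) / (a + 1))) {0..t}"
    by (rule has_integral_powr_from_0[OF a t])
  then have "((\<lambda>s. if s \<in> {0..t} then s powr a else 0) has_integral (t powr (a + 1) / (a + 1))) UNIV"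
    by (subst has_integral_restrict_UNIV)
  also have "(\<lambda>s. if s \<in> {0..t} then s powr a else 0) = ?f" by (auto simp: indicator_def)
  finally have "integral\<^sup>N lborel ?f = ennreal (t powr (a + 1) / (a + 1))"
    by (intro nn_integral_has_integral_lborel[OF m]) auto
  then have i: "has_bochner_integral lborel ?f (t powr (a + 1) / (a + 1))"
    by (intro has_bochner_integral_nn_integral) (use a t in auto)
  have e: "?f (t + (- 1) *\<^sub>R s) = indicator {0..t} s *\<^sub>R (t - s) powr a" for s
    by (auto simp: indicator_def)
  have m': "(\<lambda>s. indicator {0..t} s *\<^sub>R (t - s) powr a) \<in> borel_measurable borel" by measurable
  have "integrable lborel (\<lambda>s. indicator {0..t} s *\<^sub>R (t - s) powr a)"
    using lborel_integral_affine(1)[OF m, of "-1" t] i unfolding e by (simp add: has_bochner_integral_iff)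
  then show "set_integrable lebesgue {0..t} (\<lambda>s. (t - s) powr a)"
    unfolding set_integrable_def using m' by (subst integrable_completion) auto
  have "(LINT s|lborel. indicator {0..t} s *\<^sub>R (t - s) powr a) = t powr (a + 1) / (a + 1)"
    using lborel_integral_affine(2)[OF m, of "-1" t] i unfolding e by (simp add: has_bochner_integral_iff)
  then show "(LINT s:{0..t}|lebesgue. (t - s) powr a) = t powr (a + 1) / (a + 1)"
    unfolding set_lebesgue_integral_def using m' by (subst integral_completion) auto
qed

text \<open>The endpoint t is left out of the hypotheses because the kernel at time zero is
  meaningless; a single point is a null set.\<close>

lemma time_integral_bound:
  fixes f :: "real \<Rightarrow> 'a::{banach, second_countable_topology}"
  assumes c: "continuous_on {0..<t} f" and g: "set_integrable lebesgue {0..t} g"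
    and b: "\<And>s. s \<in> {0..<t} \<Longrightarrow> norm (f s) \<le> g s"
  shows "set_integrable lebesgue {0..t} f"
    and "norm (LINT s:{0..t}|lebesgue. f s) \<le> (LINT s:{0..t}|lebesgue. g s)"
proof -
  have ae: "AE s in lebesgue. s \<noteq> t"
    using AE_lborel_singleton[of t] by (rule AE_completion)
  \<comment> \<open>The arbitrary value at s = t is added back as a separate summand to obtain
    measurability on the closed interval.\<close>
  have "(\<lambda>s. indicator {0..<t} s *\<^sub>R f s + indicator {t} s *\<^sub>R (if 0 \<le> t then f t else 0)) \<in> borel_measurable borel"
    by (intro borel_measurable_add borel_measurable_continuous_on_indicator c borel_measurable_scaleR) auto
  moreover have "(\<lambda>s. indicator {0..<t} s *\<^sub>R f s + indicator {t} s *\<^sub>R (if 0 \<le> t then f t else 0)) = (\<lambda>s. indicator {0..t} s *\<^sub>R f s)"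
    by (auto simp: indicator_def fun_eq_iff)
  ultimately have m: "(\<lambda>s. indicator {0..t} s *\<^sub>R f s) \<in> borel_measurable lebesgue"
    by (simp add: measurable_completion)
  have le: "AE s in lebesgue. norm (indicator {0..t} s *\<^sub>R f s) \<le> indicator {0..t} s *\<^sub>R g s"
    using ae by eventually_elim (use b in \<open>auto simp: indicator_def\<close>)
  show "set_integrable lebesgue {0..t} f"
    unfolding set_integrable_def
    by (rule Bochner_Integration.integrable_bound[OF g[unfolded set_integrable_def] m])
      (use le in \<open>auto elim!: eventually_mono\<close>)
  have "norm (LINT s:{0..t}|lebesgue. f s) \<le> (LINT s|lebesgue. norm (indicator {0..t} s *\<^sub>R f s))"
    unfolding set_lebesgue_integral_def by (rule integral_norm_bound)
  also have "\<dots> \<le> (LINT s:{0..t}|lebesgue. g s)"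
    unfolding set_lebesgue_integral_def
    by (rule integral_mono_AE'[OF g[unfolded set_integrable_def] le eventually_mono[OF le order_trans[OF norm_ge_zero]]])
  finally show "norm (LINT s:{0..t}|lebesgue. f s) \<le> (LINT s:{0..t}|lebesgue. g s)" .
qed

section \<open>Convolutions with kernels bounded by the weight\<close>

lemma lebesgue_shift_measurable:
  fixes k :: "'a::euclidean_space \<Rightarrow> real"
  assumes "continuous_on UNIV k"
  shows "(\<lambda>y. k (x - y)) \<in> borel_measurable lebesgue"
proof -
  have "continuous_on UNIV (\<lambda>y. k (x - y))"
    by (rule continuous_on_compose2[OF assms]) (auto intro!: continuous_intros)
  then show ?thesis by (intro measurable_completion) (simp add: borel_measurable_continuous_onI)
qed

text \<open>While x stays in a ball, all translates of the weight have one integrable majorant; this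
  gives continuity of convolutions in x by dominated convergence on balls.\<close>

lemma wgt_local_bound:
  fixes x y :: "real^'n::finite"
  assumes \<rho>: "\<rho> > 0" and x: "norm x \<le> r"
  shows "wgt \<rho> (x - y) \<le> ((1 + r) / \<rho> + 1) ^ (CARD('n) + 1) * wgt 1 y"
proof -
  let ?c = "(1 + r) / \<rho> + 1"
  have r: "r \<ge> 0" using x norm_ge_zero[of x] by linarith
  have "norm y \<le> norm x + norm (x - y)" using norm_triangle_ineq4[of x "x - y"] by simp
  then have "1 + norm y \<le> (1 + r) + norm (x - y)" using x by simp
  also have "\<dots> \<le> ?c * (\<rho> + norm (x - y))"
    using \<rho> r by (simp add: distrib_right distrib_left add_divide_distrib)
  finally have "(1 + norm y) ^ (CARD('n) + 1) \<le> (?c * (\<rho> + norm (x - y))) ^ (CARD('n) + 1)"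
    by (intro power_mono) auto
  then have *: "(1 + norm y) ^ (CARD('n) + 1) \<le> ?c ^ (CARD('n) + 1) * (\<rho> + norm (x - y)) ^ (CARD('n) + 1)"
    by (simp only: power_mult_distrib)
  have p: "(\<rho> + norm (x - y)) ^ (CARD('n) + 1) > 0" "(1 + norm y) ^ (CARD('n) + 1) > 0"
    using \<rho> by (intro zero_less_power add_pos_nonneg; simp)+
  have "1 * (1 + norm y) ^ (CARD('n) + 1) \<le> ?c ^ (CARD('n) + 1) * (\<rho> + norm (x - y)) ^ (CARD('n) + 1)"
    using * by simp
  moreover have "1 / P \<le> c / Q" if "1 * Q \<le> c * P" "P > 0" "Q > 0" for P Q c :: real
    using that by (simp add: field_simps)
  ultimately have "1 / (\<rho> + norm (x - y)) ^ (CARD('n) + 1) \<le> ?c ^ (CARD('n) + 1) / (1 + norm y) ^ (CARD('n) + 1)"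
    using p by blast
  then show ?thesis by (simp only: wgt_def times_divide_eq_right mult_1_right)
qed

lemma conv_bound:
  fixes k :: "real^'n::finite \<Rightarrow> real" and f :: "real^'n \<Rightarrow> 'b::{banach, second_countable_topology}"
  assumes k: "continuous_on UNIV k" "\<And>z. \<bar>k z\<bar> \<le> A * wgt \<rho> z" and \<rho>: "\<rho> > 0"
    and f: "f \<in> borel_measurable lebesgue" "AE y in lebesgue. norm (f y) \<le> B"
  shows "integrable lebesgue (\<lambda>y. k (x - y) *\<^sub>R f y)"
    and "norm (LINT y|lebesgue. k (x - y) *\<^sub>R f y) \<le> A * B * wint TYPE('n) / \<rho>"
    and "continuous_on UNIV (\<lambda>x. LINT y|lebesgue. k (x - y) *\<^sub>R f y)"
proof -
  have m: "(\<lambda>y. k (x - y) *\<^sub>R f y) \<in> borel_measurable lebesgue" for x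
    by (intro borel_measurable_scaleR lebesgue_shift_measurable k f)
  have le: "AE y in lebesgue. norm (k (x - y) *\<^sub>R f y) \<le> A * B * wgt \<rho> (x - y)" for x
    using f(2)
  proof eventually_elim
    case (elim y)
    have "\<bar>k (x - y)\<bar> * norm (f y) \<le> (A * wgt \<rho> (x - y)) * B"
      using k(2)[of "x - y"] elim by (intro mult_mono) auto
    then show ?case by (simp add: mult_ac)
  qed
  have i: "integrable lebesgue (\<lambda>y. A * B * wgt \<rho> (x - y))" for x :: "real^'n"
    by (intro integrable_mult_right wgt_shift \<rho>)
  show "integrable lebesgue (\<lambda>y. k (x - y) *\<^sub>R f y)"
    by (rule Bochner_Integration.integrable_bound[OF i[of x] m])
      (use le[of x] in \<open>auto elim!: eventually_mono intro: order_trans[OF _ abs_ge_self]\<close>)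
  have "norm (LINT y|lebesgue. k (x - y) *\<^sub>R f y) \<le> (LINT y|lebesgue. norm (k (x - y) *\<^sub>R f y))"
    by (rule integral_norm_bound)
  also have "\<dots> \<le> (LINT y|lebesgue. A * B * wgt \<rho> (x - y))"
    by (rule integral_mono_AE'[OF i le eventually_mono[OF le order_trans[OF norm_ge_zero]]])
  also have "\<dots> = A * B * wint TYPE('n) / \<rho>" using wgt_shift(2)[OF \<rho>, of x] by simp
  finally show "norm (LINT y|lebesgue. k (x - y) *\<^sub>R f y) \<le> A * B * wint TYPE('n) / \<rho>" .
  have "continuous_on (ball 0 r) (\<lambda>x. LINT y|lebesgue. k (x - y) *\<^sub>R f y)" for r
  proof (rule continuous_on_integral_dominated[OF m])
    let ?c = "((1 + r) / \<rho> + 1) ^ (CARD('n) + 1)"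
    show "integrable lebesgue (\<lambda>y::real^'n. \<bar>A * B\<bar> * (?c * wgt 1 y))"
      by (intro integrable_mult_right wgt_lebesgue)
    show "AE y in lebesgue. norm (k (x - y) *\<^sub>R f y) \<le> \<bar>A * B\<bar> * (?c * wgt 1 y)" if "x \<in> ball 0 r" for x
      using le[of x]
    proof eventually_elim
      case (elim y)
      have "A * B * wgt \<rho> (x - y) \<le> \<bar>A * B\<bar> * wgt \<rho> (x - y)"
        using wgt_nonneg[of \<rho> "x - y"] \<rho> by (intro mult_right_mono) auto
      also have "\<dots> \<le> \<bar>A * B\<bar> * (?c * wgt 1 y)"
        using that by (intro mult_left_mono wgt_local_bound \<rho>) auto
      finally show ?case using elim by linarith
    qed
    show "AE y in lebesgue. (\<lambda>n. k (\<sigma> n - y) *\<^sub>R f y) \<longlonglongrightarrow> k (s - y) *\<^sub>R f y" if "\<sigma> \<longlonglongrightarrow> s" for \<sigma> s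
    proof (intro AE_I2 tendsto_scaleR tendsto_const)
      fix y
      have "isCont k (s - y)" using k(1) by (simp add: continuous_on_eq_continuous_at)
      then show "(\<lambda>n. k (\<sigma> n - y)) \<longlonglongrightarrow> k (s - y)"
        by (rule isCont_tendsto_compose) (intro tendsto_diff that tendsto_const)
    qed
  qed
  then have "continuous_on (\<Union>r. ball 0 r) (\<lambda>x. LINT y|lebesgue. k (x - y) *\<^sub>R f y)"
    by (intro continuous_on_open_UN) auto
  moreover have "(\<Union>r. ball (0::real^'n) r) = UNIV" by (auto intro: gt_ex)
  ultimately show "continuous_on UNIV (\<lambda>x. LINT y|lebesgue. k (x - y) *\<^sub>R f y)" by simp
qed

lemma heat_kernel_wgt:
  assumes "\<tau> > 0"
  shows "\<bar>heat_kernel \<tau> z\<bar> \<le> (2 ^ (CARD('n) + 1) * (gcon 0 + gcon (CARD('n) + 1)) * sqrt \<tau>) * wgt (sqrt \<tau>) (z :: real^'n::finite)"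
  using heat_kernel_wgt_bound[of "sqrt \<tau>" z 0] assms by (simp add: heat_kernel_nonneg)

lemma continuous_heat_conv:
  assumes "\<tau> > 0" "f \<in> borel_measurable lebesgue" "AE y in lebesgue. norm (f y) \<le> B"
  shows "continuous_on UNIV (heat_conv \<tau> f)"
  unfolding heat_conv_def[abs_def]
  by (rule conv_bound(3)[OF continuous_heat_kernel[OF assms(1)] heat_kernel_wgt[OF assms(1)] _ assms(2,3)]) (use assms in auto)

text \<open>The power of 1 + |x| is distributed over 1 + |y| and |x - y|: the first part falls on f,
  the second on the heat kernel. The factor \<rho> in \<open>heat_kernel_wgt_bound\<close> cancels
  the mass 1 / \<rho> of the weight, so the bound is uniform as \<tau> tends to 0.\<close>

lemma heat_conv_decay:
  fixes f :: "real^'n::finite \<Rightarrow> real^'n"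
  assumes f: "AE y in lebesgue. norm (f y) \<le> M" "AE y in lebesgue. (1 + norm y) ^ m * norm (f y) \<le> M"
    and M: "M \<ge> 0"
  shows "\<exists>C. \<forall>\<tau> x. 0 < \<tau> \<and> \<tau> \<le> T \<longrightarrow> (1 + norm x) ^ m * norm (heat_conv \<tau> f x) \<le> C"
proof -
  define c where "c m = 2 ^ (CARD('n) + 1) * (gcon m + gcon (m + CARD('n) + 1))" for m
  have c: "c m \<ge> 0" for m by (simp add: c_def gcon_nonneg)
  define C where "C = 2 ^ m * M * (c 0 + c m * sqrt T ^ m) * wint TYPE('n)"
  have "(1 + norm x) ^ m * norm (heat_conv \<tau> f x) \<le> C" if \<tau>: "0 < \<tau>" "\<tau> \<le> T" for \<tau> and x :: "real^'n"
  proof -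
    define \<rho> where "\<rho> = sqrt \<tau>"
    have \<rho>: "\<rho> > 0" "\<tau> = \<rho>\<^sup>2" "\<rho> \<le> sqrt T" using \<tau> by (auto simp: \<rho>_def)
    let ?g = "\<lambda>y. 2 ^ m * M * ((c 0 * \<rho> + c m * \<rho> ^ (m + 1)) * wgt \<rho> (x - y))"
    have gi: "integrable lebesgue ?g" by (intro integrable_mult_right wgt_shift \<rho>)
    have le: "AE y in lebesgue. (1 + norm x) ^ m * norm (heat_kernel \<tau> (x - y) *\<^sub>R f y) \<le> ?g y"
      using f
    proof eventually_elim
      case (elim y)
      let ?h = "heat_kernel \<tau> (x - y)"
      have "1 + norm x \<le> (1 + norm y) + norm (x - y)"
        using norm_triangle_ineq[of y "x - y"] by simp
      then have "(1 + norm x) ^ m \<le> ((1 + norm y) + norm (x - y)) ^ m" by (intro power_mono) auto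
      also have "\<dots> \<le> 2 ^ m * ((1 + norm y) ^ m + norm (x - y) ^ m)" by (rule power_sum_le) auto
      finally have "(1 + norm x) ^ m * (?h * norm (f y)) \<le> 2 ^ m * ((1 + norm y) ^ m + norm (x - y) ^ m) * (?h * norm (f y))"
        by (rule mult_right_mono) (simp add: heat_kernel_nonneg)
      also have "\<dots> = 2 ^ m * (?h * ((1 + norm y) ^ m * norm (f y)) + norm (x - y) ^ m * ?h * norm (f y))"
        by (simp add: algebra_simps)
      also have "\<dots> \<le> 2 ^ m * (?h * M + norm (x - y) ^ m * ?h * M)"
        using elim by (intro mult_left_mono add_mono) (auto simp: heat_kernel_nonneg)
      also have "\<dots> = 2 ^ m * M * (norm (x - y) ^ 0 * heat_kernel (\<rho>\<^sup>2) (x - y) + norm (x - y) ^ m * heat_kernel (\<rho>\<^sup>2) (x - y))"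
        by (simp add: \<rho>(2) algebra_simps)
      also have "\<dots> \<le> 2 ^ m * M * (c 0 * \<rho> ^ (0 + 1) * wgt \<rho> (x - y) + c m * \<rho> ^ (m + 1) * wgt \<rho> (x - y))"
        unfolding c_def using M by (intro mult_left_mono add_mono heat_kernel_wgt_bound \<rho>) auto
      finally show ?case by (simp add: heat_kernel_nonneg algebra_simps)
    qed
    have "(1 + norm x) ^ m * norm (heat_conv \<tau> f x) \<le> (1 + norm x) ^ m * (LINT y|lebesgue. norm (heat_kernel \<tau> (x - y) *\<^sub>R f y))"
      unfolding heat_conv_def by (intro mult_left_mono integral_norm_bound) auto
    also have "\<dots> = (LINT y|lebesgue. (1 + norm x) ^ m * norm (heat_kernel \<tau> (x - y) *\<^sub>R f y))"
      by (rule integral_mult_right_zero[symmetric])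
    also have "\<dots> \<le> (LINT y|lebesgue. ?g y)"
      by (rule integral_mono_AE'[OF gi le]) (use M c \<rho> in \<open>auto intro!: AE_I2 mult_nonneg_nonneg add_nonneg_nonneg simp: wgt_nonneg\<close>)
    also have "\<dots> = 2 ^ m * M * ((c 0 * \<rho> + c m * \<rho> ^ (m + 1)) * (wint TYPE('n) / \<rho>))"
      unfolding integral_mult_right_zero wgt_shift(2)[OF \<rho>(1)] ..
    also have "\<dots> = 2 ^ m * M * (c 0 + c m * \<rho> ^ m) * wint TYPE('n)"
      using \<rho>(1) by (simp add: field_simps)
    also have "\<dots> \<le> C" unfolding C_def
      using M c \<rho> wint_nonneg[where 'n = 'n] by (intro mult_right_mono mult_left_mono add_mono power_mono order_refl) auto
    finally show ?thesis .
  qed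
  then show ?thesis by blast
qed

section \<open>The truncated weight and almost-everywhere consequences of continuity in time\<close>

definition trunc_weight :: "real \<Rightarrow> real^'n::finite \<Rightarrow> real" where
  "trunc_weight L y = min ((1 + norm y) ^ (CARD('n) + 1)) L"

lemma trunc_weight_pos: "L \<ge> 1 \<Longrightarrow> trunc_weight L y > 0"
  by (auto simp: trunc_weight_def add_pos_nonneg)

text \<open>The truncated weight stays within a factor \<open>1 + w x / w y\<close>, uniformly in \<open>L\<close>.\<close>

lemma trunc_weight_kernel:
  fixes x y :: "real^'n::finite"
  assumes \<rho>: "\<rho> > 0" and L: "L \<ge> 1"
  shows "trunc_weight L x * wgt \<rho> (x - y) \<le> trunc_weight L y * ((1 + 2 ^ (CARD('n) + 1)) * wgt \<rho> (x - y) + 2 ^ (CARD('n) + 1) * wgt 1 y)"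
proof -
  let ?D = "CARD('n) + 1"
  define a b z where "a = (1 + norm x) ^ ?D" and "b = (1 + norm y) ^ ?D" and "z = norm (x - y) ^ ?D"
  have a: "a \<ge> 1" and b: "b \<ge> 1" unfolding a_def b_def by (intro one_le_power; simp)+
  have ab: "a \<le> 2 ^ ?D * (b + z)"
  proof -
    have "1 + norm x \<le> (1 + norm y) + norm (x - y)"
      using norm_triangle_ineq[of y "x - y"] by simp
    then have "a \<le> ((1 + norm y) + norm (x - y)) ^ ?D" unfolding a_def by (intro power_mono) auto
    also have "\<dots> \<le> 2 ^ ?D * (b + z)" unfolding b_def z_def by (rule power_sum_le) auto
    finally show ?thesis .
  qed
  have W: "wgt \<rho> (x - y) \<ge> 0" using \<rho> by (simp add: wgt_nonneg)
  have z1: "z * wgt \<rho> (x - y) \<le> 1"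
  proof -
    have "z \<le> (\<rho> + norm (x - y)) ^ ?D" unfolding z_def using \<rho> by (intro power_mono) auto
    moreover have "(\<rho> + norm (x - y)) ^ ?D > 0" using \<rho> by (intro zero_less_power add_pos_nonneg) auto
    ultimately show ?thesis unfolding wgt_def by (simp only: times_divide_eq_right mult_1_right divide_le_eq_1_pos)
  qed
  \<comment> \<open>If b exceeds the cap, the truncated weight at y is L and dominates the one at x;
    otherwise the ratio is at most a / b. No constant depends on L.\<close>
  have "min a L \<le> min b L * (1 + a / b)"
  proof (cases "b \<le> L")
    case True
    then show ?thesis using a b by (simp add: distrib_left)
  next
    case False
    then have "min a L \<le> L * (1 + 0)" by simp
    also have "\<dots> \<le> L * (1 + a / b)" using L a b by (intro mult_left_mono add_left_mono) auto
    finally show ?thesis using False by simp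
  qed
  then have "min a L * wgt \<rho> (x - y) \<le> min b L * (1 + a / b) * wgt \<rho> (x - y)"
    using W by (rule mult_right_mono)
  also have "\<dots> \<le> min b L * (1 + 2 ^ ?D * (b + z) / b) * wgt \<rho> (x - y)"
    using W L b ab by (intro mult_right_mono mult_left_mono add_left_mono divide_right_mono) auto
  also have "\<dots> = min b L * ((1 + 2 ^ ?D) * wgt \<rho> (x - y) + 2 ^ ?D * (z * wgt \<rho> (x - y)) * (1 / b))"
    using b by (simp add: field_simps)
  also have "\<dots> \<le> min b L * ((1 + 2 ^ ?D) * wgt \<rho> (x - y) + 2 ^ ?D * 1 * (1 / b))"
    using z1 L b by (intro mult_left_mono add_left_mono mult_right_mono) auto
  finally show ?thesis by (simp only: trunc_weight_def a_def b_def wgt_def mult_1_right)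
qed

text \<open>Around each t the bound deteriorates by at most 1 on some interval; finitely many of
  these intervals cover [0, T].\<close>

lemma AE_bounded_compact:
  fixes u :: "real \<Rightarrow> real^'n::finite \<Rightarrow> real^'n"
  assumes in_Linf: "\<And>t. t \<in> {0..T} \<Longrightarrow> in_Linf (u t)"
    and lim: "\<And>t. t \<in> {0..T} \<Longrightarrow> ((\<lambda>s. Linf_norm (\<lambda>x. u s x - u t x)) \<longlongrightarrow> 0) (at t within {0..T})"
  shows "\<exists>B\<ge>0. \<forall>t\<in>{0..T}. AE x in lebesgue. norm (u t x) \<le> B"
proof -
  have fin: "\<exists>b\<ge>0. AE x in lebesgue. norm (u t x) \<le> b" if t: "t \<in> {0..T}" for t
  proof -
    have "Linf_norm (u t) < \<infinity>" using in_Linf[OF t] by (simp add: in_Linf_def)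
    then obtain b where b: "Linf_norm (u t) \<le> ereal b" by (cases "Linf_norm (u t)") auto
    have "AE x in lebesgue. ereal (norm (u t x)) \<le> Linf_norm (u t)"
      unfolding Linf_norm_def by (rule esssup_AE)
    then have "AE x in lebesgue. norm (u t x) \<le> max 0 b"
    proof eventually_elim
      case (elim x)
      then have "ereal (norm (u t x)) \<le> ereal b" using b by (rule order_trans)
      then show ?case by simp
    qed
    then show ?thesis by (intro exI[of _ "max 0 b"]) auto
  qed
  have "\<exists>\<delta>>0. \<exists>b\<ge>0. \<forall>s\<in>{0..T}. dist s t < \<delta> \<longrightarrow> (AE x in lebesgue. norm (u s x) \<le> b)" if t: "t \<in> {0..T}" for t
  proof -
    obtain b where b: "b \<ge> 0" "AE x in lebesgue. norm (u t x) \<le> b" using fin[OF t] by blast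
    have "\<forall>\<^sub>F s in at t within {0..T}. Linf_norm (\<lambda>x. u s x - u t x) < 1"
      using lim[OF t] by (rule order_tendstoD) simp
    then obtain \<delta> where \<delta>: "\<delta> > 0" "\<And>s. s \<in> {0..T} \<Longrightarrow> s \<noteq> t \<Longrightarrow> dist s t < \<delta> \<Longrightarrow> Linf_norm (\<lambda>x. u s x - u t x) < 1"
      unfolding eventually_at by blast
    have "AE x in lebesgue. norm (u s x) \<le> b + 1" if s: "s \<in> {0..T}" "dist s t < \<delta>" for s
    proof (cases "s = t")
      case True
      then show ?thesis using b(2) by (auto elim!: eventually_mono)
    next
      case False
      have "AE x in lebesgue. ereal (norm (u s x - u t x)) \<le> Linf_norm (\<lambda>x. u s x - u t x)"
        unfolding Linf_norm_def by (rule esssup_AE)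
      with b(2) show ?thesis
      proof eventually_elim
        case (elim x)
        have "ereal (norm (u s x - u t x)) < 1" using elim(2) \<delta>(2)[OF s(1) False s(2)] by (rule order_le_less_trans)
        then have "norm (u s x - u t x) < 1" by (simp add: one_ereal_def)
        then show ?case using norm_triangle_ineq2[of "u s x" "u t x"] elim(1) by linarith
      qed
    qed
    then show ?thesis using \<delta>(1) b(1) by (intro exI[of _ \<delta>] conjI exI[of _ "b + 1"]) auto
  qed
  then obtain \<delta> b where \<delta>b: "\<And>t. t \<in> {0..T} \<Longrightarrow> \<delta> t > 0" "\<And>t. t \<in> {0..T} \<Longrightarrow> b t \<ge> (0::real)"
    "\<And>t s. t \<in> {0..T} \<Longrightarrow> s \<in> {0..T} \<Longrightarrow> dist s t < \<delta> t \<Longrightarrow> AE x in lebesgue. norm (u s x) \<le> b t"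
    by metis
  have "compact {0..T}" by simp
  then obtain F where F: "F \<subseteq> {0..T}" "finite F" "{0..T} \<subseteq> (\<Union>t\<in>F. ball t (\<delta> t))"
    by (rule compactE_image[where C = "{0..T}" and f = "\<lambda>t. ball t (\<delta> t)"]) (use \<delta>b(1) in \<open>auto intro!: bexI\<close>)
  show ?thesis
  proof (intro exI[of _ "sum b F"] conjI ballI)
    show "0 \<le> sum b F" using F \<delta>b(2) by (intro sum_nonneg) auto
    fix s assume s: "s \<in> {0..T}"
    then obtain t where t: "t \<in> F" "dist s t < \<delta> t" using F(3) by (auto simp: dist_commute)
    have "b t \<le> sum b F" using t(1) F \<delta>b(2) by (intro member_le_sum) auto
    then show "AE x in lebesgue. norm (u s x) \<le> sum b F"
      using eventually_mono[OF \<delta>b(3)[of t s]] t F(1) s by force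
  qed
qed

text \<open>The essential supremum dominates off a null set for each n, and countably many null sets
  have a null union.\<close>

lemma AE_tendsto_Linf:
  fixes u :: "real \<Rightarrow> real^'n::finite \<Rightarrow> real^'n"
  assumes lim: "((\<lambda>s. Linf_norm (\<lambda>x. u s x - u t x)) \<longlongrightarrow> 0) (at t within I)"
    and \<sigma>: "\<And>n. \<sigma> n \<in> I" "\<sigma> \<longlonglongrightarrow> t"
  shows "AE x in lebesgue. (\<lambda>n. u (\<sigma> n) x) \<longlonglongrightarrow> u t x"
proof -
  have "AE x in lebesgue. ereal (norm (u (\<sigma> n) x - u t x)) \<le> Linf_norm (\<lambda>x. u (\<sigma> n) x - u t x)" for n
    unfolding Linf_norm_def by (rule esssup_AE)
  then have "AE x in lebesgue. \<forall>n. ereal (norm (u (\<sigma> n) x - u t x)) \<le> Linf_norm (\<lambda>x. u (\<sigma> n) x - u t x)"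
    by (simp add: AE_all_countable)
  then show ?thesis
  proof eventually_elim
    case (elim x)
    show ?case
    proof (rule tendstoI)
      fix \<epsilon> :: real assume \<epsilon>: "\<epsilon> > 0"
      have "\<forall>\<^sub>F s in at t within I. Linf_norm (\<lambda>x. u s x - u t x) < ereal \<epsilon>"
        using lim by (rule order_tendstoD) (use \<epsilon> in simp)
      then obtain \<delta> where \<delta>: "\<delta> > 0" "\<And>s. s \<in> I \<Longrightarrow> s \<noteq> t \<Longrightarrow> dist s t < \<delta> \<Longrightarrow> Linf_norm (\<lambda>x. u s x - u t x) < ereal \<epsilon>"
        unfolding eventually_at by blast
      have "\<forall>\<^sub>F n in sequentially. dist (\<sigma> n) t < \<delta>" using \<sigma>(2) \<delta>(1) by (rule tendstoD)
      then show "\<forall>\<^sub>F n in sequentially. dist (u (\<sigma> n) x) (u t x) < \<epsilon>"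
      proof eventually_elim
        case (elim n)
        show ?case
        proof (cases "\<sigma> n = t")
          case False
          have "ereal (norm (u (\<sigma> n) x - u t x)) < ereal \<epsilon>"
            using \<open>\<forall>n. _ n\<close>[rule_format, of n] \<delta>(2)[OF \<sigma>(1) False elim] by (rule order_le_less_trans)
          then show ?thesis by (simp add: dist_norm)
        qed (use \<epsilon> in simp)
      qed
    qed
  qed
qed

section \<open>Spatial decay of the solution\<close>

text \<open>One fixed constant for all \<tau> and indices, so that later constants can be written
  down explicitly.\<close>

definition oker_const :: "'n::finite itself \<Rightarrow> real" where
  "oker_const _ = (SOME C. C \<ge> 0 \<and> (\<forall>\<tau>>0. \<forall>i j k. \<forall>x::real^'n. \<bar>oker \<tau> i j k x\<bar> \<le> C * wgt (sqrt \<tau>) x))"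

lemma oker_le:
  assumes "CARD('n::finite) \<ge> 2"
  shows "oker_const TYPE('n) \<ge> 0"
    and "\<tau> > 0 \<Longrightarrow> \<bar>oker \<tau> i j k (x :: real^'n)\<bar> \<le> oker_const TYPE('n) * wgt (sqrt \<tau>) x"
  using someI_ex[OF oker_bound[OF assms]] unfolding oker_const_def by blast+

lemma wgt_antimono: "0 < \<rho> \<Longrightarrow> \<rho> \<le> \<rho>' \<Longrightarrow> wgt \<rho>' z \<le> wgt \<rho> z"
  unfolding wgt_def by (intro divide_left_mono power_mono mult_pos_pos zero_less_power) (auto simp: add_pos_nonneg)

lemma norm_power_wgt_le:
  fixes y :: "real^'n::finite"
  assumes "m \<le> CARD('n) + 1"
  shows "norm y ^ m * wgt 1 y \<le> 1"
proof -
  have "norm y ^ m \<le> (1 + norm y) ^ m" by (intro power_mono) auto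
  also have "\<dots> \<le> (1 + norm y) ^ (CARD('n) + 1)" using assms by (intro power_increasing) auto
  finally have "norm y ^ m \<le> (1 + norm y) ^ (CARD('n) + 1)" .
  moreover have "(1 + norm y) ^ (CARD('n) + 1) > 0" by (intro zero_less_power add_pos_nonneg) auto
  ultimately show ?thesis unfolding wgt_def by (simp only: times_divide_eq_right mult_1_right divide_le_eq_1_pos)
qed

lemma wgt_one_le: "wgt 1 y \<le> 1"
  using norm_power_wgt_le[of 0 y] by simp

lemma powr_minus_half:
  assumes "(r::real) > 0"
  shows "r powr (- 1 / 2) = 1 / sqrt r"
proof -
  have "r powr (- 1 / 2) = r powr (- (1 / 2))" by simp
  also have "\<dots> = inverse (r powr (1 / 2))" by (rule powr_minus)
  also have "\<dots> = 1 / sqrt r" using assms by (simp only: powr_half_sqrt less_imp_le inverse_eq_divide)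
  finally show ?thesis .
qed

lemma inverse_sqrt_powr:
  assumes "\<nu> > 0" "r > 0"
  shows "c / sqrt (\<nu> * r) = c / sqrt \<nu> * r powr (- 1 / 2)"
  unfolding powr_minus_half[OF assms(2)] by (simp add: real_sqrt_mult)

lemma one_le_sqrt_powr:
  assumes "0 < r" "r \<le> T"
  shows "1 \<le> sqrt T * r powr (- 1 / 2)"
  unfolding powr_minus_half[OF assms(1)] using assms by simp

lemma norm_vec_sum_le:
  fixes c :: "'n::finite \<Rightarrow> 'n \<Rightarrow> 'n \<Rightarrow> real"
  shows "norm (\<chi> k. \<Sum>i\<in>UNIV. \<Sum>j\<in>UNIV. c i j k) \<le> (\<Sum>k\<in>UNIV. \<Sum>i\<in>UNIV. \<Sum>j\<in>UNIV. \<bar>c i j k\<bar>)"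
  by (rule order_trans[OF norm_le_l1_cart]) (auto intro!: sum_mono order_trans[OF sum_abs])

text \<open>What the spatial estimates take from the solution on a compact interval: a uniform bound
  and continuity along sequences. Duhamel's equation is not part of it and enters only as a
  hypothesis of \<open>decay\<close>.\<close>

locale linf_path =
  fixes u :: "real \<Rightarrow> real^'n::finite \<Rightarrow> real^'n" and \<nu> T B :: real
  assumes card: "CARD('n) \<ge> 2" and \<nu>: "\<nu> > 0" and B: "B \<ge> 0" and T: "T \<ge> 0"
    and meas: "s \<in> {0..T} \<Longrightarrow> u s \<in> borel_measurable lebesgue"
    and bound: "s \<in> {0..T} \<Longrightarrow> AE y in lebesgue. norm (u s y) \<le> B"
    and cont: "(\<And>n. \<sigma> n \<in> {0..T}) \<Longrightarrow> s \<in> {0..T} \<Longrightarrow> \<sigma> \<longlonglongrightarrow> s \<Longrightarrow> AE y in lebesgue. (\<lambda>n. u (\<sigma> n) y) \<longlonglongrightarrow> u s y"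
begin

definition cker :: "'n \<Rightarrow> 'n \<Rightarrow> 'n \<Rightarrow> real \<Rightarrow> real^'n \<Rightarrow> real \<Rightarrow> real" where
  "cker i j k t x s = (LINT y|lebesgue. oker (\<nu> * (t - s)) i j k (x - y) *\<^sub>R (u s y $ i * u s y $ j))"

definition duh :: "real \<Rightarrow> real^'n \<Rightarrow> real \<Rightarrow> real^'n" where
  "duh t x s = heat_leray_div (\<nu> * (t - s)) (\<lambda>y. tensor (u s y) (u s y)) x"

lemma duh_eq: "s < t \<Longrightarrow> duh t x s = (\<chi> k. \<Sum>i\<in>UNIV. \<Sum>j\<in>UNIV. cker i j k t x s)"
  using \<nu> by (simp add: duh_def heat_leray_div_def partial_oseen[OF card] cker_def tensor_def)

lemma comp_meas: "s \<in> {0..T} \<Longrightarrow> (\<lambda>y. u s y $ i) \<in> borel_measurable lebesgue"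
  by (rule measurable_compose[OF meas]) (auto intro!: borel_measurable_continuous_onI continuous_intros)

lemma prod_meas: "s \<in> {0..T} \<Longrightarrow> (\<lambda>y. u s y $ i * u s y $ j) \<in> borel_measurable lebesgue"
  by (intro borel_measurable_times comp_meas)

lemma prod_le: "\<bar>(v :: real^'n) $ i * v $ j\<bar> \<le> norm v * norm v"
  unfolding abs_mult by (intro mult_mono component_le_norm_cart) auto

lemma prod_bound: "s \<in> {0..T} \<Longrightarrow> AE y in lebesgue. norm (u s y $ i * u s y $ j) \<le> B * B"
  using bound[of s] by (auto elim!: eventually_mono intro!: order_trans[OF prod_le] mult_mono intro: B)

lemma prod_cont:
  assumes "\<And>n. \<sigma> n \<in> {0..T}" "s \<in> {0..T}" "\<sigma> \<longlonglongrightarrow> s"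
  shows "AE y in lebesgue. (\<lambda>n. u (\<sigma> n) y $ i * u (\<sigma> n) y $ j) \<longlonglongrightarrow> u s y $ i * u s y $ j"
  using cont[OF assms] by eventually_elim (intro tendsto_mult tendsto_vec_nth)

lemma cker_conv:
  assumes "s \<in> {0..T}" "s < t"
  shows "integrable lebesgue (\<lambda>y. oker (\<nu> * (t - s)) i j k (x - y) *\<^sub>R (u s y $ i * u s y $ j))"
    and "\<bar>cker i j k t x s\<bar> \<le> oker_const TYPE('n) * (B * B) * wint TYPE('n) / sqrt \<nu> * (t - s) powr (- 1 / 2)"
    and "continuous_on UNIV (\<lambda>x. cker i j k t x s)"
proof -
  have \<tau>: "\<nu> * (t - s) > 0" using \<nu> assms by simp
  have \<rho>: "sqrt (\<nu> * (t - s)) > 0" using \<tau> by simp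
  note c = conv_bound[OF continuous_oker[OF \<tau>] oker_le(2)[OF card \<tau>] \<rho> prod_meas[OF assms(1)] prod_bound[OF assms(1)]]
  show "integrable lebesgue (\<lambda>y. oker (\<nu> * (t - s)) i j k (x - y) *\<^sub>R (u s y $ i * u s y $ j))"
    by (rule c(1))
  show "\<bar>cker i j k t x s\<bar> \<le> oker_const TYPE('n) * (B * B) * wint TYPE('n) / sqrt \<nu> * (t - s) powr (- 1 / 2)"
  proof -
    have "\<bar>cker i j k t x s\<bar> \<le> oker_const TYPE('n) * (B * B) * wint TYPE('n) / sqrt (\<nu> * (t - s))"
      unfolding cker_def real_norm_def[symmetric] by (rule c(2))
    then show ?thesis using inverse_sqrt_powr[OF \<nu>, of "t - s"] assms(2) by simp
  qed
  show "continuous_on UNIV (\<lambda>x. cker i j k t x s)"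
    unfolding cker_def by (rule c(3))
qed

text \<open>For s \<le> t' the kernel lives at scale at least \<rho>, the square root of \<nu> (t -
  t'), so one weight dominates all integrands.\<close>

lemma cker_continuous_time:
  assumes t: "t \<le> T"
  shows "continuous_on {0..<t} (cker i j k t x)"
proof (rule continuous_on_half_open)
  fix t' assume t': "t' < t"
  define \<rho> where "\<rho> = sqrt (\<nu> * (t - t'))"
  have \<rho>: "\<rho> > 0" using t' \<nu> by (simp add: \<rho>_def)
  let ?C = "oker_const TYPE('n)"
  have m: "s \<in> {0..T}" "\<nu> * (t - s) > 0" "\<rho> \<le> sqrt (\<nu> * (t - s))" if "s \<in> {0..t'}" for s
    using that t t' \<nu> by (auto simp: \<rho>_def)
  show "continuous_on {0..t'} (cker i j k t x)"
    unfolding cker_def[abs_def]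
  proof (rule continuous_on_integral_dominated)
    show "(\<lambda>y. oker (\<nu> * (t - s)) i j k (x - y) *\<^sub>R (u s y $ i * u s y $ j)) \<in> borel_measurable lebesgue" if "s \<in> {0..t'}" for s
      by (intro borel_measurable_scaleR lebesgue_shift_measurable continuous_oker m that prod_meas)
    show "integrable lebesgue (\<lambda>y. (?C * (B * B)) * wgt \<rho> (x - y))"
      by (intro integrable_mult_right wgt_shift \<rho>)
    show "AE y in lebesgue. norm (oker (\<nu> * (t - s)) i j k (x - y) *\<^sub>R (u s y $ i * u s y $ j)) \<le> (?C * (B * B)) * wgt \<rho> (x - y)" if s: "s \<in> {0..t'}" for s
      using prod_bound[OF m(1)[OF s], of i j]
    proof eventually_elim
      case (elim y)
      have "\<bar>oker (\<nu> * (t - s)) i j k (x - y)\<bar> \<le> ?C * wgt (sqrt (\<nu> * (t - s))) (x - y)"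
        by (rule oker_le(2)[OF card m(2)[OF s]])
      also have "\<dots> \<le> ?C * wgt \<rho> (x - y)"
        by (intro mult_left_mono wgt_antimono \<rho> m(3)[OF s] oker_le(1)[OF card])
      finally have "\<bar>oker (\<nu> * (t - s)) i j k (x - y)\<bar> * \<bar>u s y $ i * u s y $ j\<bar> \<le> (?C * wgt \<rho> (x - y)) * (B * B)"
        using elim by (intro mult_mono) auto
      then show ?case by (simp add: abs_mult mult_ac)
    qed
    fix \<sigma> s assume \<sigma>: "\<And>n. \<sigma> n \<in> {0..t'}" "s \<in> {0..t'}" "\<sigma> \<longlonglongrightarrow> s"
    have "AE y in lebesgue. (\<lambda>n. u (\<sigma> n) y $ i * u (\<sigma> n) y $ j) \<longlonglongrightarrow> u s y $ i * u s y $ j"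
      using \<sigma> m by (intro prod_cont) auto
    then show "AE y in lebesgue. (\<lambda>n. oker (\<nu> * (t - \<sigma> n)) i j k (x - y) *\<^sub>R (u (\<sigma> n) y $ i * u (\<sigma> n) y $ j))
        \<longlonglongrightarrow> oker (\<nu> * (t - s)) i j k (x - y) *\<^sub>R (u s y $ i * u s y $ j)"
    proof eventually_elim
      case (elim y)
      have "(\<lambda>n. \<nu> * (t - \<sigma> n)) \<longlonglongrightarrow> \<nu> * (t - s)" by (intro tendsto_intros \<sigma>)
      from isCont_tendsto_compose[OF isCont_oker_time[OF m(2)[OF \<sigma>(2)]] this] elim
      show ?case by (intro tendsto_scaleR)
    qed
  qed
qed

lemma duh_continuous_time:
  assumes "t \<le> T"
  shows "continuous_on {0..<t} (duh t x)"
proof -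
  have "continuous_on {0..<t} (\<lambda>s. \<chi> k. \<Sum>i\<in>UNIV. \<Sum>j\<in>UNIV. cker i j k t x s)"
    by (intro continuous_intros cker_continuous_time assms)
  then show ?thesis by (rule continuous_on_eq) (simp add: duh_eq)
qed

definition duhc :: real where
  "duhc = real CARD('n) ^ 3 * (oker_const TYPE('n) * (B * B) * wint TYPE('n) / sqrt \<nu>)"

lemma sum3_const: "(\<Sum>k\<in>(UNIV::'n set). \<Sum>i\<in>(UNIV::'n set). \<Sum>j\<in>(UNIV::'n set). c) = real CARD('n) ^ 3 * (c::real)"
  by (simp add: power3_eq_cube)

lemma duh_norm_le:
  assumes "s \<in> {0..T}" "s < t"
    and "\<And>i j k. \<bar>cker i j k t x s\<bar> \<le> c"
  shows "norm (duh t x s) \<le> real CARD('n) ^ 3 * c"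
proof -
  have "norm (duh t x s) \<le> (\<Sum>k\<in>(UNIV::'n set). \<Sum>i\<in>(UNIV::'n set). \<Sum>j\<in>(UNIV::'n set). \<bar>cker i j k t x s\<bar>)"
    unfolding duh_eq[OF assms(2)] by (rule norm_vec_sum_le)
  also have "\<dots> \<le> (\<Sum>k\<in>(UNIV::'n set). \<Sum>i\<in>(UNIV::'n set). \<Sum>j\<in>(UNIV::'n set). c)"
    by (intro sum_mono assms)
  finally show ?thesis unfolding sum3_const .
qed

lemma duh_bound:
  assumes "s \<in> {0..T}" "s < t"
  shows "norm (duh t x s) \<le> duhc * (t - s) powr (- 1 / 2)"
  using duh_norm_le[OF assms cker_conv(2)[OF assms]] by (simp add: duhc_def mult_ac)

lemma duh_integrable:
  assumes "t \<in> {0..T}"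
  shows "set_integrable lebesgue {0..t} (duh t x)"
proof (rule time_integral_bound(1))
  show "continuous_on {0..<t} (duh t x)" using assms by (intro duh_continuous_time) auto
  show "set_integrable lebesgue {0..t} (\<lambda>s. duhc * (t - s) powr (- 1 / 2))"
    using time_powr(1)[of "-1/2" t] assms by (intro set_integrable_mult_right) auto
qed (use assms duh_bound in auto)

lemma duh_integral_continuous:
  assumes t: "t \<in> {0..T}"
  shows "continuous_on UNIV (\<lambda>x. LINT s:{0..t}|lebesgue. duh t x s)"
  unfolding set_lebesgue_integral_def
proof (rule continuous_on_integral_dominated)
  have ae: "AE s in lebesgue. s \<noteq> t"
    using AE_lborel_singleton[of t] by (rule AE_completion)
  show "(\<lambda>s. indicator {0..t} s *\<^sub>R duh t x s) \<in> borel_measurable lebesgue" for x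
    using duh_integrable[OF t, of x] by (auto simp: set_integrable_def)
  show "integrable lebesgue (\<lambda>s. indicator {0..t} s *\<^sub>R (duhc * (t - s) powr (- 1 / 2)))"
    using set_integrable_mult_right[of duhc, OF time_powr(1)[of "-1/2" t]] t by (simp add: set_integrable_def)
  show "AE s in lebesgue. norm (indicator {0..t} s *\<^sub>R duh t x s) \<le> indicator {0..t} s *\<^sub>R (duhc * (t - s) powr (- 1 / 2))" for x
    using ae by eventually_elim (use duh_bound t in \<open>auto simp: indicator_def\<close>)
  fix \<sigma> :: "nat \<Rightarrow> real^'n" and x assume \<sigma>: "\<sigma> \<longlonglongrightarrow> x"
  show "AE s in lebesgue. (\<lambda>n. indicator {0..t} s *\<^sub>R duh t (\<sigma> n) s) \<longlonglongrightarrow> indicator {0..t} s *\<^sub>R duh t x s"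
    using ae
  proof eventually_elim
    case (elim s)
    show ?case
    proof (cases "s \<in> {0..t}")
      case True
      then have s: "s \<in> {0..T}" "s < t" using elim t by auto
      have "continuous_on UNIV (\<lambda>x. \<chi> k. \<Sum>i\<in>UNIV. \<Sum>j\<in>UNIV. cker i j k t x s)"
        by (intro continuous_intros cker_conv(3) s)
      then have "continuous_on UNIV (\<lambda>x. duh t x s)" by (simp add: duh_eq[OF s(2)])
      then have "isCont (\<lambda>x. duh t x s) x" by (simp add: continuous_on_eq_continuous_at)
      then show ?thesis by (intro tendsto_scaleR tendsto_const isCont_tendsto_compose[OF _ \<sigma>])
    qed simp
  qed
qed

text \<open>Gronwall-type estimate: the factor \<open>exp (\<mu> s)\<close> turns the weakly singular time integral into a
  contraction, since \<open>exp (- r) \<le> r powr (- 1 / 4)\<close>.\<close>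

lemma decay_step:
  assumes L: "L \<ge> 1" and \<mu>: "\<mu> > 0" and S: "S \<ge> 0" and t: "t \<in> {0<..T}"
    and bd: "\<And>s. s \<in> {0..T} \<Longrightarrow> AE y in lebesgue. trunc_weight L y * norm (u s y) \<le> S * exp (\<mu> * s)"
  defines "\<kappa> \<equiv> real CARD('n) ^ 3 * (oker_const TYPE('n) * B * wint TYPE('n) * ((1 + 2 ^ (CARD('n) + 1)) / sqrt \<nu> + 2 ^ (CARD('n) + 1) * sqrt T))"
  shows "trunc_weight L x * norm (LINT s:{0..t}|lebesgue. duh t x s) \<le> \<kappa> * S * exp (\<mu> * t) * \<mu> powr (- 1 / 4) * (4 * T powr (1 / 4))"
proof -
  let ?C = "oker_const TYPE('n)" and ?D = "CARD('n) + 1" and ?W = "wint TYPE('n)"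
  \<comment> \<open>The two terms of \<open>trunc_weight_kernel\<close>: the weight at scale \<rho>
    has mass of order (\<nu> (t - s)) powr (-1/2), while the weight at scale 1 has constant mass,
    estimated by the same singularity through 1 \<le> sqrt T * (t - s) powr (-1/2).\<close>
  define E where "E = (1 + 2 ^ ?D) / sqrt \<nu> + 2 ^ ?D * sqrt T"
  have E: "E \<ge> 0" using \<nu> T by (simp add: E_def)
  have C: "?C \<ge> 0" by (rule oker_le(1)[OF card])
  have tw: "trunc_weight L x > 0" using trunc_weight_pos[OF L] .
  have \<kappa>: "\<kappa> = real CARD('n) ^ 3 * (?C * B * ?W * E)" by (simp add: \<kappa>_def E_def)
  have \<kappa>0: "\<kappa> \<ge> 0" unfolding \<kappa> using C B E wint_nonneg[where 'n = 'n] by simp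
  have ck: "\<bar>cker i j k t x s\<bar> \<le> ?C * B * ?W * E * (S * exp (\<mu> * s)) * (t - s) powr (- 1 / 2) / trunc_weight L x"
    if s: "s \<in> {0..<t}" for i j k s
  proof -
    have s': "s \<in> {0..T}" "s < t" using s t by auto
    have \<tau>: "\<nu> * (t - s) > 0" using s' \<nu> by simp
    define \<rho> where "\<rho> = sqrt (\<nu> * (t - s))"
    have \<rho>: "\<rho> > 0" using \<tau> by (simp add: \<rho>_def)
    let ?g = "\<lambda>y. ?C * B * (S * exp (\<mu> * s)) * ((1 + 2 ^ ?D) * wgt \<rho> (x - y) + 2 ^ ?D * wgt 1 y)"
    have gi: "integrable lebesgue ?g"
      by (intro integrable_mult_right Bochner_Integration.integrable_add wgt_shift \<rho> wgt_lebesgue)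
    have le: "AE y in lebesgue. norm (trunc_weight L x * (oker (\<nu> * (t - s)) i j k (x - y) *\<^sub>R (u s y $ i * u s y $ j))) \<le> ?g y"
      using bound[OF s'(1)] bd[OF s'(1)]
    proof eventually_elim
      case (elim y)
      \<comment> \<open>One factor of the quadratic term is spent on the uniform bound, so the final
        estimate is linear in S.\<close>
      have "\<bar>u s y $ i * u s y $ j\<bar> \<le> B * norm (u s y)"
        by (rule order_trans[OF prod_le mult_right_mono[OF elim(1)]]) simp
      then have "\<bar>oker (\<nu> * (t - s)) i j k (x - y)\<bar> * \<bar>u s y $ i * u s y $ j\<bar> \<le> (?C * wgt \<rho> (x - y)) * (B * norm (u s y))"
        using oker_le(2)[OF card \<tau>, of i j k "x - y"] wgt_nonneg[of \<rho> "x - y"] \<rho> C unfolding \<rho>_def[symmetric]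
        by (intro mult_mono) auto
      then have "trunc_weight L x * (\<bar>oker (\<nu> * (t - s)) i j k (x - y)\<bar> * \<bar>u s y $ i * u s y $ j\<bar>) \<le> trunc_weight L x * ((?C * wgt \<rho> (x - y)) * (B * norm (u s y)))"
        using tw by (intro mult_left_mono) auto
      also have "\<dots> = ?C * B * norm (u s y) * (trunc_weight L x * wgt \<rho> (x - y))" by (simp only: mult_ac)
      also have "\<dots> \<le> ?C * B * norm (u s y) * (trunc_weight L y * ((1 + 2 ^ ?D) * wgt \<rho> (x - y) + 2 ^ ?D * wgt 1 y))"
        using C B by (intro mult_left_mono trunc_weight_kernel \<rho> L) auto
      also have "\<dots> = ?C * B * (trunc_weight L y * norm (u s y)) * ((1 + 2 ^ ?D) * wgt \<rho> (x - y) + 2 ^ ?D * wgt 1 y)"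
        by (simp only: mult_ac)
      also have "\<dots> \<le> ?g y"
        using elim(2) C B \<rho> by (intro mult_right_mono mult_left_mono add_nonneg_nonneg mult_nonneg_nonneg wgt_nonneg) auto
      finally show ?case using tw by (simp add: abs_mult)
    qed
    have "trunc_weight L x * \<bar>cker i j k t x s\<bar> = norm (LINT y|lebesgue. trunc_weight L x * (oker (\<nu> * (t - s)) i j k (x - y) *\<^sub>R (u s y $ i * u s y $ j)))"
      using tw by (simp only: cker_def integral_mult_right_zero real_norm_def abs_mult abs_of_pos)
    also have "\<dots> \<le> (LINT y|lebesgue. norm (trunc_weight L x * (oker (\<nu> * (t - s)) i j k (x - y) *\<^sub>R (u s y $ i * u s y $ j))))"
      by (rule integral_norm_bound)
    also have "\<dots> \<le> (LINT y|lebesgue. ?g y)"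
      by (rule integral_mono_AE'[OF gi le eventually_mono[OF le order_trans[OF norm_ge_zero]]])
    also have "\<dots> = ?C * B * (S * exp (\<mu> * s)) * ((1 + 2 ^ ?D) * (?W / \<rho>) + 2 ^ ?D * ?W)"
      using wgt_shift[OF \<rho>, of x] wgt_lebesgue[where 'n = 'n] by simp
    also have "\<dots> \<le> ?C * B * (S * exp (\<mu> * s)) * (?W * E * (t - s) powr (- 1 / 2))"
    proof (intro mult_left_mono)
      have "?W / \<rho> = ?W / sqrt \<nu> * (t - s) powr (- 1 / 2)"
        unfolding \<rho>_def using s' by (intro inverse_sqrt_powr \<nu>) auto
      moreover have "?W * 1 \<le> ?W * (sqrt T * (t - s) powr (- 1 / 2))"
        using s' t wint_nonneg[where 'n = 'n] by (intro mult_left_mono one_le_sqrt_powr) auto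
      ultimately have "(1 + 2 ^ ?D) * (?W / \<rho>) + 2 ^ ?D * ?W \<le> (1 + 2 ^ ?D) * (?W / sqrt \<nu> * (t - s) powr (- 1 / 2)) + 2 ^ ?D * (?W * (sqrt T * (t - s) powr (- 1 / 2)))"
        by (intro add_mono mult_left_mono) auto
      also have "\<dots> = ?W * E * (t - s) powr (- 1 / 2)" unfolding E_def by (simp add: algebra_simps)
      finally show "(1 + 2 ^ ?D) * (?W / \<rho>) + 2 ^ ?D * ?W \<le> ?W * E * (t - s) powr (- 1 / 2)" .
    qed (use C B S in auto)
    finally show ?thesis using tw by (simp add: field_simps)
  qed
  have nd: "norm (duh t x s) \<le> (\<kappa> * S * exp (\<mu> * t) * \<mu> powr (- 1 / 4) / trunc_weight L x) * (t - s) powr (- 3 / 4)" if s: "s \<in> {0..<t}" for s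
  proof -
    have "norm (duh t x s) \<le> real CARD('n) ^ 3 * (?C * B * ?W * E * (S * exp (\<mu> * s)) * (t - s) powr (- 1 / 2) / trunc_weight L x)"
      using s t by (intro duh_norm_le ck) auto
    also have "\<dots> = \<kappa> * S / trunc_weight L x * (exp (\<mu> * s) * (t - s) powr (- 1 / 2))"
      by (simp add: \<kappa>)
    also have "\<dots> \<le> \<kappa> * S / trunc_weight L x * (exp (\<mu> * t) * \<mu> powr (- 1 / 4) * (t - s) powr (- 3 / 4))"
    proof (intro mult_left_mono)
      define r where "r = t - s"
      have r: "r > 0" using s by (simp add: r_def)
      \<comment> \<open>Trading the power 1/4 leaves (t - s) powr (-3/4), which is still integrable,
        and produces \<mu> powr (-1/4), which is small for large \<mu>.\<close>
      have "(\<mu> * r) powr (1 / 4) \<le> exp (\<mu> * r)"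
      proof (cases "\<mu> * r \<le> 1")
        case True
        then have "(\<mu> * r) powr (1 / 4) \<le> 1" using \<mu> r by (intro powr_le1) auto
        also have "1 \<le> exp (\<mu> * r)" using \<mu> r by simp
        finally show ?thesis .
      next
        case False
        then have "(\<mu> * r) powr (1 / 4) \<le> (\<mu> * r) powr 1" by (intro powr_mono) auto
        also have "\<dots> \<le> exp (\<mu> * r)" 
        proof -
          have "(\<mu> * r) powr 1 = \<mu> * r" using \<mu> r by simp
          then show ?thesis using exp_ge_add_one_self[of "\<mu> * r"] by linarith
        qed
        finally show ?thesis .
      qed
      then have "inverse (exp (\<mu> * r)) \<le> inverse ((\<mu> * r) powr (1 / 4))"
        using \<mu> r by (intro le_imp_inverse_le) auto
      then have e: "exp (- (\<mu> * r)) \<le> \<mu> powr (- 1 / 4) * r powr (- 1 / 4)"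
        using \<mu> r powr_minus[of "\<mu> * r" "1 / 4"] by (simp add: exp_minus powr_mult)
      have "exp (\<mu> * s) = exp (\<mu> * t) * exp (- (\<mu> * r))"
        by (simp add: r_def algebra_simps flip: exp_add)
      then have "exp (\<mu> * s) * r powr (- 1 / 2) \<le> exp (\<mu> * t) * (\<mu> powr (- 1 / 4) * r powr (- 1 / 4)) * r powr (- 1 / 2)"
        using e by (intro mult_right_mono) auto
      also have "\<dots> = exp (\<mu> * t) * \<mu> powr (- 1 / 4) * (r powr (- 1 / 4) * r powr (- 1 / 2))" by simp
      also have "r powr (- 1 / 4) * r powr (- 1 / 2) = r powr (- 3 / 4)" by (simp flip: powr_add)
      finally show "exp (\<mu> * s) * (t - s) powr (- 1 / 2) \<le> exp (\<mu> * t) * \<mu> powr (- 1 / 4) * (t - s) powr (- 3 / 4)"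
        by (simp only: r_def)
    qed (use \<kappa>0 S tw in auto)
    finally show ?thesis by (simp add: mult_ac)
  qed
  have "norm (LINT s:{0..t}|lebesgue. duh t x s) \<le> (LINT s:{0..t}|lebesgue. (\<kappa> * S * exp (\<mu> * t) * \<mu> powr (- 1 / 4) / trunc_weight L x) * (t - s) powr (- 3 / 4))"
    by (rule time_integral_bound(2)[OF duh_continuous_time])
      (use t nd time_powr(1)[of "-3/4" t] in auto)
  also have "\<dots> = (\<kappa> * S * exp (\<mu> * t) * \<mu> powr (- 1 / 4) / trunc_weight L x) * (4 * t powr (1 / 4))"
    using time_powr(2)[of "-3/4" t] t by simp
  also have "\<dots> \<le> (\<kappa> * S * exp (\<mu> * t) * \<mu> powr (- 1 / 4) / trunc_weight L x) * (4 * T powr (1 / 4))"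
    using t \<kappa>0 S tw by (intro mult_left_mono powr_mono2) auto
  finally show ?thesis using tw by (simp add: field_simps)
qed

text \<open>A weighted bound S improves to C0 + S / 2. Truncation supplies the finite starting value
  L B; after enough iterations the bound is 2 C0 + 1, independent of L, and L tends to
  infinity.\<close>

lemma decay:
  assumes sol: "\<And>t. t \<in> {0<..T} \<Longrightarrow> AE x in lebesgue. u t x = h t x - (LINT s:{0..t}|lebesgue. duh t x s)"
    and h: "\<And>t x. t \<in> {0<..T} \<Longrightarrow> (1 + norm x) ^ (CARD('n) + 1) * norm (h t x) \<le> C0"
    and u0: "AE x in lebesgue. (1 + norm x) ^ (CARD('n) + 1) * norm (u 0 x) \<le> C0"
    and C0: "C0 \<ge> 0"
  shows "\<exists>A\<ge>0. \<forall>s\<in>{0..T}. AE y in lebesgue. norm (u s y) \<le> A * wgt 1 y"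
proof -
  define \<kappa> where "\<kappa> = real CARD('n) ^ 3 * (oker_const TYPE('n) * B * wint TYPE('n) * ((1 + 2 ^ (CARD('n) + 1)) / sqrt \<nu> + 2 ^ (CARD('n) + 1) * sqrt T))"
  have \<kappa>: "\<kappa> \<ge> 0" unfolding \<kappa>_def using B wint_nonneg[where 'n = 'n] oker_le(1)[OF card] \<nu> T by simp
  \<comment> \<open>Chosen so that the fourth root of \<mu> is 8 (\<kappa> + 1) (T + 1) powr (1/4),
    which makes the factor of \<open>decay_step\<close> at most 1/2; the added ones keep \<mu>
    positive if \<kappa> or T vanishes.\<close>
  define \<mu> where "\<mu> = (8 * (\<kappa> + 1)) ^ 4 * (T + 1)"
  have \<mu>: "\<mu> > 0" unfolding \<mu>_def using \<kappa> T by (intro mult_pos_pos zero_less_power) auto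
  have half: "\<kappa> * \<mu> powr (- 1 / 4) * (4 * T powr (1 / 4)) \<le> 1 / 2"
  proof -
    have "\<mu> powr (1 / 4) = 8 * (\<kappa> + 1) * (T + 1) powr (1 / 4)"
    proof -
      define q where "q = 8 * (\<kappa> + 1)"
      have q: "q > 0" using \<kappa> by (simp add: q_def)
      have "(q ^ 4) powr (1 / 4) = (q powr real (4::nat)) powr (1 / 4)"
        by (simp only: powr_realpow[OF q])
      also have "\<dots> = q" unfolding powr_powr using q by simp
      finally have "((8 * (\<kappa> + 1)) ^ 4) powr (1 / 4) = 8 * (\<kappa> + 1)" unfolding q_def .
      then show ?thesis unfolding \<mu>_def using \<kappa> T by (subst powr_mult) auto
    qed
    moreover have "T powr (1 / 4) \<le> (T + 1) powr (1 / 4)" using T by (intro powr_mono2) auto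
    ultimately have "8 * (\<kappa> + 1) * T powr (1 / 4) \<le> \<mu> powr (1 / 4)" using \<kappa> by (simp add: mult_left_mono)
    moreover have "\<kappa> * T powr (1 / 4) \<le> (\<kappa> + 1) * T powr (1 / 4)" by (intro mult_right_mono) auto
    ultimately have "8 * (\<kappa> * T powr (1 / 4)) \<le> \<mu> powr (1 / 4)" by linarith
    moreover have "\<mu> powr (1 / 4) > 0" using \<mu> by simp
    moreover have "\<mu> powr (- 1 / 4) = 1 / \<mu> powr (1 / 4)"
      using powr_minus_divide[of \<mu> "1 / 4"] by (simp only: minus_divide_left)
    moreover have "\<kappa> * (1 / q) * (4 * X) \<le> 1 / 2" if "8 * (\<kappa> * X) \<le> q" "q > 0" for q X
      using that by (simp add: field_simps)
    ultimately show ?thesis by (simp only:)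
  qed
  define bd where "bd L S \<longleftrightarrow> (\<forall>s\<in>{0..T}. AE y in lebesgue. trunc_weight L y * norm (u s y) \<le> S * exp (\<mu> * s))" for L S
  have step: "bd L (C0 + S / 2)" if L: "L \<ge> 1" and S: "S \<ge> 0" and b: "bd L S" for L S
    unfolding bd_def
  proof
    fix t assume t: "t \<in> {0..T}"
    have et: "exp (\<mu> * t) \<ge> 1" using \<mu> t by simp
    have tw: "trunc_weight L x \<le> (1 + norm x) ^ (CARD('n) + 1)" for x :: "real^'n" by (simp add: trunc_weight_def)
    show "AE x in lebesgue. trunc_weight L x * norm (u t x) \<le> (C0 + S / 2) * exp (\<mu> * t)"
    proof (cases "t = 0")
      case True
      show ?thesis unfolding True using u0
      proof eventually_elim
        case (elim x)
        have "trunc_weight L x * norm (u 0 x) \<le> (1 + norm x) ^ (CARD('n) + 1) * norm (u 0 x)"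
          by (intro mult_right_mono tw) auto
        then show ?case using elim S by simp
      qed
    next
      case False
      then have t': "t \<in> {0<..T}" using t by auto
      show ?thesis using sol[OF t']
      proof eventually_elim
        case (elim x)
        have "trunc_weight L x * norm (u t x) \<le> trunc_weight L x * (norm (h t x) + norm (LINT s:{0..t}|lebesgue. duh t x s))"
          unfolding elim using trunc_weight_pos[OF L, of x] by (intro mult_left_mono norm_triangle_ineq4) auto
        also have "\<dots> = trunc_weight L x * norm (h t x) + trunc_weight L x * norm (LINT s:{0..t}|lebesgue. duh t x s)"
          by (simp add: distrib_left)
        also have "trunc_weight L x * norm (h t x) \<le> C0"
          by (rule order_trans[OF mult_right_mono[OF tw] h[OF t']]) auto
        also have "trunc_weight L x * norm (LINT s:{0..t}|lebesgue. duh t x s) \<le> \<kappa> * S * exp (\<mu> * t) * \<mu> powr (- 1 / 4) * (4 * T powr (1 / 4))"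
          unfolding \<kappa>_def by (rule decay_step[OF L \<mu> S t']) (use b in \<open>auto simp: bd_def\<close>)
        also have "\<dots> = (S * exp (\<mu> * t)) * (\<kappa> * \<mu> powr (- 1 / 4) * (4 * T powr (1 / 4)))" by simp
        also have "\<dots> \<le> (S * exp (\<mu> * t)) * (1 / 2)" using S by (intro mult_left_mono half) auto
        also have "C0 + (S * exp (\<mu> * t)) * (1 / 2) \<le> (C0 + S / 2) * exp (\<mu> * t)"
          using mult_left_mono[OF et C0] by (simp add: distrib_right)
        finally show ?case by simp
      qed
    qed
  qed
  have bd2: "bd L (2 * C0 + 1)" if L: "L \<ge> 1" for L
  proof -
    \<comment> \<open>2 C0 is the fixed point of S \<mapsto> C0 + S / 2, and the distance to it is
      halved in each step.\<close>
    have "bd L (2 * C0 + L * B / 2 ^ n)" for n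
    proof (induction n)
      case 0
      show ?case unfolding bd_def
      proof
        fix s assume s: "s \<in> {0..T}"
        show "AE y in lebesgue. trunc_weight L y * norm (u s y) \<le> (2 * C0 + L * B / 2 ^ 0) * exp (\<mu> * s)"
          using bound[OF s]
        proof eventually_elim
          case (elim y)
          have "trunc_weight L y * norm (u s y) \<le> L * B"
            using elim L by (intro mult_mono) (auto simp: trunc_weight_def)
          also have "\<dots> \<le> (2 * C0 + L * B / 2 ^ 0) * 1" using C0 by simp
          also have "\<dots> \<le> (2 * C0 + L * B / 2 ^ 0) * exp (\<mu> * s)"
            using C0 L B \<mu> s by (intro mult_left_mono) auto
          finally show ?case .
        qed
      qed
    next
      case (Suc n)
      have "bd L (C0 + (2 * C0 + L * B / 2 ^ n) / 2)"
        using C0 L B by (intro step Suc.IH L) auto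
      then show ?case by (simp add: add_divide_distrib mult.commute)
    qed
    moreover obtain n where "L * B / 2 ^ n \<le> 1"
    proof -
      obtain n :: nat where n: "L * B < 2 ^ n" using real_arch_pow[of 2 "L * B"] by auto
      then have "L * B / 2 ^ n \<le> 1" by simp
      then show ?thesis by (rule that)
    qed
    ultimately have b: "bd L (2 * C0 + L * B / 2 ^ n)" and n: "L * B / 2 ^ n \<le> 1" by auto
    have "(2 * C0 + L * B / 2 ^ n) * exp (\<mu> * s) \<le> (2 * C0 + 1) * exp (\<mu> * s)" for s
      using n by (intro mult_right_mono) auto
    then show ?thesis using b unfolding bd_def by (blast intro: eventually_mono order_trans)
  qed
  define A where "A = (2 * C0 + 1) * exp (\<mu> * T)"
  show ?thesis
  proof (intro exI[of _ A] conjI ballI)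
    show "A \<ge> 0" using C0 by (simp add: A_def)
    fix s assume s: "s \<in> {0..T}"
    \<comment> \<open>The cap runs through positive integers only, so that the exceptional sets
      remain countable in number.\<close>
    have "AE y in lebesgue. \<forall>n. trunc_weight (real (Suc n)) y * norm (u s y) \<le> (2 * C0 + 1) * exp (\<mu> * s)"
      unfolding AE_all_countable using bd2 s by (auto simp: bd_def)
    then show "AE y in lebesgue. norm (u s y) \<le> A * wgt 1 y"
    proof eventually_elim
      case (elim y)
      obtain n :: nat where "(1 + norm y) ^ (CARD('n) + 1) \<le> real n" using real_arch_simple by blast
      then have "trunc_weight (real (Suc n)) y = (1 + norm y) ^ (CARD('n) + 1)"
        by (simp add: trunc_weight_def min_def del: power_Suc)
      then have "(1 + norm y) ^ (CARD('n) + 1) * norm (u s y) \<le> (2 * C0 + 1) * exp (\<mu> * s)"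
        using elim[rule_format, of n] by simp
      also have "\<dots> \<le> A" unfolding A_def using s \<mu> C0 by (intro mult_left_mono) auto
      finally have "(1 + norm y) ^ (CARD('n) + 1) * norm (u s y) \<le> A" .
      moreover have "(1 + norm y) ^ (CARD('n) + 1) > 0" by (intro zero_less_power add_pos_nonneg) auto
      ultimately have "norm (u s y) \<le> A / (1 + norm y) ^ (CARD('n) + 1)"
        by (simp only: pos_le_divide_eq mult.commute)
      then show ?case by (simp only: wgt_def times_divide_eq_right mult_1_right)
    qed
  qed
qed

end

section \<open>The remainder\<close>

text \<open>For |x| \<le> 2 |y| a term of order l < m, of size |y| ^ l / |x| powi (a + l), is raised
  to order m by estimating |x| ^ (m - l) by (2 |y|) ^ (m - l).\<close>

lemma homog_taylor_poly_bound:
  fixes f :: "real^'n::finite \<Rightarrow> real"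
  assumes f: "homog a f"
  shows "\<exists>C\<ge>0. \<forall>x y. x \<noteq> 0 \<and> norm x \<le> 2 * norm y \<longrightarrow> \<bar>taylor_poly m f x y\<bar> \<le> C * norm y ^ m / norm x powi (a + int m)"
proof -
  let ?A = "{\<alpha> :: 'n \<Rightarrow> nat. multi_order \<alpha> < m}"
  have "\<exists>C\<ge>0. \<forall>x. x \<noteq> 0 \<longrightarrow> \<bar>multi_partial \<alpha> f x\<bar> \<le> C * norm x powi (- (a + int (multi_order \<alpha>)))" for \<alpha>
    using homog_bound[OF homog_multi_partial[OF f]] .
  then obtain C where C: "\<And>\<alpha>. C \<alpha> \<ge> 0"
    "\<And>\<alpha> x. x \<noteq> 0 \<Longrightarrow> \<bar>multi_partial \<alpha> f x\<bar> \<le> C \<alpha> * norm x powi (- (a + int (multi_order \<alpha>)))" by metis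
  have "\<bar>taylor_poly m f x y\<bar> \<le> (\<Sum>\<alpha>\<in>?A. C \<alpha> * 2 ^ m / multi_fact \<alpha>) * norm y ^ m / norm x powi (a + int m)"
    if x: "x \<noteq> 0" and xy: "norm x \<le> 2 * norm y" for x y
  proof -
    have nx: "norm x > 0" using x by simp
    have "\<bar>taylor_poly m f x y\<bar> \<le> (\<Sum>\<alpha>\<in>?A. \<bar>multi_power y \<alpha>\<bar> * \<bar>multi_partial \<alpha> f x\<bar> / multi_fact \<alpha>)"
      unfolding taylor_poly_def
      by (intro order_trans[OF sum_abs] sum_mono) (simp add: abs_mult power_abs abs_of_pos[OF multi_fact_pos])
    also have "\<dots> \<le> (\<Sum>\<alpha>\<in>?A. C \<alpha> * 2 ^ m * (norm y ^ m / norm x powi (a + int m)) / multi_fact \<alpha>)"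
    proof (intro sum_mono divide_right_mono)
      fix \<alpha> assume \<alpha>: "\<alpha> \<in> ?A"
      define l where "l = multi_order \<alpha>"
      have l: "l < m" using \<alpha> by (simp add: l_def)
      have "\<bar>multi_power y \<alpha>\<bar> * \<bar>multi_partial \<alpha> f x\<bar> \<le> norm y ^ l * (C \<alpha> * norm x powi (- (a + int l)))"
        unfolding l_def using C x by (intro mult_mono multi_power_bound) auto
      also have "norm x powi (- (a + int l)) = norm x powi (int (m - l) + - (a + int m))"
        using l by (intro arg_cong[where f = "(powi) (norm x)"]) (simp add: of_nat_diff)
      also have "\<dots> = norm x ^ (m - l) / norm x powi (a + int m)"
        by (subst power_int_add) (use x in simp, simp only: power_int_minus power_int_of_nat divide_inverse)
      also have "norm y ^ l * (C \<alpha> * (norm x ^ (m - l) / norm x powi (a + int m))) \<le> norm y ^ l * (C \<alpha> * ((2 ^ m * norm y ^ (m - l)) / norm x powi (a + int m)))"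
      proof (intro mult_left_mono divide_right_mono)
        have "norm x ^ (m - l) \<le> (2 * norm y) ^ (m - l)" using xy by (intro power_mono) auto
        also have "\<dots> = 2 ^ (m - l) * norm y ^ (m - l)" by (simp add: power_mult_distrib)
        also have "\<dots> \<le> 2 ^ m * norm y ^ (m - l)" by (intro mult_right_mono power_increasing) auto
        finally show "norm x ^ (m - l) \<le> 2 ^ m * norm y ^ (m - l)" .
      qed (use C nx in auto)
      also have "\<dots> = C \<alpha> * 2 ^ m * ((norm y ^ l * norm y ^ (m - l)) / norm x powi (a + int m))"
        by simp
      also have "norm y ^ l * norm y ^ (m - l) = norm y ^ m" using l by (simp flip: power_add)
      finally show "\<bar>multi_power y \<alpha>\<bar> * \<bar>multi_partial \<alpha> f x\<bar> \<le> C \<alpha> * 2 ^ m * (norm y ^ m / norm x powi (a + int m))" .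
      show "0 \<le> multi_fact \<alpha>" using multi_fact_pos[of \<alpha>] by simp
    qed
    also have "\<dots> = (\<Sum>\<alpha>\<in>?A. C \<alpha> * 2 ^ m / multi_fact \<alpha>) * norm y ^ m / norm x powi (a + int m)"
      unfolding sum_distrib_right sum_divide_distrib by (intro sum.cong refl) (simp add: mult.commute)
    finally show ?thesis .
  qed
  moreover have "(\<Sum>\<alpha>\<in>?A. C \<alpha> * 2 ^ m / multi_fact \<alpha>) \<ge> 0"
    using C multi_fact_pos by (intro sum_nonneg divide_nonneg_pos) auto
  ultimately show ?thesis by blast
qed

text \<open>The two factors \<open>wgt 1 y\<close> stand for u \<otimes> u. For small y one of them
  pays for |y| ^ d and the other stays for integrability. For 2 |y| > |x| the kernel may peak at y =
  x, so its own weight is kept for integrability and both factors \<open>wgt 1 y\<close> are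
  converted into |x| ^ (-2 d - 2); the Taylor polynomial is treated as for small y.\<close>

lemma oker_taylor_bound:
  assumes d: "CARD('n::finite) \<ge> 2" and T: "T \<ge> 0"
  shows "\<exists>C\<ge>0. \<forall>\<tau> x y. 0 < \<tau> \<and> \<tau> \<le> T \<and> norm x \<ge> 1 \<longrightarrow>
    \<bar>oker \<tau> i j k (x - y) - taylor_poly CARD('n) (partial k (K_ker i j)) x y\<bar> * (wgt 1 y * wgt 1 y)
      \<le> C / norm x ^ (2 * CARD('n) + 1) * (wgt 1 y + wgt (sqrt \<tau>) (x - y :: real^'n))"
proof -
  let ?d = "CARD('n)" and ?f = "partial k (K_ker i j) :: real^'n \<Rightarrow> real"
  have f: "homog (int ?d + 1) ?f" by (rule homog_K_ker(2)[OF d])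
  have pw: "r powi (int ?d + 1 + int ?d) = r ^ (2 * ?d + 1)" for r :: real
  proof -
    have "int ?d + 1 + int ?d = int (2 * ?d + 1)" by simp
    then show ?thesis by (simp only: power_int_of_nat)
  qed
  obtain C1 where C1: "C1 \<ge> 0" "\<And>x y. x \<noteq> 0 \<Longrightarrow> 2 * norm y \<le> norm x \<Longrightarrow>
      \<bar>?f (x - y) - taylor_poly ?d ?f x y\<bar> \<le> C1 * norm y ^ ?d / norm x ^ (2 * ?d + 1)"
    using homog_taylor_bound[OF f, of ?d] unfolding pw by auto
  obtain C2 where C2: "C2 \<ge> 0" "\<And>x y. x \<noteq> 0 \<Longrightarrow> norm x \<le> 2 * norm y \<Longrightarrow>
      \<bar>taylor_poly ?d ?f x y\<bar> \<le> C2 * norm y ^ ?d / norm x ^ (2 * ?d + 1)"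
    using homog_taylor_poly_bound[OF f, of ?d] unfolding pw by auto
  \<comment> \<open>N = d gives decay of order 3 d + 1, which is at least the required 2 d + 1
    because |x| \<ge> 1.\<close>
  obtain C3 where C3: "C3 \<ge> 0" "\<And>\<tau> x. \<tau> > 0 \<Longrightarrow> x \<noteq> 0 \<Longrightarrow>
      \<bar>oker \<tau> i j k x - ?f x\<bar> \<le> C3 * \<tau> ^ ?d / norm x ^ (?d + 1 + 2 * ?d)"
    using oker_diff[OF d, of ?d] by blast
  let ?C4 = "oker_const TYPE('n)"
  have C4: "?C4 \<ge> 0" by (rule oker_le(1)[OF d])
  define C where "C = C1 + C2 + C3 * T ^ ?d * 2 ^ (?d + 1 + 2 * ?d) + ?C4 * 2 ^ (2 * ?d + 2)"
  have C: "C \<ge> 0" "C1 + C3 * T ^ ?d * 2 ^ (?d + 1 + 2 * ?d) \<le> C" "C2 \<le> C" "?C4 * 2 ^ (2 * ?d + 2) \<le> C"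
    unfolding C_def using C1(1) C2(1) C3(1) C4 T by simp_all
  show ?thesis
  proof (intro exI[of _ C] conjI allI impI, goal_cases)
    case 1
    show ?case by (rule C(1))
  next
    case (2 \<tau> x y)
    then have \<tau>: "\<tau> > 0" "\<tau> \<le> T" and x: "norm x \<ge> 1" "x \<noteq> 0" "norm x > 0" by auto
    let ?P = "taylor_poly ?d ?f x y" and ?W = "wgt 1 y" and ?V = "wgt (sqrt \<tau>) (x - y)" and ?N = "norm x ^ (2 * ?d + 1)"
    have W: "0 \<le> ?W" "?W \<le> 1" by (auto simp: wgt_nonneg wgt_one_le)
    have V: "0 \<le> ?V" using \<tau> by (simp add: wgt_nonneg)
    have N: "?N > 0" using x by simp
    have yW: "norm y ^ ?d * ?W \<le> 1" by (rule norm_power_wgt_le) simp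
    show ?case
    proof (cases "2 * norm y \<le> norm x")
      case True
      have half: "norm x / 2 \<le> norm (x - y)" using True norm_triangle_ineq2[of x y] by linarith
      then have "x - y \<noteq> 0" using x by auto
      have "\<bar>oker \<tau> i j k (x - y) - ?f (x - y)\<bar> \<le> C3 * \<tau> ^ ?d / norm (x - y) ^ (?d + 1 + 2 * ?d)"
        by (rule C3(2)[OF \<tau>(1) \<open>x - y \<noteq> 0\<close>])
      also have "\<dots> \<le> C3 * T ^ ?d / (norm x / 2) ^ (?d + 1 + 2 * ?d)"
        using half x \<tau> C3(1) T by (intro frac_le mult_left_mono power_mono) auto
      also have "\<dots> = C3 * T ^ ?d * 2 ^ (?d + 1 + 2 * ?d) / norm x ^ (?d + 1 + 2 * ?d)"
        by (simp only: power_divide divide_divide_eq_right)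
      also have "\<dots> \<le> C3 * T ^ ?d * 2 ^ (?d + 1 + 2 * ?d) / ?N"
        using x C3(1) T by (intro divide_left_mono power_increasing mult_pos_pos) auto
      finally have 1: "\<bar>oker \<tau> i j k (x - y) - ?f (x - y)\<bar> \<le> C3 * T ^ ?d * 2 ^ (?d + 1 + 2 * ?d) / ?N" .
      have "\<bar>oker \<tau> i j k (x - y) - ?P\<bar> * (?W * ?W) \<le> (\<bar>oker \<tau> i j k (x - y) - ?f (x - y)\<bar> + \<bar>?f (x - y) - ?P\<bar>) * (?W * ?W)"
        using W by (intro mult_right_mono) auto
      also have "\<dots> \<le> (C3 * T ^ ?d * 2 ^ (?d + 1 + 2 * ?d) / ?N + C1 * norm y ^ ?d / ?N) * (?W * ?W)"
        using W by (intro mult_right_mono add_mono 1 C1(2) x True) auto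
      also have "\<dots> = (C3 * T ^ ?d * 2 ^ (?d + 1 + 2 * ?d) * ?W + C1 * (norm y ^ ?d * ?W)) / ?N * ?W"
        by (simp add: algebra_simps add_divide_distrib del: power_Suc)
      also have "\<dots> \<le> (C3 * T ^ ?d * 2 ^ (?d + 1 + 2 * ?d) * 1 + C1 * 1) / ?N * ?W"
        using W N C1(1) C3(1) T yW by (intro mult_right_mono divide_right_mono add_mono mult_left_mono) auto
      also have "\<dots> \<le> C / ?N * ?W"
        using C(2) N W by (intro mult_right_mono divide_right_mono) auto
      also have "\<dots> \<le> C / ?N * (?W + ?V)"
        using C(1) N V by (intro mult_left_mono) auto
      finally show ?thesis .
    next
      case False
      then have xy: "norm x \<le> 2 * norm y" by simp
      have Wx: "?W \<le> 2 ^ (?d + 1) / norm x ^ (?d + 1)"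
      proof -
        have "?W \<le> 1 / (norm x / 2) ^ (?d + 1)"
          unfolding wgt_def using xy x by (intro divide_left_mono power_mono mult_pos_pos zero_less_power) (auto simp: add_pos_nonneg)
        then show ?thesis by (simp only: power_divide divide_divide_eq_right mult_1)
      qed
      have "?W * ?W \<le> (2 ^ (?d + 1) / norm x ^ (?d + 1)) * (2 ^ (?d + 1) / norm x ^ (?d + 1))"
        using Wx W by (intro mult_mono) auto
      also have "\<dots> = 2 ^ (2 * ?d + 2) / norm x ^ (2 * ?d + 2)"
        by (simp only: times_divide_times_eq power_add[symmetric]) (simp add: mult_2 del: power_Suc)
      also have "\<dots> \<le> 2 ^ (2 * ?d + 2) / ?N"
        using x by (intro divide_left_mono power_increasing mult_pos_pos) auto
      finally have WW: "?W * ?W \<le> 2 ^ (2 * ?d + 2) / ?N" .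
      have "\<bar>oker \<tau> i j k (x - y) - ?P\<bar> * (?W * ?W) \<le> \<bar>oker \<tau> i j k (x - y)\<bar> * (?W * ?W) + \<bar>?P\<bar> * (?W * ?W)"
        using W unfolding distrib_right[symmetric] by (intro mult_right_mono abs_triangle_ineq4) auto
      also have "\<dots> \<le> (?C4 * ?V) * (2 ^ (2 * ?d + 2) / ?N) + (C2 * norm y ^ ?d / ?N) * (?W * ?W)"
        using W V C4 by (intro add_mono mult_mono WW oker_le(2)[OF d \<tau>(1)] C2(2) x xy mult_nonneg_nonneg mult_right_mono) auto
      also have "\<dots> = (?C4 * 2 ^ (2 * ?d + 2)) / ?N * ?V + C2 * (norm y ^ ?d * ?W) / ?N * ?W"
        by (simp only: times_divide_eq_right times_divide_eq_left mult_ac)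
      also have "\<dots> \<le> C / ?N * ?V + C2 * 1 / ?N * ?W"
        using C(4) C2(1) N V W yW by (intro add_mono mult_right_mono divide_right_mono mult_left_mono) auto
      also have "\<dots> \<le> C / ?N * ?V + C / ?N * ?W"
        using C(3) N W by (intro add_mono order_refl mult_right_mono divide_right_mono) auto
      finally show ?thesis by (simp only: distrib_left add.commute)
    qed
  qed
qed

section \<open>Comparison of the Duhamel term with the moment expansion\<close>

context linf_path
begin

lemma moment_integrable:
  assumes dec: "AE y in lebesgue. norm (u s y) \<le> A * wgt 1 y" and s: "s \<in> {0..T}" and A: "A \<ge> 0"
    and \<alpha>: "multi_order \<alpha> \<le> CARD('n) - 1"
  shows "(\<lambda>y. multi_power y \<alpha> * (u s y $ i) * (u s y $ j)) \<in> borel_measurable lebesgue"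
    and "AE y in lebesgue. norm (multi_power y \<alpha> * (u s y $ i) * (u s y $ j)) \<le> A * A * wgt 1 y"
    and "integrable lebesgue (\<lambda>y. multi_power y \<alpha> * (u s y $ i) * (u s y $ j))"
proof -
  have "(\<lambda>y. multi_power y \<alpha>) \<in> borel_measurable borel"
    unfolding multi_power_def by (intro borel_measurable_continuous_onI continuous_intros)
  then have "(\<lambda>y. multi_power y \<alpha> * (u s y $ i * u s y $ j)) \<in> borel_measurable lebesgue"
    by (intro borel_measurable_times prod_meas s measurable_completion) simp
  then show m: "(\<lambda>y. multi_power y \<alpha> * (u s y $ i) * (u s y $ j)) \<in> borel_measurable lebesgue"
    by (simp add: mult.assoc)
  show le: "AE y in lebesgue. norm (multi_power y \<alpha> * (u s y $ i) * (u s y $ j)) \<le> A * A * wgt 1 y"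
    using dec
  proof eventually_elim
    case (elim y)
    have "norm (multi_power y \<alpha> * (u s y $ i) * (u s y $ j)) = \<bar>multi_power y \<alpha>\<bar> * \<bar>u s y $ i * u s y $ j\<bar>"
      by (simp add: abs_mult)
    also have "\<dots> \<le> norm y ^ multi_order \<alpha> * ((A * wgt 1 y) * (A * wgt 1 y))"
      using elim by (intro mult_mono multi_power_bound order_trans[OF prod_le]) (auto simp: A wgt_nonneg)
    also have "\<dots> = A * A * (norm y ^ multi_order \<alpha> * wgt 1 y) * wgt 1 y" by (simp add: mult_ac)
    also have "\<dots> \<le> A * A * 1 * wgt 1 y"
      using A \<alpha> by (intro mult_right_mono mult_left_mono norm_power_wgt_le) (auto simp: wgt_nonneg)
    finally show ?case by simp
  qed
  show "integrable lebesgue (\<lambda>y. multi_power y \<alpha> * (u s y $ i) * (u s y $ j))"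
    by (rule Bochner_Integration.integrable_bound[OF integrable_mult_right[OF wgt_lebesgue(1), of "A * A"] m])
      (use le in \<open>auto elim!: eventually_mono intro: order_trans[OF _ abs_ge_self]\<close>)
qed

lemma moment_continuous:
  assumes dec: "\<And>s. s \<in> {0..T} \<Longrightarrow> AE y in lebesgue. norm (u s y) \<le> A * wgt 1 y" and A: "A \<ge> 0"
    and \<alpha>: "multi_order \<alpha> \<le> CARD('n) - 1"
  shows "continuous_on {0..T} (moment u \<alpha> i j)"
  unfolding moment_def[abs_def]
proof (rule continuous_on_integral_dominated)
  show "integrable lebesgue (\<lambda>y::real^'n. A * A * wgt 1 y)" by (intro integrable_mult_right wgt_lebesgue)
  fix \<sigma> s assume "\<And>n. \<sigma> n \<in> {0..T}" "s \<in> {0..T}" "\<sigma> \<longlonglongrightarrow> s"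
  then have "AE y in lebesgue. (\<lambda>n. u (\<sigma> n) y) \<longlonglongrightarrow> u s y" by (rule cont)
  then show "AE y in lebesgue. (\<lambda>n. multi_power y \<alpha> * u (\<sigma> n) y $ i * u (\<sigma> n) y $ j) \<longlonglongrightarrow> multi_power y \<alpha> * u s y $ i * u s y $ j"
    by eventually_elim (intro tendsto_mult tendsto_vec_nth tendsto_const)
qed (use moment_integrable[OF dec _ A \<alpha>] in auto)

text \<open>The leading part of \<open>duh t x s\<close>. It does not involve t, since the kernel
  has been replaced by its limit at time zero; the minus sign of Duhamel's formula is left
  outside.\<close>

definition tay :: "real^'n \<Rightarrow> real \<Rightarrow> real^'n" where
  "tay x s = (\<Sum>\<alpha> | multi_order \<alpha> \<le> CARD('n) - 1. ((-1) ^ multi_order \<alpha> / multi_fact \<alpha>) *\<^sub>R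
      (\<Sum>i\<in>UNIV. \<Sum>j\<in>UNIV. moment u \<alpha> i j s *\<^sub>R gradient (multi_partial \<alpha> (K_ker i j)) x))"

lemma tay_continuous:
  assumes dec: "\<And>s. s \<in> {0..T} \<Longrightarrow> AE y in lebesgue. norm (u s y) \<le> A * wgt 1 y" and A: "A \<ge> 0"
  shows "continuous_on {0..T} (tay x)"
  unfolding tay_def[abs_def] by (intro continuous_intros moment_continuous[OF dec A]) auto

lemma tay_integral:
  assumes dec: "\<And>s. s \<in> {0..T} \<Longrightarrow> AE y in lebesgue. norm (u s y) \<le> A * wgt 1 y" and A: "A \<ge> 0"
    and t: "t \<in> {0..T}"
  shows "set_integrable lebesgue {0..t} (tay x)"
    and "(LINT s:{0..t}|lebesgue. tay x s) = (\<Sum>\<alpha> | multi_order \<alpha> \<le> CARD('n) - 1. ((-1) ^ multi_order \<alpha> / multi_fact \<alpha>) *\<^sub>R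
      (\<Sum>i\<in>UNIV. \<Sum>j\<in>UNIV. (LINT s:{0..t}|lebesgue. moment u \<alpha> i j s) *\<^sub>R gradient (multi_partial \<alpha> (K_ker i j)) x))"
proof -
  have m: "set_integrable lebesgue {0..t} (moment u \<alpha> i j)" if "multi_order \<alpha> \<le> CARD('n) - 1" for \<alpha> i j
  proof -
    have c: "continuous_on {0..t} (moment u \<alpha> i j)"
      by (rule continuous_on_subset[OF moment_continuous[OF dec A that]]) (use t in auto)
    have "set_integrable lborel {0..t} (moment u \<alpha> i j)"
      by (rule borel_integrable_atLeastAtMost'[OF c])
    then show ?thesis unfolding set_integrable_def
      by (subst integrable_completion) (auto intro!: borel_measurable_continuous_on_indicator[OF _ c, simplified])
  qed
  have e: "(\<lambda>s. indicator {0..t} s *\<^sub>R tay x s) = (\<lambda>s. \<Sum>\<alpha> | multi_order \<alpha> \<le> CARD('n) - 1. ((-1) ^ multi_order \<alpha> / multi_fact \<alpha>) *\<^sub>R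
      (\<Sum>i\<in>UNIV. \<Sum>j\<in>UNIV. (indicator {0..t} s *\<^sub>R moment u \<alpha> i j s) *\<^sub>R gradient (multi_partial \<alpha> (K_ker i j)) x))"
    by (simp add: fun_eq_iff tay_def scaleR_sum_right mult_ac)
  have "has_bochner_integral lebesgue (\<lambda>s. indicator {0..t} s *\<^sub>R tay x s)
     (\<Sum>\<alpha> | multi_order \<alpha> \<le> CARD('n) - 1. ((-1) ^ multi_order \<alpha> / multi_fact \<alpha>) *\<^sub>R
      (\<Sum>i\<in>UNIV. \<Sum>j\<in>UNIV. (LINT s:{0..t}|lebesgue. moment u \<alpha> i j s) *\<^sub>R gradient (multi_partial \<alpha> (K_ker i j)) x))"
    unfolding e
    by (intro has_bochner_integral_sum has_bochner_integral_scaleR_right has_bochner_integral_scaleR_left)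
      (use m in \<open>auto simp: set_lebesgue_integral_def set_integrable_def has_bochner_integral_iff\<close>)
  then show "set_integrable lebesgue {0..t} (tay x)"
    and "(LINT s:{0..t}|lebesgue. tay x s) = (\<Sum>\<alpha> | multi_order \<alpha> \<le> CARD('n) - 1. ((-1) ^ multi_order \<alpha> / multi_fact \<alpha>) *\<^sub>R
      (\<Sum>i\<in>UNIV. \<Sum>j\<in>UNIV. (LINT s:{0..t}|lebesgue. moment u \<alpha> i j s) *\<^sub>R gradient (multi_partial \<alpha> (K_ker i j)) x))"
    by (auto simp: has_bochner_integral_iff set_integrable_def set_lebesgue_integral_def)
qed

lemma taylor_moment:
  assumes dec: "AE y in lebesgue. norm (u s y) \<le> A * wgt 1 y" and s: "s \<in> {0..T}" and A: "A \<ge> 0"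
  shows "has_bochner_integral lebesgue (\<lambda>y. taylor_poly CARD('n) f x y * (u s y $ i * u s y $ j))
    (\<Sum>\<alpha> | multi_order \<alpha> \<le> CARD('n) - 1. ((-1) ^ multi_order \<alpha> / multi_fact \<alpha>) * (moment u \<alpha> i j s * multi_partial \<alpha> f x))"
proof -
  have S: "{\<alpha> :: 'n \<Rightarrow> nat. multi_order \<alpha> < CARD('n)} = {\<alpha>. multi_order \<alpha> \<le> CARD('n) - 1}"
    using card by auto
  have e: "taylor_poly CARD('n) f x y * (u s y $ i * u s y $ j) = (\<Sum>\<alpha> | multi_order \<alpha> \<le> CARD('n) - 1. ((-1) ^ multi_order \<alpha> / multi_fact \<alpha>) *
     (multi_power y \<alpha> * (u s y $ i) * (u s y $ j) * multi_partial \<alpha> f x))" for y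
    unfolding taylor_poly_def S sum_distrib_right by (intro sum.cong refl) (simp add: mult_ac)
  show ?thesis unfolding e
    by (intro has_bochner_integral_sum has_bochner_integral_mult_right has_bochner_integral_mult_left)
      (use moment_integrable(3)[OF dec s A] in \<open>auto simp: moment_def has_bochner_integral_iff\<close>)
qed

text \<open>\<open>tay\<close> contains the gradient of \<partial>^\<alpha> K_ij, the Taylor
  polynomial contains \<partial>^\<alpha> of \<partial>_k K_ij. These agree away from the origin,
  which puts the difference under one integral.\<close>

lemma duh_minus_tay:
  assumes dec: "AE y in lebesgue. norm (u s y) \<le> A * wgt 1 y" and s: "s \<in> {0..T}" "s < t" and A: "A \<ge> 0"
    and x: "x \<noteq> 0"
  shows "duh t x s - tay x s = (\<chi> k. \<Sum>i\<in>UNIV. \<Sum>j\<in>UNIV. LINT y|lebesgue.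
     (oker (\<nu> * (t - s)) i j k (x - y) - taylor_poly CARD('n) (partial k (K_ker i j)) x y) * (u s y $ i * u s y $ j))"
proof -
  have "(LINT y|lebesgue. (oker (\<nu> * (t - s)) i j k (x - y) - taylor_poly CARD('n) (partial k (K_ker i j)) x y) * (u s y $ i * u s y $ j)) =
     cker i j k t x s - (\<Sum>\<alpha> | multi_order \<alpha> \<le> CARD('n) - 1. ((-1) ^ multi_order \<alpha> / multi_fact \<alpha>) * (moment u \<alpha> i j s * multi_partial \<alpha> (partial k (K_ker i j)) x))"
    for i j k
    using cker_conv(1)[OF s, of i j k x] taylor_moment[OF dec s(1) A, of "partial k (K_ker i j)" x i j]
    unfolding left_diff_distrib by (simp add: has_bochner_integral_iff cker_def)
  moreover have "tay x s $ k = (\<Sum>i\<in>UNIV. \<Sum>j\<in>UNIV. \<Sum>\<alpha> | multi_order \<alpha> \<le> CARD('n) - 1. ((-1) ^ multi_order \<alpha> / multi_fact \<alpha>) * (moment u \<alpha> i j s * multi_partial \<alpha> (partial k (K_ker i j)) x))" for k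
  proof -
    have "tay x s $ k = (\<Sum>\<alpha> | multi_order \<alpha> \<le> CARD('n) - 1. \<Sum>i\<in>UNIV. \<Sum>j\<in>UNIV. ((-1) ^ multi_order \<alpha> / multi_fact \<alpha>) * (moment u \<alpha> i j s * multi_partial \<alpha> (partial k (K_ker i j)) x))"
      by (simp add: tay_def gradient_def sum_distrib_left partial_multi_partial(1)[OF homog_K_ker(1)[OF card] x])
    also have "\<dots> = (\<Sum>i\<in>UNIV. \<Sum>\<alpha> | multi_order \<alpha> \<le> CARD('n) - 1. \<Sum>j\<in>UNIV. ((-1) ^ multi_order \<alpha> / multi_fact \<alpha>) * (moment u \<alpha> i j s * multi_partial \<alpha> (partial k (K_ker i j)) x))"
      by (rule sum.swap)
    also have "\<dots> = (\<Sum>i\<in>UNIV. \<Sum>j\<in>UNIV. \<Sum>\<alpha> | multi_order \<alpha> \<le> CARD('n) - 1. ((-1) ^ multi_order \<alpha> / multi_fact \<alpha>) * (moment u \<alpha> i j s * multi_partial \<alpha> (partial k (K_ker i j)) x))"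
      by (intro sum.cong refl sum.swap)
    finally show ?thesis .
  qed
  ultimately show ?thesis
    by (simp add: vec_eq_iff duh_eq[OF s(2)] sum_subtractf)
qed

text \<open>Integrating \<open>oker_taylor_bound\<close> over y leaves the masses of the two
  weights, together at most a multiple of (t - s) powr (-1/2), which is integrable in s uniformly
  for t \<le> T.\<close>

lemma duhamel_remainder:
  assumes dec: "\<And>s. s \<in> {0..T} \<Longrightarrow> AE y in lebesgue. norm (u s y) \<le> A * wgt 1 y" and A: "A \<ge> 0"
  shows "\<exists>D. \<forall>x t. norm x \<ge> 1 \<and> t \<in> {0..T} \<longrightarrow>
    norm ((LINT s:{0..t}|lebesgue. duh t x s) - (LINT s:{0..t}|lebesgue. tay x s)) \<le> D / norm x ^ (2 * CARD('n) + 1)"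
proof -
  let ?W = "wint TYPE('n)" and ?m = "2 * CARD('n) + 1"
  have "\<exists>C\<ge>0. \<forall>\<tau> x y. 0 < \<tau> \<and> \<tau> \<le> \<nu> * T \<and> norm x \<ge> 1 \<longrightarrow>
    \<bar>oker \<tau> i j k (x - y) - taylor_poly CARD('n) (partial k (K_ker i j)) x y\<bar> * (wgt 1 y * wgt 1 y)
      \<le> C / norm x ^ ?m * (wgt 1 y + wgt (sqrt \<tau>) (x - y :: real^'n))" for i j k
    by (rule oker_taylor_bound[OF card]) (use \<nu> T in simp)
  then obtain C where C: "\<And>i j k. C i j k \<ge> 0" "\<And>i j k \<tau> x y. 0 < \<tau> \<Longrightarrow> \<tau> \<le> \<nu> * T \<Longrightarrow> norm x \<ge> 1 \<Longrightarrow>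
    \<bar>oker \<tau> i j k (x - y) - taylor_poly CARD('n) (partial k (K_ker i j)) x y\<bar> * (wgt 1 y * wgt 1 y)
      \<le> C i j k / norm x ^ ?m * (wgt 1 y + wgt (sqrt \<tau>) (x - y :: real^'n))" by metis
  define CS where "CS = (\<Sum>k\<in>UNIV. \<Sum>i\<in>UNIV. \<Sum>j\<in>UNIV. C i j k)"
  \<comment> \<open>The first summand accounts for the weight at scale 1, the second for the weight
    at the scale of the kernel.\<close>
  define E where "E = sqrt T + 1 / sqrt \<nu>"
  define D where "D = A * A * CS * ?W * E"
  have CS: "CS \<ge> 0" unfolding CS_def by (intro sum_nonneg C)
  have E: "E \<ge> 0" unfolding E_def using T \<nu> by simp
  have D: "D \<ge> 0" unfolding D_def using A CS E wint_nonneg[where 'n = 'n] by simp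
  have pt: "norm (duh t x s - tay x s) \<le> D / norm x ^ ?m * (t - s) powr (- 1 / 2)"
    if x: "norm x \<ge> 1" and t: "t \<in> {0..T}" and s: "s \<in> {0..<t}" for x t s
  proof -
    have s': "s \<in> {0..T}" "s < t" and x0: "x \<noteq> 0" using x t s by auto
    have \<tau>: "0 < \<nu> * (t - s)" "\<nu> * (t - s) \<le> \<nu> * T" using s t \<nu> by auto
    define \<rho> where "\<rho> = sqrt (\<nu> * (t - s))"
    have \<rho>: "\<rho> > 0" using \<tau> by (simp add: \<rho>_def)
    have q: "\<bar>LINT y|lebesgue. (oker (\<nu> * (t - s)) i j k (x - y) - taylor_poly CARD('n) (partial k (K_ker i j)) x y) * (u s y $ i * u s y $ j)\<bar>
        \<le> C i j k * (A * A * ?W * E / norm x ^ ?m * (t - s) powr (- 1 / 2))" (is "\<bar>LINT y|lebesgue. ?F y\<bar> \<le> _") for i j k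
    proof -
      let ?g = "\<lambda>y. A * A * (C i j k / norm x ^ ?m * (wgt 1 y + wgt \<rho> (x - y)))"
      have gi: "integrable lebesgue ?g"
        by (intro integrable_mult_right Bochner_Integration.integrable_add wgt_shift \<rho> wgt_lebesgue)
      have le: "AE y in lebesgue. norm (?F y) \<le> ?g y"
        using dec[OF s'(1)]
      proof eventually_elim
        case (elim y)
        have "norm (?F y) \<le> \<bar>oker (\<nu> * (t - s)) i j k (x - y) - taylor_poly CARD('n) (partial k (K_ker i j)) x y\<bar> * ((A * wgt 1 y) * (A * wgt 1 y))"
          unfolding real_norm_def abs_mult[of "_ - _"] using elim
          by (intro mult_left_mono order_trans[OF prod_le] mult_mono) (auto simp: A wgt_nonneg)
        also have "\<dots> = A * A * (\<bar>oker (\<nu> * (t - s)) i j k (x - y) - taylor_poly CARD('n) (partial k (K_ker i j)) x y\<bar> * (wgt 1 y * wgt 1 y))"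
          by (simp only: mult_ac)
        also have "\<dots> \<le> ?g y"
          unfolding \<rho>_def using A by (intro mult_left_mono C(2) \<tau> x) auto
        finally show ?case .
      qed
      have "\<bar>LINT y|lebesgue. ?F y\<bar> \<le> (LINT y|lebesgue. norm (?F y))"
        unfolding real_norm_def[symmetric] by (rule integral_norm_bound)
      also have "\<dots> \<le> (LINT y|lebesgue. ?g y)"
        by (rule integral_mono_AE'[OF gi le eventually_mono[OF le order_trans[OF norm_ge_zero]]])
      also have "\<dots> = A * A * (C i j k / norm x ^ ?m * (?W + ?W / \<rho>))"
        using wgt_shift[OF \<rho>, of x] wgt_lebesgue[where 'n = 'n] by simp
      also have "\<dots> \<le> A * A * (C i j k / norm x ^ ?m * (?W * E * (t - s) powr (- 1 / 2)))"
      proof (intro mult_left_mono)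
        have "?W / \<rho> = ?W / sqrt \<nu> * (t - s) powr (- 1 / 2)"
          unfolding \<rho>_def using s' by (intro inverse_sqrt_powr \<nu>) auto
        moreover have "?W * 1 \<le> ?W * (sqrt T * (t - s) powr (- 1 / 2))"
          using s t wint_nonneg[where 'n = 'n] by (intro mult_left_mono one_le_sqrt_powr) auto
        moreover have "?W * E * (t - s) powr (- 1 / 2) = ?W * (sqrt T * (t - s) powr (- 1 / 2)) + ?W / sqrt \<nu> * (t - s) powr (- 1 / 2)"
          unfolding E_def by (simp add: algebra_simps)
        ultimately show "?W + ?W / \<rho> \<le> ?W * E * (t - s) powr (- 1 / 2)" by linarith
      qed (use A C(1)[of i j k] in auto)
      also have "\<dots> = C i j k * (A * A * ?W * E / norm x ^ ?m * (t - s) powr (- 1 / 2))"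
        by (simp only: times_divide_eq_right times_divide_eq_left mult_ac)
      finally show ?thesis .
    qed
    have "norm (duh t x s - tay x s) \<le> (\<Sum>k\<in>UNIV. \<Sum>i\<in>UNIV. \<Sum>j\<in>UNIV. C i j k * (A * A * ?W * E / norm x ^ ?m * (t - s) powr (- 1 / 2)))"
      unfolding duh_minus_tay[OF dec[OF s'(1)] s' A x0]
      by (rule order_trans[OF norm_vec_sum_le]) (intro sum_mono q)
    also have "\<dots> = CS * (A * A * ?W * E / norm x ^ ?m * (t - s) powr (- 1 / 2))"
      unfolding CS_def sum_distrib_right ..
    also have "\<dots> = D / norm x ^ ?m * (t - s) powr (- 1 / 2)"
      unfolding D_def by (simp only: times_divide_eq_right times_divide_eq_left mult_ac)
    finally show ?thesis .
  qed
  have "norm ((LINT s:{0..t}|lebesgue. duh t x s) - (LINT s:{0..t}|lebesgue. tay x s)) \<le> (D * (2 * sqrt T)) / norm x ^ ?m"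
    if x: "norm x \<ge> 1" and t: "t \<in> {0..T}" for x t
  proof -
    have "(LINT s:{0..t}|lebesgue. duh t x s) - (LINT s:{0..t}|lebesgue. tay x s) = (LINT s:{0..t}|lebesgue. duh t x s - tay x s)"
      by (rule set_integral_diff(2)[symmetric, OF duh_integrable[OF t] tay_integral(1)[OF dec A t]])
    also have "norm \<dots> \<le> (LINT s:{0..t}|lebesgue. D / norm x ^ ?m * (t - s) powr (- 1 / 2))"
    proof (rule time_integral_bound(2))
      show "continuous_on {0..<t} (\<lambda>s. duh t x s - tay x s)"
        using t by (intro continuous_intros duh_continuous_time continuous_on_subset[OF tay_continuous[OF dec A]]) auto
      show "set_integrable lebesgue {0..t} (\<lambda>s. D / norm x ^ ?m * (t - s) powr (- 1 / 2))"
        using time_powr(1)[of "-1/2" t] t by (intro set_integrable_mult_right) auto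
    qed (rule pt[OF x t])
    also have "\<dots> = D / norm x ^ ?m * (2 * sqrt t)"
      using time_powr(2)[of "-1/2" t] t by (simp add: powr_half_sqrt)
    also have "\<dots> \<le> D / norm x ^ ?m * (2 * sqrt T)"
      using D t by (intro mult_left_mono) auto
    finally show ?thesis by simp
  qed
  then show ?thesis by blast
qed

end

text \<open>As u(t) is determined only up to null sets, the pointwise formula is stated for a
  representative v, made unique at positive times by continuity. The formula itself merely defines
  R; the content lies in the decay of R, uniform on compact time intervals.\<close>

theorem theorem1p2:
  fixes \<nu> C \<sigma> :: real
    and u0 :: "real^'n::finite \<Rightarrow> real^'n"
    and u :: "real \<Rightarrow> real^'n \<Rightarrow> real^'n"
  assumes "CARD('n) \<ge> 2" and "\<nu> > 0" and "C > 0" and "\<sigma> > 0"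
    and "in_Linf u0"
    and "AE x in lebesgue. norm (u0 x) \<le> C * heat_kernel (\<nu> * \<sigma>) x"
    and "0 < max_lifespan \<nu> u0"
    and "strong_solution \<nu> u0 {t. 0 \<le> t \<and> ereal t < max_lifespan \<nu> u0} u"
  shows "\<exists>(v :: real \<Rightarrow> real^'n \<Rightarrow> real^'n) (R :: real^'n \<Rightarrow> real \<Rightarrow> real^'n).
    (\<forall>t. 0 \<le> t \<and> ereal t < max_lifespan \<nu> u0 \<longrightarrow> (AE x in lebesgue. v t x = u t x)) \<and>
    (\<forall>t. 0 < t \<and> ereal t < max_lifespan \<nu> u0 \<longrightarrow> continuous_on UNIV (v t)) \<and>
    (\<forall>x t. norm x \<ge> 1 \<and> 0 \<le> t \<and> ereal t < max_lifespan \<nu> u0 \<longrightarrow>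
       v t x =
         - (\<Sum>\<alpha> | multi_order \<alpha> \<le> CARD('n) - 1.
              ((-1) ^ multi_order \<alpha> / multi_fact \<alpha>) *\<^sub>R
              (\<Sum>i\<in>UNIV. \<Sum>j\<in>UNIV.
                 (LINT s:{0..t}|lebesgue. moment u \<alpha> i j s) *\<^sub>R
                 gradient (multi_partial \<alpha> (K_ker i j)) x))
         + R x t) \<and>
    (\<forall>T. 0 \<le> T \<and> ereal T < max_lifespan \<nu> u0 \<longrightarrow>
       (\<exists>A. \<forall>\<^sub>F x in at_infinity.
          (SUP t\<in>{0..T}. ereal (norm (R x t)))
            \<le> ereal (A * norm x powr (- (2 * real CARD('n) + 1)))))"
proof -
  note card = assms(1) and \<nu> = assms(2) and u0_bound = assms(6) and sol = assms(8)
  let ?I = "{t. 0 \<le> t \<and> ereal t < max_lifespan \<nu> u0}" and ?m = "2 * CARD('n) + 1"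
  define duhamel where "duhamel t x = (LINT s:{0..t}|lebesgue. heat_leray_div (\<nu> * (t - s)) (\<lambda>y. tensor (u s y) (u s y)) x)" for t x
  \<comment> \<open>At \<open>t = 0\<close> the remainder is \<open>v 0\<close> itself, so the Gaussian bound has to hold everywhere.\<close>
  define v where "v t x = (if t = 0 then (if norm (u0 x) \<le> C * heat_kernel (\<nu> * \<sigma>) x then u0 x else 0)
     else heat_conv (\<nu> * t) u0 x - duhamel t x)" for t x
  define P where "P x t = (\<Sum>\<alpha> | multi_order \<alpha> \<le> CARD('n) - 1. ((-1) ^ multi_order \<alpha> / multi_fact \<alpha>) *\<^sub>R
      (\<Sum>i\<in>UNIV. \<Sum>j\<in>UNIV. (LINT s:{0..t}|lebesgue. moment u \<alpha> i j s) *\<^sub>R gradient (multi_partial \<alpha> (K_ker i j)) x))" for x t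
  define R where "R x t = v t x + P x t" for x t
  define \<rho> where "\<rho> = sqrt (\<nu> * \<sigma>)"
  have \<rho>: "\<rho> > 0" "\<nu> * \<sigma> = \<rho>\<^sup>2" using assms(2,4) by (auto simp: \<rho>_def)
  \<comment> \<open>The Gaussian bound is weighted with the exponent 2 d + 1, so that the heat flow
    of the data can be absorbed entirely into the remainder.\<close>
  define M where "M = C * (2 ^ ?m * (gcon 0 * \<rho> ^ 0 / \<rho> ^ CARD('n) + gcon ?m * \<rho> ^ ?m / \<rho> ^ CARD('n)))"
  have M: "M \<ge> 0" unfolding M_def using \<rho> assms(3) by (simp add: gcon_nonneg)
  have gauss: "(1 + norm x) ^ ?m * (C * heat_kernel (\<nu> * \<sigma>) x) \<le> M" for x :: "real^'n"
  proof -
    have "(1 + norm x) ^ ?m * heat_kernel (\<nu> * \<sigma>) x \<le> (2 ^ ?m * (1 ^ ?m + norm x ^ ?m)) * heat_kernel (\<nu> * \<sigma>) x"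
      by (intro mult_right_mono power_sum_le heat_kernel_nonneg) auto
    also have "\<dots> = 2 ^ ?m * (norm x ^ 0 * heat_kernel (\<rho>\<^sup>2) x + norm x ^ ?m * heat_kernel (\<rho>\<^sup>2) x)"
      unfolding \<rho>(2) by (simp add: algebra_simps)
    also have "\<dots> \<le> 2 ^ ?m * (gcon 0 * \<rho> ^ 0 / \<rho> ^ CARD('n) + gcon ?m * \<rho> ^ ?m / \<rho> ^ CARD('n))"
      by (intro mult_left_mono add_mono heat_kernel_bound \<rho>) auto
    finally have "C * ((1 + norm x) ^ ?m * heat_kernel (\<nu> * \<sigma>) x) \<le> M"
      unfolding M_def using assms(3) by (intro mult_left_mono) auto
    then show ?thesis by (simp only: mult_ac)
  qed
  have p1: "1 \<le> (1 + norm x) ^ m" for x :: "real^'n" and m by (rule one_le_power) simp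
  have u0_dec: "(1 + norm x) ^ ?m * norm (u0 x) \<le> M" "norm (u0 x) \<le> M" if "norm (u0 x) \<le> C * heat_kernel (\<nu> * \<sigma>) x" for x
  proof -
    have "(1 + norm x) ^ ?m * norm (u0 x) \<le> (1 + norm x) ^ ?m * (C * heat_kernel (\<nu> * \<sigma>) x)"
      using that by (intro mult_left_mono) auto
    also have "\<dots> \<le> M" by (rule gauss)
    finally show *: "(1 + norm x) ^ ?m * norm (u0 x) \<le> M" .
    have "1 * norm (u0 x) \<le> (1 + norm x) ^ ?m * norm (u0 x)" by (intro mult_right_mono p1) auto
    then show "norm (u0 x) \<le> M" using * by linarith
  qed
  have u0M: "AE x in lebesgue. norm (u0 x) \<le> M" "AE x in lebesgue. (1 + norm x) ^ ?m * norm (u0 x) \<le> M"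
    using u0_bound by (auto elim!: eventually_mono dest: u0_dec)
  have u0_meas: "u0 \<in> borel_measurable lebesgue" using assms(5) by (simp add: in_Linf_def)
  have path: "\<exists>B. linf_path u \<nu> T B" if T: "T \<in> ?I" for T
  proof -
    have sub: "{0..T} \<subseteq> ?I" using T by (auto intro: le_less_trans[of "ereal _" "ereal T"])
    have lim: "((\<lambda>s. Linf_norm (\<lambda>x. u s x - u t x)) \<longlongrightarrow> 0) (at t within {0..T})" if "t \<in> {0..T}" for t
    proof (rule tendsto_within_subset[OF _ sub])
      show "((\<lambda>s. Linf_norm (\<lambda>x. u s x - u t x)) \<longlongrightarrow> 0) (at t within ?I)"
        using sol sub that unfolding strong_solution_def by auto
    qed
    have L: "in_Linf (u t)" if "t \<in> {0..T}" for t
      using sol sub that unfolding strong_solution_def by auto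
    obtain B where B: "B \<ge> 0" "\<And>t. t \<in> {0..T} \<Longrightarrow> AE x in lebesgue. norm (u t x) \<le> B"
      using AE_bounded_compact[OF L lim] by blast
    have "linf_path u \<nu> T B"
    proof
      show "u s \<in> borel_measurable lebesgue" if "s \<in> {0..T}" for s using L[OF that] by (simp add: in_Linf_def)
      show "AE y in lebesgue. (\<lambda>n. u (\<sigma> n) y) \<longlonglongrightarrow> u s y" if "\<And>n. \<sigma> n \<in> {0..T}" "s \<in> {0..T}" "\<sigma> \<longlonglongrightarrow> s" for \<sigma> s
        by (rule AE_tendsto_Linf[OF lim[OF that(2)] that(1,3)])
    qed (use card \<nu> B T in auto)
    then show ?thesis by blast
  qed
  have sol0: "AE x in lebesgue. u 0 x = u0 x" using sol by (simp add: strong_solution_def)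
  have solt: "AE x in lebesgue. u t x = heat_conv (\<nu> * t) u0 x - duhamel t x" if "t \<in> ?I" "0 < t" for t
    using sol that unfolding strong_solution_def duhamel_def by auto
  have v_eq: "AE x in lebesgue. v t x = u t x" if t: "t \<in> ?I" for t
  proof (cases "t = 0")
    case True
    show ?thesis using sol0 u0_bound by eventually_elim (simp add: True v_def)
  next
    case False
    then show ?thesis using solt[OF t] t by (auto simp: v_def elim!: eventually_mono)
  qed
  have v_cont: "continuous_on UNIV (v t)" if t: "t \<in> ?I" "0 < t" for t
  proof -
    obtain B where "linf_path u \<nu> t B" using path[OF t(1)] by blast
    then interpret linf_path u \<nu> t B .
    have "continuous_on UNIV (duhamel t)"
      using duh_integral_continuous[of t] t by (simp add: duhamel_def[abs_def] duh_def)
    moreover have "continuous_on UNIV (heat_conv (\<nu> * t) u0)"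
      by (rule continuous_heat_conv[OF _ u0_meas u0M(1)]) (use \<nu> t in simp)
    ultimately have "continuous_on UNIV (\<lambda>x. heat_conv (\<nu> * t) u0 x - duhamel t x)" by (intro continuous_on_diff)
    then show ?thesis using t(2) by (simp add: v_def[abs_def])
  qed
  have R_bound: "\<exists>A. \<forall>x t. norm x \<ge> 1 \<and> t \<in> {0..T} \<longrightarrow> norm (R x t) \<le> A / norm x ^ ?m" if T: "T \<in> ?I" for T
  proof -
    have sub: "t \<in> ?I" if "t \<in> {0..T}" for t
      using T that by (auto intro: le_less_trans[where y = "ereal T"])
    have T0: "T \<ge> 0" using T by simp
    obtain B where "linf_path u \<nu> T B" using path[OF T] by blast
    then interpret linf_path u \<nu> T B .
    have duhamel: "duhamel t x = (LINT s:{0..t}|lebesgue. duh t x s)" for t x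
      by (simp add: duhamel_def duh_def)
    obtain H where H: "\<And>\<tau> x. 0 < \<tau> \<Longrightarrow> \<tau> \<le> \<nu> * T \<Longrightarrow> (1 + norm x) ^ ?m * norm (heat_conv \<tau> u0 x) \<le> H"
      using heat_conv_decay[OF u0M M, of "\<nu> * T"] by blast
    \<comment> \<open>The decay estimate for u uses only d + 1 of the available 2 d + 1 powers; the
      full power is kept for the linear part of R.\<close>
    have pm: "(1 + norm x) ^ (CARD('n) + 1) \<le> (1 + norm x) ^ ?m" for x :: "real^'n"
      by (intro power_increasing) auto
    define C0 where "C0 = max M H"
    have "\<exists>A\<ge>0. \<forall>s\<in>{0..T}. AE y in lebesgue. norm (u s y) \<le> A * wgt 1 y"
    proof (rule decay[where h = "\<lambda>t. heat_conv (\<nu> * t) u0" and ?C0.0 = C0])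
      show "AE x in lebesgue. u t x = heat_conv (\<nu> * t) u0 x - (LINT s:{0..t}|lebesgue. duh t x s)" if "t \<in> {0<..T}" for t
        using solt[of t] sub[of t] that by (simp add: duhamel)
      show "(1 + norm x) ^ (CARD('n) + 1) * norm (heat_conv (\<nu> * t) u0 x) \<le> C0" if "t \<in> {0<..T}" for t x
      proof -
        have "(1 + norm x) ^ (CARD('n) + 1) * norm (heat_conv (\<nu> * t) u0 x) \<le> (1 + norm x) ^ ?m * norm (heat_conv (\<nu> * t) u0 x)"
          by (intro mult_right_mono pm) auto
        also have "\<dots> \<le> H" using that \<nu> by (intro H) auto
        finally show ?thesis by (simp add: C0_def)
      qed
      show "AE x in lebesgue. (1 + norm x) ^ (CARD('n) + 1) * norm (u 0 x) \<le> C0"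
        using sol0 u0M(2)
      proof eventually_elim
        case (elim x)
        have "(1 + norm x) ^ (CARD('n) + 1) * norm (u 0 x) \<le> (1 + norm x) ^ ?m * norm (u 0 x)"
          by (intro mult_right_mono pm) auto
        then show ?case using elim by (simp add: C0_def)
      qed
      show "C0 \<ge> 0" using M by (simp add: C0_def)
    qed
    then obtain A where A: "A \<ge> 0" "\<And>s. s \<in> {0..T} \<Longrightarrow> AE y in lebesgue. norm (u s y) \<le> A * wgt 1 y" by blast
    obtain D where D: "\<And>x t. norm x \<ge> 1 \<Longrightarrow> t \<in> {0..T} \<Longrightarrow>
      norm ((LINT s:{0..t}|lebesgue. duh t x s) - (LINT s:{0..t}|lebesgue. tay x s)) \<le> D / norm x ^ ?m"
      using duhamel_remainder[OF A(2,1)] by blast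
    have P: "P x t = (LINT s:{0..t}|lebesgue. tay x s)" if "t \<in> {0..T}" for x t
      unfolding P_def by (rule tay_integral(2)[OF A(2,1) that, symmetric])
    have pow: "a \<le> c / norm x ^ ?m" if "(1 + norm x) ^ ?m * a \<le> c" "norm x \<ge> 1" "a \<ge> 0" for a c and x :: "real^'n"
    proof -
      have "norm x ^ ?m * a \<le> (1 + norm x) ^ ?m * a" using that by (intro mult_right_mono power_mono) auto
      then have "a * norm x ^ ?m \<le> c" using that(1) by (simp only: mult.commute)
      moreover have "norm x ^ ?m > 0" using that(2) by (intro zero_less_power) auto
      ultimately show ?thesis by (simp only: pos_le_divide_eq)
    qed
    have "norm (R x t) \<le> (C0 + \<bar>D\<bar>) / norm x ^ ?m" if x: "norm x \<ge> 1" and t: "t \<in> {0..T}" for x t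
    proof (cases "t = 0")
      case True
      have "(LINT s:{0..0}|lebesgue. tay x s) = 0"
      proof -
        have "AE s in lebesgue. s \<noteq> (0::real)"
          using AE_lborel_singleton[of "0::real"] by (rule AE_completion)
        then show ?thesis unfolding set_lebesgue_integral_def
          by (intro integral_eq_zero_AE) (auto elim!: eventually_mono)
      qed
      then have "R x t = v 0 x" using True P[of 0] T0 by (simp add: R_def)
      also have "norm \<dots> \<le> M / norm x ^ ?m"
        using pow[OF u0_dec(1) x] x M by (auto simp: v_def)
      also have "\<dots> \<le> (C0 + \<bar>D\<bar>) / norm x ^ ?m" unfolding C0_def by (intro divide_right_mono) auto
      finally show ?thesis .
    next
      case False
      \<comment> \<open>The expansion cancels the leading part of the Duhamel integral; what remains
        is the linear evolution and the difference bounded by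
        \<open>duhamel_remainder\<close>.\<close>
      then have "R x t = heat_conv (\<nu> * t) u0 x - ((LINT s:{0..t}|lebesgue. duh t x s) - (LINT s:{0..t}|lebesgue. tay x s))"
        using t by (simp add: R_def v_def duhamel P)
      also have "norm \<dots> \<le> norm (heat_conv (\<nu> * t) u0 x) + norm ((LINT s:{0..t}|lebesgue. duh t x s) - (LINT s:{0..t}|lebesgue. tay x s))"
        by (rule norm_triangle_ineq4)
      also have "\<dots> \<le> H / norm x ^ ?m + D / norm x ^ ?m"
        using t False \<nu> by (intro add_mono D x pow H) auto
      also have "\<dots> = (H + D) / norm x ^ ?m" by (rule add_divide_distrib[symmetric])
      also have "\<dots> \<le> (C0 + \<bar>D\<bar>) / norm x ^ ?m" unfolding C0_def by (intro divide_right_mono add_mono) auto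
      finally show ?thesis .
    qed
    then show ?thesis by blast
  qed
  have sup: "\<exists>A. \<forall>\<^sub>F x in at_infinity. (SUP t\<in>{0..T}. ereal (norm (R x t))) \<le> ereal (A * norm x powr (- (2 * real CARD('n) + 1)))"
    if T: "T \<in> ?I" for T
  proof -
    obtain A where A: "\<And>x t. norm x \<ge> 1 \<Longrightarrow> t \<in> {0..T} \<Longrightarrow> norm (R x t) \<le> A / norm x ^ ?m"
      using R_bound[OF T] by blast
    have "(SUP t\<in>{0..T}. ereal (norm (R x t))) \<le> ereal (A * norm x powr (- (2 * real CARD('n) + 1)))" if x: "norm x \<ge> 1" for x
    proof (rule SUP_least)
      fix t assume "t \<in> {0..T}"
      from A[OF x this] have "norm (R x t) \<le> A / norm x ^ ?m" .
      also have "A / norm x ^ ?m = A * norm x powr (- (2 * real CARD('n) + 1))"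
      proof -
        have "norm x > 0" using x by linarith
        then have "norm x powr real ?m = norm x ^ ?m" by (rule powr_realpow)
        moreover have "real ?m = 2 * real CARD('n) + 1" by simp
        ultimately show ?thesis by (simp only: powr_minus_divide times_divide_eq_right mult_1_right)
      qed
      finally show "ereal (norm (R x t)) \<le> ereal (A * norm x powr (- (2 * real CARD('n) + 1)))" by simp
    qed
    then show ?thesis by (auto simp: eventually_at_infinity)
  qed
  show ?thesis
    by (rule exI[of _ v], rule exI[of _ R])
      (use v_eq v_cont sup in \<open>auto simp: R_def P_def\<close>)
qed

end
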